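(* There exist isomorphisms of $\mathbb Q(q)$-algebras: (a) $\mathbf f^\pi/(\pi+1)\cong\mathbf f^-$; (b) $\mathbf f^\pi/(\pi-1)\cong\mathbf f^+$.
   Context: $I=I_{\bar0}\sqcup I_{\bar1}$ is a finite $\mathbb Z_2$-graded set, with $p(i)=0$ for $i\in I_{\bar0}$ and $p(i)=1$ for $i\in I_{\bar1}$. $A=(a_{ij})_{i,j\in I}$ is a generalized Cartan matrix with: (C1) $a_{ii}=2$; (C2) $a_{ij}\in\mathbb Z_{\le0}$ for $i\neq j$; (C3) $a_{ij}=0$ iff $a_{ji}=0$; (C4) $a_{ij}\in2\mathbb Z$ for $i\in I_{\bar1}$, $j\in I$; (C5) there are positive integers $s_i$ ($i\in I$) with $\gcd=1$ such that $\mathrm{diag}(s_i)A$ is symmetric; (C6) $I_{\bar1}\ne\emptyset$, and $s_i$ is odd iff $i\in I_{\bar1}$. $Q^+=\bigoplus_{i\in I}\mathbb Z_{\ge0}\alpha_i$, with bilinear pairing $(\alpha_i,\alpha_j)=s_ia_{ij}$. For a ring $R$, $R^\pi=R[\pi]/(\pi^2-1)$. Set $q_i=q^{s_i}$, $\pi_i=\pi^{p(i)}$. ${}'\mathbf f^\pi$ is the free associative $\mathbb Q(q)^\pi$-algebra generated by $\theta_i$ ($i\in I$), $\theta_i$ having parity $p(i)$ and weight $\alpha_i$. ${}'\mathbf f^\pi\otimes{}'\mathbf f^\pi$ has the product $(x_1\otimes x_2)(x_1'\otimes x_2')=\pi^{p(x_2)p(x_1')}q^{-(|x_2|,|x_1'|)}x_1x_1'\otimes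 x_2x_2'$ for homogeneous elements, where $p(x)$ is parity and $|x|$ is weight; $r:{}'\mathbf f^\pi\to{}'\mathbf f^\pi\otimes{}'\mathbf f^\pi$ is the algebra homomorphism with $r(\theta_i)=\theta_i\otimes1+1\otimes\theta_i$. There is a unique bilinear form $(\cdot,\cdot):{}'\mathbf f^\pi\times{}'\mathbf f^\pi\to\mathbb Q(q)^\pi$, and it is symmetric, with $(1,1)=1$, $(\theta_i,\theta_j)=\delta_{ij}(1-\pi_iq_i^2)^{-1}$, $(x,y'y'')=(r(x),y'\otimes y'')$ and $(xx',y)=(x\otimes x',r(y))$, where $(x\otimes x',y\otimes y')=(x,y)(x',y')$. Define $\mathbf f^\pi={}'\mathbf f^\pi/\mathrm{Rad}(\cdot,\cdot)$ (half of the covering Kac-Moody algebra). Let $p(k;i,j)=kp(i)p(j)+\frac12k(k-1)p(i)$. $\mathbf f^-$ (half the quantum Kac-Moody superalgebra of $A$) is the $\mathbb Q(q)$-algebra generated by $\theta_i$ ($i\in I$), of parity $p(i)$, subject to the relations $\sum_{k=0}^{1-a_{ij}}(-1)^{k+p(k;i,j)}\theta_i^{(1-a_{ij}-k)}\theta_j\theta_i^{(k)}=0$ for $i\ne j$, where $\theta_i^{(k)}=\theta_i^k/[k]_i^-!$, $[k]_i^-=\frac{(-1)^{kp(i)}q_i^k-q_i^{-k}}{(-1)^{p(i)}q_i-q_i^{-1}}$, $[k]_i^-!=\prod_{b=1}^k[b]_i^-$. $\mathbf f^+$ (half the usual quantum Kac-Moody algebra of $A$ with parity forgotten, i.e. Lusztig's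 algebra) is the $\mathbb Q(q)$-algebra generated by $\theta_i$ ($i\in I$) subject to $\sum_{k=0}^{1-a_{ij}}(-1)^k\theta_i^{(1-a_{ij}-k)}\theta_j\theta_i^{(k)}=0$ for $i\ne j$, where $\theta_i^{(k)}=\theta_i^k/[k]_i^+!$, $[k]_i^+=\frac{q_i^k-q_i^{-k}}{q_i-q_i^{-1}}$. *)

theory Defs
  imports
    "HOL-Algebra.QuotRing"
    "HOL-Algebra.Module"
    "HOL-Library.Poly_Mapping"
    "HOL-Computational_Algebra.Polynomial"
    "HOL-Computational_Algebra.Fraction_Field"
begin

section \<open>The ring \<open>R\<^sup>\<pi> = R[\<pi>]/(\<pi>\<^sup>2 - 1)\<close>\<close>

quotient_type (overloaded) 'a pi_ext = "'a::comm_ring_1 poly" /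
  "\<lambda>f g. [:-1, 0, 1:] dvd f - g"
proof (rule equivpI)
  show "reflp (\<lambda>f g::'a poly. [:-1, 0, 1:] dvd f - g)"
    by (simp add: reflp_def)
  show "symp (\<lambda>f g::'a poly. [:-1, 0, 1:] dvd f - g)"
    by (metis (no_types, lifting) dvd_minus_iff minus_diff_eq sympI)
  show "transp (\<lambda>f g::'a poly. [:-1, 0, 1:] dvd f - g)"
    by (rule transpI) (metis (no_types, lifting) diff_add_cancel add_diff_eq dvd_add)
qed

instantiation pi_ext :: (comm_ring_1) comm_ring_1
begin

lift_definition zero_pi_ext :: "'a pi_ext" is 0 .
lift_definition one_pi_ext :: "'a pi_ext" is 1 .
lift_definition plus_pi_ext :: "'a pi_ext \<Rightarrow> 'a pi_ext \<Rightarrow> 'a pi_ext" is "(+)"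
  by (metis (no_types, lifting) add_diff_add dvd_add)
lift_definition uminus_pi_ext :: "'a pi_ext \<Rightarrow> 'a pi_ext" is uminus
  by (metis (no_types, lifting) dvd_minus_iff minus_diff_minus)
lift_definition minus_pi_ext :: "'a pi_ext \<Rightarrow> 'a pi_ext \<Rightarrow> 'a pi_ext" is "(-)"
proof -
  fix a b c d :: "'a poly"
  assume "[:-1, 0, 1:] dvd a - b" "[:-1, 0, 1:] dvd c - d"
  then have "[:-1, 0, 1:] dvd (a - b) - (c - d)" by (rule dvd_diff)
  then show "[:-1, 0, 1:] dvd (a - c) - (b - d)" by (simp add: algebra_simps)
qed
lift_definition times_pi_ext :: "'a pi_ext \<Rightarrow> 'a pi_ext \<Rightarrow> 'a pi_ext" is "(*)"
proof -
  fix a b c d :: "'a poly"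
  assume "[:-1, 0, 1:] dvd a - b" "[:-1, 0, 1:] dvd c - d"
  then have "[:-1, 0, 1:] dvd (a - b) * c + b * (c - d)"
    by (intro dvd_add dvd_mult dvd_mult2)
  then show "[:-1, 0, 1:] dvd a * c - b * d" by (simp add: algebra_simps)
qed

instance
proof
  show "(0::'a pi_ext) \<noteq> 1"
  proof (transfer, rule notI)
    assume "[:-1, 0, 1:] dvd (0::'a poly) - 1"
    then obtain k where "(0::'a poly) - 1 = [:-1, 0, 1:] * k" by (rule dvdE)
    then have "poly (0 - 1) (1::'a) = poly ([:-1, 0, 1:] * k) 1" by simp
    then show False by simp
  qed
qed (transfer, simp add: algebra_simps)+

end

lift_definition of_base :: "'a::comm_ring_1 \<Rightarrow> 'a pi_ext" is "\<lambda>c. [:c:]" .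

lift_definition cpi :: "'a::comm_ring_1 pi_ext" is "[:0, 1:]" .

lemma cpi_squared: "cpi ^ 2 = (1 :: 'a::comm_ring_1 pi_ext)"
  unfolding power2_eq_square
  by transfer (simp add: one_pCons)

lemma of_base_hom:
  "of_base 0 = 0" "of_base 1 = 1"
  "of_base (a + b) = of_base a + of_base b"
  "of_base (a * b) = of_base a * of_base b"
  by (transfer, simp add: one_pCons)+


section \<open>Algebras over a commutative ring, quotients and isomorphisms\<close>

text \<open>
  An algebra whose scalars are all elements of a type is represented by a record of type
  \<^typ>\<open>('k, 'a) module\<close>, which extends the ring record by a scalar multiplication.
\<close>

definition quot_alg :: "('k, 'a) module \<Rightarrow> 'a set \<Rightarrow> ('k, 'a set) module" where
  "quot_alg M J =
     ring.extend (M Quot J) (module.fields (\<lambda>c X. \<Union>x\<in>X. J +>\<^bsub>M\<^esub> (c \<odot>\<^bsub>M\<^esub> x)))"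

definition restrict_scalars :: "('l \<Rightarrow> 'k) \<Rightarrow> ('k, 'a) module \<Rightarrow> ('l, 'a) module" where
  "restrict_scalars h M =
     ring.extend (ring.truncate M) (module.fields (\<lambda>c x. h c \<odot>\<^bsub>M\<^esub> x))"

definition alg_iso :: "('k, 'a) module \<Rightarrow> ('k, 'b) module \<Rightarrow> ('a \<Rightarrow> 'b) set" where
  "alg_iso M N =
     {\<phi> \<in> ring_iso M N. \<forall>c. \<forall>x\<in>carrier M. \<phi> (c \<odot>\<^bsub>M\<^esub> x) = c \<odot>\<^bsub>N\<^esub> \<phi> x}"


section \<open>Free associative algebras\<close>

datatype 'i word = Word (letters: "'i list")

instantiation word :: (type) monoid_add
begin
definition "0 = Word []"
definition "u + v = Word (letters u @ letters v)"
instance by standard (simp_all add: zero_word_def plus_word_def)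
end

text \<open>
  The free associative \<open>'k\<close>-algebra on \<open>'i\<close> is the monoid algebra of the free monoid: its elements
  are the finitely supported functions on words, and \<^term>\<open>(*)\<close> is convolution with respect to
  concatenation, which is written additively.
\<close>

type_synonym ('i, 'k) free = "'i word \<Rightarrow>\<^sub>0 'k"

definition mon :: "'i word \<Rightarrow> ('i, 'k::comm_ring_1) free" where
  "mon w = Poly_Mapping.single w 1"

definition \<theta> :: "'i \<Rightarrow> ('i, 'k::comm_ring_1) free" where
  "\<theta> i = mon (Word [i])"

definition scale :: "'k \<Rightarrow> ('b \<Rightarrow>\<^sub>0 'k::comm_ring_1) \<Rightarrow> ('b \<Rightarrow>\<^sub>0 'k)" where
  "scale c = Poly_Mapping.map ((*) c)"

definition free_alg :: "('k::comm_ring_1, ('i, 'k) free) module" where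
  "free_alg = \<lparr>carrier = UNIV, monoid.mult = (*), one = 1, zero = 0, add = (+), module.smult = scale\<rparr>"


lemma scale_single: "scale c (Poly_Mapping.single b d) = Poly_Mapping.single b (c * d)"
  unfolding scale_def by (rule poly_mapping_eqI) (simp add: map.rep_eq lookup_single when_def)

lemma lookup_scale: "Poly_Mapping.lookup (scale c x) b = c * Poly_Mapping.lookup x b"
  unfolding scale_def by (simp add: map.rep_eq when_def)

lemma scale_add: "scale c (x + y) = scale c x + scale c y"
  by (rule poly_mapping_eqI) (simp add: lookup_scale lookup_add algebra_simps)

lemma scale_add_left: "scale (c + d) x = scale c x + scale d x"
  by (rule poly_mapping_eqI) (simp add: lookup_scale lookup_add algebra_simps)

lemma scale_scale: "scale c (scale d x) = scale (c * d) x"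
  by (rule poly_mapping_eqI) (simp add: lookup_scale algebra_simps)

lemma scale_0: "scale 0 x = 0"
  by (rule poly_mapping_eqI) (simp add: lookup_scale)

lemma single_add_induct [case_names single add]:
  assumes single: "\<And>b c. P (Poly_Mapping.single b (c::'k::comm_ring_1))"
    and add: "\<And>x y. P x \<Longrightarrow> P y \<Longrightarrow> P (x + y)"
  shows "P x"
proof -
  have "P (\<Sum>b\<in>S. Poly_Mapping.single b (Poly_Mapping.lookup x b))" if "finite S" for S
    using that
  proof induction
    case empty
    show ?case using single[of undefined 0] by simp
  qed (simp add: single add)
  moreover have "(\<Sum>b\<in>Poly_Mapping.keys x. Poly_Mapping.single b (Poly_Mapping.lookup x b)) = x"
    by (rule poly_mapping_eqI)
       (auto simp: lookup_sum lookup_single when_def sum.delta in_keys_iff)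
  ultimately show ?thesis by (metis finite_keys)
qed

lemma free_alg_ring: "ring free_alg"
proof (intro ringI abelian_groupI monoidI)
  show "\<exists>y\<in>carrier free_alg. y \<oplus>\<^bsub>free_alg\<^esub> x = \<zero>\<^bsub>free_alg\<^esub>"
    for x :: "('i, 'k::comm_ring_1) free"
    by (rule bexI[of _ "- x"]) (simp_all add: free_alg_def)
qed (simp_all add: free_alg_def algebra_simps)


section \<open>Cartan data\<close>

type_synonym Qq = "rat poly fract"

definition qvar :: Qq where
  "qvar = Fract [:0, 1:] 1"

text \<open>
  The set \<open>I\<close> is the finite type \<open>'i\<close>; \<open>odd_part\<close> is its odd part and \<open>A\<close>, \<open>s\<close> are as in
  (C1)--(C6).
\<close>

locale cartan_data =
  fixes A :: "'i::finite \<Rightarrow> 'i \<Rightarrow> int"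
    and s :: "'i \<Rightarrow> nat"
    and odd_part :: "'i set"
begin

definition p :: "'i \<Rightarrow> nat" where
  "p i = (if i \<in> odd_part then 1 else 0)"

definition q :: "'i \<Rightarrow> Qq" where
  "q i = qvar ^ s i"

text \<open>
  Parities of words are computed in \<open>\<nat>\<close> rather than modulo 2, which makes no difference since they
  are used as exponents of \<open>\<pi>\<close> only. Weights, elements of \<open>Q\<^sup>+\<close>, are functions on \<open>I\<close>.
\<close>

definition par :: "'i word \<Rightarrow> nat" where
  "par w = (\<Sum>i\<leftarrow>letters w. p i)"

definition wt :: "'i word \<Rightarrow> 'i \<Rightarrow> nat" where
  "wt w i = count_list (letters w) i"

definition pairing :: "('i \<Rightarrow> nat) \<Rightarrow> ('i \<Rightarrow> nat) \<Rightarrow> int" where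
  "pairing \<mu> \<nu> = (\<Sum>i\<in>UNIV. \<Sum>j\<in>UNIV. int (\<mu> i) * int (\<nu> j) * (int (s i) * A i j))"


subsection \<open>The algebra \<open>\<^bold>f\<^sup>\<pi>\<close>\<close>

text \<open>
  The tensor square of the free algebra is the free module on pairs of words, the pair \<open>(u, v)\<close>
  standing for \<open>u \<otimes> v\<close>.
\<close>

definition tensor ::
    "('i, Qq pi_ext) free \<Rightarrow> ('i, Qq pi_ext) free \<Rightarrow> ('i word \<times> 'i word \<Rightarrow>\<^sub>0 Qq pi_ext)" where
  "tensor x y =
     (\<Sum>u\<in>Poly_Mapping.keys x. \<Sum>v\<in>Poly_Mapping.keys y.
        Poly_Mapping.single (u, v) (Poly_Mapping.lookup x u * Poly_Mapping.lookup y v))"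

definition tcoeff :: "'i word \<times> 'i word \<Rightarrow> 'i word \<times> 'i word \<Rightarrow> Qq pi_ext" where
  "tcoeff a b =
     cpi ^ (par (snd a) * par (fst b)) *
     of_base (qvar powi (- pairing (wt (snd a)) (wt (fst b))))"

definition tmult ::
    "('i word \<times> 'i word \<Rightarrow>\<^sub>0 Qq pi_ext) \<Rightarrow> ('i word \<times> 'i word \<Rightarrow>\<^sub>0 Qq pi_ext) \<Rightarrow>
     ('i word \<times> 'i word \<Rightarrow>\<^sub>0 Qq pi_ext)" where
  "tmult X Y =
     (\<Sum>a\<in>Poly_Mapping.keys X. \<Sum>b\<in>Poly_Mapping.keys Y.
        Poly_Mapping.single (fst a + fst b, snd a + snd b)
          (Poly_Mapping.lookup X a * Poly_Mapping.lookup Y b * tcoeff a b))"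

fun r_word :: "'i list \<Rightarrow> ('i word \<times> 'i word \<Rightarrow>\<^sub>0 Qq pi_ext)" where
  "r_word [] = tensor 1 1"
| "r_word (i # w) = tmult (tensor (\<theta> i) 1 + tensor 1 (\<theta> i)) (r_word w)"

definition r :: "('i, Qq pi_ext) free \<Rightarrow> ('i word \<times> 'i word \<Rightarrow>\<^sub>0 Qq pi_ext)" where
  "r x = (\<Sum>w\<in>Poly_Mapping.keys x. scale (Poly_Mapping.lookup x w) (r_word (letters w)))"

text \<open>
  \<^const>\<open>r\<close>, defined on words by recursion, is indeed the algebra homomorphism into the twisted
  tensor square with the given values on generators.
\<close>

lemma tmult_add_left: "tmult (X + X') Y = tmult X Y + tmult X' Y"
  unfolding tmult_def
  by (rule setsum_keys_plus_distrib [where f = "\<lambda>a c. \<Sum>b\<in>Poly_Mapping.keys Y.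
        Poly_Mapping.single (fst a + fst b, snd a + snd b)
          (c * Poly_Mapping.lookup Y b * tcoeff a b)"])
     (simp_all add: algebra_simps single_add sum.distrib)

lemma tmult_add_right: "tmult X (Y + Y') = tmult X Y + tmult X Y'"
  unfolding tmult_def sum.distrib[symmetric]
  by (intro sum.cong refl setsum_keys_plus_distrib)
     (simp_all add: algebra_simps single_add sum.distrib)

lemma tmult_single:
  "tmult (Poly_Mapping.single a c) (Poly_Mapping.single b d) =
     Poly_Mapping.single (fst a + fst b, snd a + snd b) (c * d * tcoeff a b)"
  unfolding tmult_def by simp

lemma tmult_scale: "tmult (scale c X) Y = scale c (tmult X Y)" "tmult X (scale c Y) = scale c (tmult X Y)"
proof -
  have "tmult (scale c (Poly_Mapping.single a d)) Y = scale c (tmult (Poly_Mapping.single a d) Y)"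
    and "tmult (Poly_Mapping.single a d) (scale c Y) = scale c (tmult (Poly_Mapping.single a d) Y)"
    for a d
    by (induction Y rule: single_add_induct)
       (simp_all add: tmult_add_right tmult_single scale_add scale_single mult_ac)
  then show "tmult (scale c X) Y = scale c (tmult X Y)" "tmult X (scale c Y) = scale c (tmult X Y)"
    by (induction X rule: single_add_induct) (simp_all add: tmult_add_left scale_add)
qed

lemma par_plus: "par (u + v) = par u + par v"
  by (simp add: par_def plus_word_def)

lemma pairing_plus:
  "pairing (wt (u + v)) \<nu> = pairing (wt u) \<nu> + pairing (wt v) \<nu>"
  "pairing \<nu> (wt (u + v)) = pairing \<nu> (wt u) + pairing \<nu> (wt v)"
  by (simp_all add: pairing_def wt_def plus_word_def algebra_simps sum.distrib)

lemma qvar_nonzero: "qvar \<noteq> 0"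
  by (simp add: qvar_def Zero_fract_def eq_fract)

lemma tcoeff_plus:
  "tcoeff (a, u + v) (b, c) = tcoeff (a, u) (b, c) * tcoeff (a', v) (b, c')"
  "tcoeff (a, u) (b + b', c) = tcoeff (a, u) (b, c) * tcoeff (a', u) (b', c')"
  by (simp_all add: tcoeff_def par_plus pairing_plus power_add distrib_left distrib_right
      power_int_add qvar_nonzero power_int_diff of_base_hom(4)[symmetric] mult_ac)
     (simp_all add: of_base_hom(4) power_int_minus power_int_add qvar_nonzero divide_inverse mult_ac
       flip: power_int_minus)

lemma tmult_assoc: "tmult (tmult X Y) Z = tmult X (tmult Y Z)"
proof (induction X rule: single_add_induct)
  case (single a c)
  show ?case
  proof (induction Y rule: single_add_induct)
    case (single b d)
    show ?case
    proof (induction Z rule: single_add_induct)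
      case (single e f)
      obtain a1 a2 b1 b2 e1 e2 where *: "a = (a1, a2)" "b = (b1, b2)" "e = (e1, e2)"
        by (metis surj_pair)
      show ?case
        unfolding * by (simp add: tmult_single add.assoc tcoeff_plus(1)[where a' = b1 and c' = e2]
           tcoeff_plus(2)[where a' = a1 and c' = e2] mult_ac)
          (simp add: tcoeff_def mult_ac)
    qed (simp_all add: tmult_add_right)
  qed (simp_all add: tmult_add_right tmult_add_left)
qed (simp_all add: tmult_add_left)

lemma tensor_add: "tensor (x + x') y = tensor x y + tensor x' y" "tensor x (y + y') = tensor x y + tensor x y'"
  unfolding tensor_def
   apply (rule setsum_keys_plus_distrib [where f = "\<lambda>u c. \<Sum>v\<in>Poly_Mapping.keys y.
        Poly_Mapping.single (u, v) (c * Poly_Mapping.lookup y v)"])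
    apply (simp_all add: algebra_simps single_add sum.distrib)
  unfolding sum.distrib[symmetric]
  by (intro sum.cong refl setsum_keys_plus_distrib)
     (simp_all add: algebra_simps single_add sum.distrib)

lemma tensor_mon: "tensor (mon u) (mon v) = Poly_Mapping.single (u, v) 1"
  by (simp add: tensor_def mon_def)

lemma one_mon: "1 = mon 0"
  by (simp add: mon_def)

lemma tmult_1: "tmult (tensor 1 1) X = X" "tmult X (tensor 1 1) = X"
proof -
  have c: "tcoeff (0, 0) a = 1" "tcoeff a (0, 0) = 1" for a
    by (simp_all add: tcoeff_def par_def zero_word_def pairing_def wt_def of_base_hom)
  show "tmult (tensor 1 1) X = X" "tmult X (tensor 1 1) = X"
    unfolding one_mon tensor_mon
    by (induction X rule: single_add_induct)
       (simp_all add: tmult_single tmult_add_left tmult_add_right c)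
qed

lemma r_word_append: "r_word (u @ v) = tmult (r_word u) (r_word v)"
  by (induction u) (simp_all add: tmult_1 tmult_assoc)

lemma r_add: "r (x + y) = r x + r y"
  unfolding r_def by (rule setsum_keys_plus_distrib) (simp_all add: scale_0 scale_add_left)

lemma r_single: "r (Poly_Mapping.single w c) = scale c (r_word (letters w))"
  by (simp add: r_def scale_0)

theorem r_hom:
  "r (x + y) = r x + r y"
  "r (scale c x) = scale c (r x)"
  "r 1 = tensor 1 1"
  "r (x * y) = tmult (r x) (r y)"
  "r (\<theta> i) = tensor (\<theta> i) 1 + tensor 1 (\<theta> i)"
proof -
  have one: "scale 1 X = X" for X :: "'b \<Rightarrow>\<^sub>0 'k::comm_ring_1"
    by (rule poly_mapping_eqI) (simp add: lookup_scale)
  show "r (x + y) = r x + r y" by (rule r_add)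
  show "r (scale c x) = scale c (r x)"
    by (induction x rule: single_add_induct)
       (simp_all add: r_add scale_add r_single scale_single scale_scale)
  show "r 1 = tensor 1 1"
    unfolding one_mon mon_def r_single one by (simp add: zero_word_def one_mon mon_def)
  show "r (x * y) = tmult (r x) (r y)"
  proof (induction x rule: single_add_induct)
    case (single b c)
    show ?case
      by (induction y rule: single_add_induct)
         (simp_all add: r_add distrib_left tmult_add_right mult_single r_single plus_word_def
           r_word_append tmult_scale scale_scale mult_ac)
  qed (simp_all add: r_add distrib_right tmult_add_left)
  show "r (\<theta> i) = tensor (\<theta> i) 1 + tensor 1 (\<theta> i)"
    by (simp add: \<theta>_def mon_def r_single one) (simp add: tmult_1)
qed

definition tform ::
    "(('i, Qq pi_ext) free \<Rightarrow> ('i, Qq pi_ext) free \<Rightarrow> Qq pi_ext) \<Rightarrow>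
     ('i word \<times> 'i word \<Rightarrow>\<^sub>0 Qq pi_ext) \<Rightarrow> ('i word \<times> 'i word \<Rightarrow>\<^sub>0 Qq pi_ext) \<Rightarrow> Qq pi_ext" where
  "tform B X Y =
     (\<Sum>a\<in>Poly_Mapping.keys X. \<Sum>b\<in>Poly_Mapping.keys Y.
        Poly_Mapping.lookup X a * Poly_Mapping.lookup Y b *
        (B (mon (fst a)) (mon (fst b)) * B (mon (snd a)) (mon (snd b))))"

text \<open>
  The ring \<open>\<rat>(q)\<^sup>\<pi>\<close> is not a field; the fourth condition on the form says that \<open>(\<theta>\<^sub>i, \<theta>\<^sub>i)\<close> is the
  inverse of \<open>1 - \<pi>\<^sub>i q\<^sub>i\<^sup>2\<close>.
\<close>

definition is_form :: "(('i, Qq pi_ext) free \<Rightarrow> ('i, Qq pi_ext) free \<Rightarrow> Qq pi_ext) \<Rightarrow> bool" where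
  "is_form B \<longleftrightarrow>
     (\<forall>x y z. B (x + y) z = B x z + B y z \<and> B z (x + y) = B z x + B z y) \<and>
     (\<forall>c x y. B (scale c x) y = c * B x y \<and> B x (scale c y) = c * B x y) \<and>
     B 1 1 = 1 \<and>
     (\<forall>i. B (\<theta> i) (\<theta> i) * (1 - cpi ^ p i * of_base (q i ^ 2)) = 1) \<and>
     (\<forall>i j. i \<noteq> j \<longrightarrow> B (\<theta> i) (\<theta> j) = 0) \<and>
     (\<forall>x y y'. B x (y * y') = tform B (r x) (tensor y y')) \<and>
     (\<forall>x x' y. B (x * x') y = tform B (tensor x x') (r y))"

definition form :: "('i, Qq pi_ext) free \<Rightarrow> ('i, Qq pi_ext) free \<Rightarrow> Qq pi_ext" where
  "form = (THE B. is_form B)"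

definition form_rad :: "('i, Qq pi_ext) free set" where
  "form_rad = {x. \<forall>y. form x y = 0}"

definition f_pi :: "(Qq pi_ext, ('i, Qq pi_ext) free set) module" where
  "f_pi = quot_alg free_alg form_rad"

text \<open>
  The \<open>\<rat>(q)\<close>-algebra \<open>\<^bold>f\<^sup>\<pi>/(u)\<close> for a scalar \<open>u \<in> \<rat>(q)\<^sup>\<pi>\<close>; the ideal \<open>(u)\<close> is generated by the
  multiple \<open>u \<cdot> 1\<close> of the unit.
\<close>

definition f_pi_mod :: "Qq pi_ext \<Rightarrow> (Qq, ('i, Qq pi_ext) free set set) module" where
  "f_pi_mod u =
     quot_alg (restrict_scalars of_base f_pi) (Idl\<^bsub>f_pi\<^esub> {u \<odot>\<^bsub>f_pi\<^esub> \<one>\<^bsub>f_pi\<^esub>})"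


subsection \<open>The algebras \<open>\<^bold>f\<^sup>-\<close> and \<open>\<^bold>f\<^sup>+\<close>\<close>

definition qint_minus :: "'i \<Rightarrow> nat \<Rightarrow> Qq" where
  "qint_minus i k =
     ((-1) ^ (k * p i) * q i ^ k - inverse (q i) ^ k) / ((-1) ^ p i * q i - inverse (q i))"

definition qint_plus :: "'i \<Rightarrow> nat \<Rightarrow> Qq" where
  "qint_plus i k = (q i ^ k - inverse (q i) ^ k) / (q i - inverse (q i))"

definition divpow :: "('i \<Rightarrow> nat \<Rightarrow> Qq) \<Rightarrow> 'i \<Rightarrow> nat \<Rightarrow> ('i, Qq) free" where
  "divpow qint i k = scale (inverse (\<Prod>b=1..k. qint i b)) (\<theta> i ^ k)"

definition p3 :: "nat \<Rightarrow> 'i \<Rightarrow> 'i \<Rightarrow> nat" where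
  "p3 k i j = k * p i * p j + k * (k - 1) div 2 * p i"

definition serre_minus :: "'i \<Rightarrow> 'i \<Rightarrow> ('i, Qq) free" where
  "serre_minus i j =
     (\<Sum>k=0..nat (1 - A i j).
        scale ((-1) ^ (k + p3 k i j))
          (divpow qint_minus i (nat (1 - A i j) - k) * \<theta> j * divpow qint_minus i k))"

definition serre_plus :: "'i \<Rightarrow> 'i \<Rightarrow> ('i, Qq) free" where
  "serre_plus i j =
     (\<Sum>k=0..nat (1 - A i j).
        scale ((-1) ^ k)
          (divpow qint_plus i (nat (1 - A i j) - k) * \<theta> j * divpow qint_plus i k))"

definition f_minus :: "(Qq, ('i, Qq) free set) module" where
  "f_minus = quot_alg free_alg (Idl\<^bsub>free_alg\<^esub> {serre_minus i j | i j. i \<noteq> j})"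

definition f_plus :: "(Qq, ('i, Qq) free set) module" where
  "f_plus = quot_alg free_alg (Idl\<^bsub>free_alg\<^esub> {serre_plus i j | i j. i \<noteq> j})"

end

locale super_cartan_datum = cartan_data A s odd_part
  for A :: "'i::finite \<Rightarrow> 'i \<Rightarrow> int" and s :: "'i \<Rightarrow> nat" and odd_part :: "'i set" +
  assumes C1: "A i i = 2"
    and C2: "i \<noteq> j \<Longrightarrow> A i j \<le> 0"
    and C3: "A i j = 0 \<longleftrightarrow> A j i = 0"
    and C4: "i \<in> odd_part \<Longrightarrow> even (A i j)"
    and C5_pos: "s i > 0"
    and C5_gcd: "Gcd (range s) = 1"
    and C5_sym: "int (s i) * A i j = int (s j) * A j i"
    and C6_nonempty: "odd_part \<noteq> {}"
    and C6_odd: "odd (s i) \<longleftrightarrow> i \<in> odd_part"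

end

theory Submission
  imports Defs "HOL-Library.Multiset"
begin

text \<open>
  Both \<open>\<rat>(q)\<close>-algebras arise from the diagonal braidings
  \<open>\<chi>\<^sub>i\<^sub>j = \<epsilon>\<^bsup>p(i)p(j)\<^esup> q\<^bsup>-(\<alpha>\<^sub>i,\<alpha>\<^sub>j)\<^esup>\<close> with \<open>\<epsilon> = \<plusminus>1\<close>, which are
  symmetric and satisfy \<open>\<chi>\<^sub>i\<^sub>j\<^sup>2 = \<chi>\<^sub>i\<^sub>i\<^bsup>a\<^esup>\<close>, \<open>a = a\<^sub>i\<^sub>j\<close>. The radical of the form consists of the
  elements annihilated by all iterated skew derivations followed by the counit, so it is
  compatible with the specializations \<open>\<pi> = \<epsilon>\<close>; these jointly embed \<open>\<rat>(q)\<^sup>\<pi>\<close> into \<open>\<rat>(q)\<^sup>2\<close>. It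
  remains to see that over the field \<open>\<rat>(q)\<close> the radical is the ideal of the Serre relations
  \<open>ad(\<theta>\<^sub>i)\<^bsup>1-a\<^esup> \<theta>\<^sub>j = 0\<close>.

  Let \<open>x\<close> be an element of the radical of weight \<open>\<nu>\<close>, lower weights being settled. Modulo the
  Serre ideal \<open>x\<close> is primitive, hence equals minus its antipode. The square of the antipode is a
  scalar on each weight space, \<open>\<plusminus>q\<close> to the power \<open>2(\<rho>,\<nu>) - (\<nu>,\<nu>)\<close>, so \<open>x\<close> vanishes unless
  \<open>(\<nu>,\<nu>) = 2(\<rho>,\<nu>)\<close>. In that case \<open>(\<nu>,\<alpha>\<^sub>i) > 0\<close> for some \<open>i\<close>. As \<open>x\<close> is killed by the right
  derivation \<open>r\<^sub>i\<close>, it lies in the subalgebra generated by the \<open>ad(\<theta>\<^sub>i)\<^sup>k \<theta>\<^sub>j\<close>, on which \<open>ad(\<theta>\<^sub>i)\<close>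
  is locally nilpotent; as it is also killed by the left derivation, \<open>sl\<^sub>2\<close> theory for the sign of
  \<open>(\<nu>,\<alpha>\<^sub>i)\<close> forces \<open>x = 0\<close>.
\<close>

section \<open>Linear maps on free modules\<close>

text \<open>The obstacle is that the form on the Serre quotient is not known to be nondegenerate.
  Induction on the degree supplies exactly enough: the inner terms of the coproduct of an element of
  degree n have two factors of degree below n, where radical and Serre ideal already agree. The
  price is that the antipode must descend to the Serre quotient; since it is reversal up to a scalar
  on each weight space, the Serre elements have to be reversed. The inequality behind the last step:
  2(rho,nu) is the sum of (alpha_i,alpha_i) over the letters i of a word of weight nu, hence
  positive for nonempty words, while (nu,nu) is the sum of (nu,alpha_i) over the same letters. If
  the two agree, some (nu,alpha_i) is positive. No character formula and no highest weight module
  enters. Both signs are treated by one argument: the Cartan condition determines an off-diagonal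
  \<open>\<chi> i j\<close> only up to sign, and for odd i the evenness of a_ij absorbs the sign of
  \<open>\<chi> i i\<close>.\<close>

definition is_lin :: "(('b \<Rightarrow>\<^sub>0 'k::comm_ring_1) \<Rightarrow> ('c \<Rightarrow>\<^sub>0 'k)) \<Rightarrow> bool" where
  "is_lin f \<longleftrightarrow> (\<forall>x y. f (x + y) = f x + f y) \<and> (\<forall>c x. f (scale c x) = scale c (f x))"

definition is_functional :: "(('b \<Rightarrow>\<^sub>0 'k::comm_ring_1) \<Rightarrow> 'k) \<Rightarrow> bool" where
  "is_functional f \<longleftrightarrow> (\<forall>x y. f (x + y) = f x + f y) \<and> (\<forall>c x. f (scale c x) = c * f x)"

definition lin :: "('b \<Rightarrow> ('c \<Rightarrow>\<^sub>0 'k::comm_ring_1)) \<Rightarrow> ('b \<Rightarrow>\<^sub>0 'k) \<Rightarrow> ('c \<Rightarrow>\<^sub>0 'k)" where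
  "lin f x = (\<Sum>b\<in>Poly_Mapping.keys x. scale (Poly_Mapping.lookup x b) (f b))"

lemma scale_1 [simp]: "scale 1 x = x"
  by (rule poly_mapping_eqI) (simp add: lookup_scale)

lemma scale_zero [simp]: "scale c 0 = 0"
  by (rule poly_mapping_eqI) (simp add: lookup_scale)

lemma scale_uminus: "scale c (- x) = - scale c x" "scale (- c) x = - scale c x"
  by (rule poly_mapping_eqI, simp add: lookup_scale)+

lemma scale_diff: "scale c (x - y) = scale c x - scale c y"
  by (rule poly_mapping_eqI) (simp add: lookup_scale lookup_minus algebra_simps)

lemma scale_diff_left: "scale (c - d) x = scale c x - scale d x"
  by (rule poly_mapping_eqI) (simp add: lookup_scale lookup_minus algebra_simps)

lemma scale_sum: "scale c (sum f S) = (\<Sum>t\<in>S. scale c (f t))"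
  by (induction S rule: infinite_finite_induct) (simp_all add: scale_add)

lemmas scale_simps = scale_add scale_add_left scale_uminus scale_diff scale_diff_left scale_scale
  scale_0

lemma single_scale: "Poly_Mapping.single b c = scale c (Poly_Mapping.single b 1)"
  by (simp add: scale_single)

lemma is_lin_lin: "is_lin (lin f)"
proof -
  have add: "lin f (x + y) = lin f x + lin f y" for x y
    unfolding lin_def by (rule setsum_keys_plus_distrib) (simp_all add: scale_simps)
  have "lin f (scale c x) = scale c (lin f x)" for c x
    by (induction x rule: single_add_induct)
       (simp_all add: add scale_add scale_single, simp add: lin_def scale_simps)
  with add show ?thesis by (simp add: is_lin_def)
qed

lemma lin_single [simp]: "lin f (Poly_Mapping.single b c) = scale c (f b)"
  by (simp add: lin_def scale_simps)

lemma is_linD: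
  assumes "is_lin f"
  shows "f (x + y) = f x + f y" "f (scale c x) = scale c (f x)" "f 0 = 0" "f (- x) = - f x"
    "f (x - y) = f x - f y"
proof -
  show 1: "f (x + y) = f x + f y" "f (scale c x) = scale c (f x)" for x y c
    using assms by (simp_all add: is_lin_def)
  show "f 0 = 0" using 1(2)[of 0 0] by (simp add: scale_simps)
  show 2: "f (- x) = - f x" for x using 1(2)[of "-1" x] by (simp add: scale_simps)
  show "f (x - y) = f x - f y" using 1(1)[of x "-y"] 2[of y] by simp
qed

lemmas lin_simps = is_linD[OF is_lin_lin]

lemma is_lin_sum: "is_lin f \<Longrightarrow> f (sum g S) = (\<Sum>t\<in>S. f (g t))"
  by (induction S rule: infinite_finite_induct) (simp_all add: is_linD)

lemma is_functionalD:
  assumes "is_functional f"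
  shows "f (x + y) = f x + f y" "f (scale c x) = c * f x" "f 0 = 0" "f (- x) = - f x"
    "f (x - y) = f x - f y"
proof -
  show 1: "f (x + y) = f x + f y" "f (scale c x) = c * f x" for x y c
    using assms by (simp_all add: is_functional_def)
  show "f 0 = 0" using 1(2)[of 0 0] by (simp add: scale_simps)
  show 2: "f (- x) = - f x" for x using 1(2)[of "-1" x] by (simp add: scale_simps)
  show "f (x - y) = f x - f y" using 1(1)[of x "-y"] 2[of y] by simp
qed

lemma is_lin_compose: "is_lin f \<Longrightarrow> is_lin g \<Longrightarrow> is_lin (\<lambda>x. f (g x))"
  by (simp add: is_lin_def)

lemma is_functional_compose: "is_functional f \<Longrightarrow> is_lin g \<Longrightarrow> is_functional (\<lambda>x. f (g x))"
  by (simp add: is_lin_def is_functional_def)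

lemma is_lin_ops:
  "is_lin (\<lambda>x. x)"
  "is_lin f \<Longrightarrow> is_lin g \<Longrightarrow> is_lin (\<lambda>x. f x + g x)"
  "is_lin f \<Longrightarrow> is_lin g \<Longrightarrow> is_lin (\<lambda>x. f x - g x)"
  "is_lin f \<Longrightarrow> is_lin (\<lambda>x. scale c (f x))"
  by (simp_all add: is_lin_def scale_simps mult.commute algebra_simps)

lemma lin_ext:
  assumes "is_lin f" "is_lin g" "\<And>b. f (Poly_Mapping.single b 1) = g (Poly_Mapping.single b 1)"
  shows "f x = g x"
proof (induction x rule: single_add_induct)
  case (single b c)
  show ?case by (subst (1 2) single_scale) (simp add: assms is_linD)
qed (simp add: assms is_linD)

lemma functional_ext:
  assumes "is_functional f" "is_functional g" "\<And>b. f (Poly_Mapping.single b 1) = g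
      (Poly_Mapping.single b 1)"
  shows "f x = g x"
proof (induction x rule: single_add_induct)
  case (single b c)
  show ?case by (subst (1 2) single_scale) (simp add: assms is_functionalD)
qed (simp add: assms is_functionalD)

lemma lin_of_is_lin: "is_lin g \<Longrightarrow> g (lin f x) = lin (\<lambda>b. g (f b)) x"
  by (rule lin_ext) (simp_all add: is_lin_compose is_lin_lin)

lemma is_functional_lookup: "is_functional (\<lambda>x. Poly_Mapping.lookup x b)"
  by (simp add: is_functional_def lookup_add lookup_scale)

section \<open>The free algebra\<close>

lemma scale_mult_left: "scale c x * y = scale c (x * y)"
  and scale_mult_right: "x * scale c y = scale c (x * (y :: ('i, 'k::comm_ring_1) free))"
proof -
  have 1: "scale c x = Poly_Mapping.single 0 c * x" for x :: "('i, 'k) free"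
    by (induction x rule: single_add_induct) (simp_all add: scale_single mult_single scale_add
        distrib_left)
  have 2: "x * Poly_Mapping.single 0 c = Poly_Mapping.single 0 c * x" for x :: "('i, 'k) free"
    by (induction x rule: single_add_induct) (simp_all add: mult_single distrib_left distrib_right
        mult.commute)
  show "scale c x * y = scale c (x * y)" by (simp add: 1 mult.assoc)
  show "x * scale c y = scale c (x * y)" by (simp add: 1 2 flip: mult.assoc)
qed

lemmas scale_mult = scale_mult_left scale_mult_right

lemma is_lin_mult: 
  fixes a :: "('i, 'k::comm_ring_1) free"
  shows "is_lin f \<Longrightarrow> is_lin (\<lambda>x. a * f x)" "is_lin f \<Longrightarrow> is_lin (\<lambda>x. f x * a)"
  by (simp_all add: is_lin_def algebra_simps scale_mult)

lemma theta_mult_mon: "\<theta> i * mon (Word w) = mon (Word (i # w))"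
  by (simp add: \<theta>_def mon_def mult_single plus_word_def)

lemma mon_Nil: "mon (Word []) = 1"
  by (simp add: mon_def flip: zero_word_def)

text \<open>Identities for twisted derivations are checked one left letter at a time, so that
  coefficients of products never have to be computed.\<close>

lemma free_induct [case_names one theta add scale]:
  fixes x :: "('i, 'k::comm_ring_1) free"
  assumes one: "P 1" and theta: "\<And>i x. P x \<Longrightarrow> P (\<theta> i * x)"
    and add: "\<And>x y. P x \<Longrightarrow> P y \<Longrightarrow> P (x + y)" and scale: "\<And>c x. P x \<Longrightarrow> P (scale c x)"
  shows "P x"
proof (induction x rule: single_add_induct)
  case (single b c)
  have "P (mon (Word w))" for w
    by (induction w) (simp_all add: mon_Nil one theta flip: theta_mult_mon)
  from scale[OF this[of "letters b"], of c] show ?case by (simp add: mon_def scale_single)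
qed (rule add)

definition counit :: "('i, 'k::comm_ring_1) free \<Rightarrow> 'k" where
  "counit x = Poly_Mapping.lookup x 0"

lemma is_functional_counit: "is_functional counit"
  unfolding counit_def by (rule is_functional_lookup)

lemmas counit_simps = is_functionalD[OF is_functional_counit]

lemma counit_theta [simp]: "counit (\<theta> i * x) = 0"
proof (induction x rule: single_add_induct)
  case (single b c)
  then show ?case 
    by (simp add: \<theta>_def mon_def mult_single counit_def lookup_single plus_word_def zero_word_def)
qed (simp add: distrib_left counit_simps)

lemma counit_1 [simp]: "counit 1 = 1"
  by (simp add: counit_def)

lemma counit_mult: "counit (x * y) = counit x * counit y"
  by (induction x rule: free_induct)
     (simp_all add: mult.assoc counit_simps distrib_right scale_mult)

section \<open>Twisted derivations\<close>

locale braiding =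
  fixes \<chi> :: "'i \<Rightarrow> 'i \<Rightarrow> 'k::comm_ring_1"
  assumes \<chi>_sym: "\<chi> i j = \<chi> j i"
begin

definition chi_prod :: "'i \<Rightarrow> 'i list \<Rightarrow> 'k" where
  "chi_prod i w = prod_list (map (\<chi> i) w)"

text \<open>The action of a Cartan element on weights. Keeping only the operator avoids adjoining a
  torus to the algebra.\<close>

definition K :: "'i \<Rightarrow> ('i, 'k) free \<Rightarrow> ('i, 'k) free" where
  "K i = lin (\<lambda>w. scale (chi_prod i (letters w)) (mon w))"

text \<open>Lusztig's skew derivations: \<open>lderiv i\<close> records the part of the coproduct
  with \<open>\<theta> i\<close> as left factor, \<open>rderiv i\<close> the part with
  \<open>\<theta> i\<close> as right factor.\<close>

fun lderiv_word :: "'i \<Rightarrow> 'i list \<Rightarrow> ('i, 'k) free" where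
  "lderiv_word i [] = 0"
| "lderiv_word i (j # w) = (if i = j then mon (Word w) else 0) + scale (\<chi> i j) (\<theta> j * lderiv_word
    i w)"

fun rderiv_word :: "'i \<Rightarrow> 'i list \<Rightarrow> ('i, 'k) free" where
  "rderiv_word i [] = 0"
| "rderiv_word i (j # w) = \<theta> j * rderiv_word i w + (if i = j then scale (chi_prod i w) (mon (Word
    w)) else 0)"

definition lderiv :: "'i \<Rightarrow> ('i, 'k) free \<Rightarrow> ('i, 'k) free" where
  "lderiv i = lin (\<lambda>w. lderiv_word i (letters w))"

definition rderiv :: "'i \<Rightarrow> ('i, 'k) free \<Rightarrow> ('i, 'k) free" where
  "rderiv i = lin (\<lambda>w. rderiv_word i (letters w))"

text \<open>The braided commutator with \<open>\<theta> i\<close>: \<open>K i\<close> supplies the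
  braiding scalar that depends on the weight of y.\<close>

definition ad :: "'i \<Rightarrow> ('i, 'k) free \<Rightarrow> ('i, 'k) free" where
  "ad i y = \<theta> i * y - K i y * \<theta> i"

lemma is_lin_K: "is_lin (K i)" and is_lin_lderiv: "is_lin (lderiv i)" and is_lin_rderiv: "is_lin
    (rderiv i)"
  by (simp_all add: K_def lderiv_def rderiv_def is_lin_lin)

lemma is_lin_ad: "is_lin (ad i)"
  unfolding ad_def by (intro is_lin_ops is_lin_mult is_lin_K)

lemmas K_simps = is_linD[OF is_lin_K]
lemmas lderiv_simps = is_linD[OF is_lin_lderiv]
lemmas rderiv_simps = is_linD[OF is_lin_rderiv]
lemmas ad_simps = is_linD[OF is_lin_ad]

lemma K_mon: "K i (mon w) = scale (chi_prod i (letters w)) (mon w)"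
  unfolding K_def by (subst mon_def) simp

lemma chi_prod_simps [simp]: "chi_prod i [] = 1" "chi_prod i (j # w) = \<chi> i j * chi_prod i w"
  by (simp_all add: chi_prod_def)

lemma K_1 [simp]: "K i 1 = 1"
  using K_mon[of i "Word []"] by (simp add: mon_Nil)

lemma mon_ext:
  assumes "is_lin f" "is_lin g" "\<And>w. f (mon (Word w)) = g (mon (Word w))"
  shows "f x = g x"
proof (rule lin_ext[OF assms(1,2)])
  show "f (Poly_Mapping.single b 1) = g (Poly_Mapping.single b 1)" for b
    using assms(3)[of "letters b"] by (simp add: mon_def)
qed

lemma K_theta_mult: "K i (\<theta> j * x) = scale (\<chi> i j) (\<theta> j * K i x)"
  by (rule mon_ext[of "\<lambda>x. K i (\<theta> j * x)"])
     (simp_all add: theta_mult_mon K_mon is_lin_def K_simps distrib_left scale_mult scale_simps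
         mult.commute)

lemma lderiv_mon: "lderiv i (mon (Word w)) = lderiv_word i w"
  unfolding lderiv_def by (subst mon_def) simp

lemma rderiv_mon: "rderiv i (mon (Word w)) = rderiv_word i w"
  unfolding rderiv_def by (subst mon_def) simp

lemma lderiv_1 [simp]: "lderiv i 1 = 0" and rderiv_1 [simp]: "rderiv i 1 = 0"
  using lderiv_mon[of i "[]"] rderiv_mon[of i "[]"] by (simp_all add: mon_Nil)

lemma lderiv_theta_mult: "lderiv i (\<theta> j * x) = (if i = j then x else 0) + scale (\<chi> i j) (\<theta> j *
    lderiv i x)"
  by (rule mon_ext[of "\<lambda>x. lderiv i (\<theta> j * x)"])
     (auto simp: theta_mult_mon lderiv_mon is_lin_def scale_simps scale_mult lderiv_simps
         algebra_simps)

lemma rderiv_theta_mult: "rderiv i (\<theta> j * x) = \<theta> j * rderiv i x + (if i = j then K i x else 0)"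
  by (rule mon_ext[of "\<lambda>x. rderiv i (\<theta> j * x)"])
     (auto simp: theta_mult_mon rderiv_mon K_mon is_lin_def scale_simps scale_mult rderiv_simps
         K_simps algebra_simps)

lemma K_theta [simp]: "K i (\<theta> j) = scale (\<chi> i j) (\<theta> j)"
  using K_theta_mult[of i j 1] by simp

lemma lderiv_theta [simp]: "lderiv i (\<theta> j) = (if i = j then 1 else 0)"
  using lderiv_theta_mult[of i j 1] by simp

lemma rderiv_theta [simp]: "rderiv i (\<theta> j) = (if i = j then 1 else 0)"
  using rderiv_theta_mult[of i j 1] by simp

lemma K_mult: "K i (x * y) = K i x * K i y"
  by (induction x rule: free_induct)
     (simp_all add: K_theta_mult K_simps scale_mult mult.assoc distrib_right)

lemma lderiv_mult: "lderiv i (x * y) = lderiv i x * y + K i x * lderiv i y"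
  by (induction x rule: free_induct)
     (simp_all add: K_theta_mult K_simps lderiv_theta_mult lderiv_simps scale_mult scale_simps
         algebra_simps)

lemma rderiv_mult: "rderiv i (x * y) = x * rderiv i y + rderiv i x * K i y"
  by (induction x rule: free_induct)
     (simp_all add: K_mult rderiv_theta_mult rderiv_simps scale_mult scale_simps algebra_simps)

lemma K_K: "K i (K j x) = K j (K i x)"
  by (induction x rule: free_induct)
     (simp_all add: K_theta_mult K_simps scale_simps mult.commute)

lemma lderiv_K: "lderiv i (K j x) = scale (\<chi> i j) (K j (lderiv i x))"
  by (induction x rule: free_induct)
     (simp_all add: K_theta_mult K_simps lderiv_theta_mult lderiv_simps scale_simps scale_mult
         mult_ac
        \<chi>_sym)

lemma rderiv_K: "rderiv i (K j x) = scale (\<chi> i j) (K j (rderiv i x))"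
  by (induction x rule: free_induct)
     (simp_all add: K_theta_mult K_simps rderiv_theta_mult rderiv_simps scale_simps scale_mult
         mult_ac
        \<chi>_sym K_K)

text \<open>The derivations strip letters from opposite ends of a word; the twists produced when one
  passes the other agree because \<open>\<chi>\<close> is symmetric.\<close>

lemma lderiv_rderiv: "lderiv i (rderiv j x) = rderiv j (lderiv i x)"
  by (induction x rule: free_induct)
     (simp_all add: K_theta_mult K_simps rderiv_theta_mult lderiv_theta_mult rderiv_simps
         lderiv_simps scale_simps
        scale_mult lderiv_K \<chi>_sym)

lemma ad_mult: "ad i (x * y) = ad i x * y + K i x * ad i y"
  by (simp add: ad_def K_mult algebra_simps)

lemma K_ad: "K j (ad i x) = scale (\<chi> i j) (ad i (K j x))"
  by (simp add: ad_def K_theta_mult K_mult K_simps scale_simps scale_mult K_K \<chi>_sym)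

lemma ad_1 [simp]: "ad i 1 = 0"
  by (simp add: ad_def)

text \<open>The two terms in which \<open>rderiv i\<close> hits the new letter are both
  \<open>K i y\<close> and cancel. Hence the kernel of \<open>rderiv i\<close> is stable under
  \<open>ad i\<close>.\<close>

lemma rderiv_ad: "rderiv i (ad i y) = \<theta> i * rderiv i y - scale (\<chi> i i * \<chi> i i) (K i (rderiv i y) *
    \<theta> i)"
  by (simp add: ad_def rderiv_theta_mult rderiv_mult rderiv_simps scale_mult rderiv_K scale_simps)

lemma rderiv_ad_other: "j \<noteq> i \<Longrightarrow> rderiv j (ad i y) = \<theta> i * rderiv j y - scale (\<chi> i j * \<chi> i j) (K i
    (rderiv j y) * \<theta> i)"
  by (simp add: ad_def rderiv_theta_mult rderiv_mult rderiv_simps scale_mult rderiv_K scale_simps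
      \<chi>_sym)

lemma lderiv_ad: "lderiv i (ad i y) = y - K i (K i y) + scale (\<chi> i i) (ad i (lderiv i y))"
  by (simp add: ad_def lderiv_theta_mult lderiv_mult lderiv_simps scale_mult lderiv_K scale_simps)

lemma lderiv_ad_other: "j \<noteq> i \<Longrightarrow> lderiv j (ad i y) = scale (\<chi> i j) (ad i (lderiv j y))"
  by (simp add: ad_def lderiv_theta_mult lderiv_mult lderiv_simps scale_mult lderiv_K scale_simps
      \<chi>_sym)

lemma counit_K [simp]: "counit (K i x) = counit x"
  by (induction x rule: free_induct) (simp_all add: K_theta_mult K_simps counit_simps)

lemma counit_lderiv_rderiv: "counit (lderiv i x) = counit (rderiv i x)"
  by (induction x rule: free_induct) (simp_all add: lderiv_theta_mult rderiv_theta_mult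
      counit_simps lderiv_simps rderiv_simps)

section \<open>Iterated derivations and the radical\<close>

fun lderivs :: "'i list \<Rightarrow> ('i, 'k) free \<Rightarrow> ('i, 'k) free" where
  "lderivs [] x = x"
| "lderivs (i # w) x = lderivs w (lderiv i x)"

fun rderivs :: "'i list \<Rightarrow> ('i, 'k) free \<Rightarrow> ('i, 'k) free" where
  "rderivs [] x = x"
| "rderivs (i # w) x = rderivs w (rderiv i x)"

definition radical :: "('i, 'k) free set" where
  "radical = {x. \<forall>w. counit (lderivs w x) = 0}"

lemma is_lin_lderivs: "is_lin (lderivs w)" and is_lin_rderivs: "is_lin (rderivs w)"
  by (induction w) (simp_all add: is_lin_def lderiv_simps rderiv_simps)

lemma rderivs_append: "rderivs (u @ v) x = rderivs v (rderivs u x)"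
  by (induction u arbitrary: x) simp_all

lemma rderivs_lderiv: "rderivs w (lderiv i x) = lderiv i (rderivs w x)"
  by (induction w arbitrary: x) (simp_all flip: lderiv_rderiv)

text \<open>Under the counit a left derivation may be traded for a right one, and left derivations
  commute with right ones; so the same functional can be read from the other end of the word. This
  makes the radical stable under both kinds.\<close>

lemma counit_lderivs_rderivs: "counit (lderivs w x) = counit (rderivs (rev w) x)"
  by (induction w arbitrary: x) (simp_all add: rderivs_append rderivs_lderiv counit_lderiv_rderiv)

lemma radical_rderivs: "radical = {x. \<forall>w. counit (rderivs w x) = 0}"
  unfolding radical_def counit_lderivs_rderivs by (metis rev_rev_ident)

lemma radical_lderiv: "x \<in> radical \<Longrightarrow> lderiv i x \<in> radical"
  using lderivs.simps(2)[of i] by (simp add: radical_def flip: lderivs.simps(2))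

lemma radical_rderiv: "x \<in> radical \<Longrightarrow> rderiv i x \<in> radical"
  by (simp add: radical_rderivs flip: rderivs.simps(2))

section \<open>The coproduct\<close>

text \<open>Left multiplication by the coproduct of \<open>\<theta> i\<close> in the braided tensor
  square; \<open>chi_prod\<close> is the cost of moving \<open>\<theta> i\<close> past the left
  factor.\<close>

definition coprod_step :: "'i \<Rightarrow> 'i word \<times> 'i word \<Rightarrow> ('i word \<times> 'i word \<Rightarrow>\<^sub>0 'k)" where
  "coprod_step i = (\<lambda>(u, v). Poly_Mapping.single (Word (i # letters u), v) 1
      + Poly_Mapping.single (u, Word (i # letters v)) (chi_prod i (letters u)))"

fun coprod_word :: "'i list \<Rightarrow> ('i word \<times> 'i word \<Rightarrow>\<^sub>0 'k)" where
  "coprod_word [] = Poly_Mapping.single (Word [], Word []) 1"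
| "coprod_word (i # w) = lin (coprod_step i) (coprod_word w)"

definition coprod :: "('i, 'k) free \<Rightarrow> ('i word \<times> 'i word \<Rightarrow>\<^sub>0 'k)" where
  "coprod = lin (\<lambda>w. coprod_word (letters w))"

lemma is_lin_coprod: "is_lin coprod"
  by (simp add: coprod_def is_lin_lin)

lemmas coprod_simps = is_linD[OF is_lin_coprod]

lemma coprod_mon: "coprod (mon (Word w)) = coprod_word w"
  unfolding coprod_def by (subst mon_def) simp

lemma coprod_theta_mult: "coprod (\<theta> i * x) = lin (coprod_step i) (coprod x)"
  by (rule mon_ext[of "\<lambda>x. coprod (\<theta> i * x)"])
     (simp_all add: theta_mult_mon coprod_mon is_lin_def coprod_simps lin_simps distrib_left
         scale_mult)

lemma coprod_1: "coprod 1 = Poly_Mapping.single (Word [], Word []) 1"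
  using coprod_mon[of "[]"] by (simp add: mon_Nil)

lemma mon_Cons: "mon (Word (i # letters u)) = \<theta> i * mon u"
  by (cases u) (simp add: theta_mult_mon)

text \<open>The slice maps: the functional is applied to the right (\<open>cutr\<close>) or left
  (\<open>cutl\<close>) tensor factor of the coproduct, and the other factor is kept.\<close>

definition cutr :: "(('i, 'k) free \<Rightarrow> 'k) \<Rightarrow> ('i, 'k) free \<Rightarrow> ('i, 'k) free" where
  "cutr \<phi> x = lin (\<lambda>(u, v). scale (\<phi> (mon v)) (mon u)) (coprod x)"

definition cutl :: "(('i, 'k) free \<Rightarrow> 'k) \<Rightarrow> ('i, 'k) free \<Rightarrow> ('i, 'k) free" where
  "cutl \<phi> x = lin (\<lambda>(u, v). scale (\<phi> (mon u)) (mon v)) (coprod x)"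

lemma is_lin_cutr: "is_lin (cutr \<phi>)" and is_lin_cutl: "is_lin (cutl \<phi>)"
  by (simp_all add: is_lin_def cutr_def cutl_def coprod_simps lin_simps)

lemmas cutr_simps = is_linD[OF is_lin_cutr]
lemmas cutl_simps = is_linD[OF is_lin_cutl]

lemma lin_plus: "lin (\<lambda>b. f b + g b) x = lin f x + lin g x"
  by (simp add: lin_def scale_add sum.distrib)

lemma lin_smult: "lin (\<lambda>b. scale c (f b)) x = scale c (lin f x)"
  by (simp add: lin_of_is_lin is_lin_ops)

lemma cutr_fun:
  "cutr (\<lambda>v. \<phi> v + \<psi> v) x = cutr \<phi> x + cutr \<psi> x"
  "cutr (\<lambda>v. c * \<phi> v) x = scale c (cutr \<phi> x)"
  "cutr (\<lambda>v. 0) x = 0"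
  by (simp_all add: cutr_def case_prod_unfold scale_simps lin_plus lin_smult flip: scale_scale)
     (simp add: lin_def)

lemma cutl_fun:
  "cutl (\<lambda>v. \<phi> v + \<psi> v) x = cutl \<phi> x + cutl \<psi> x"
  "cutl (\<lambda>v. c * \<phi> v) x = scale c (cutl \<phi> x)"
  "cutl (\<lambda>v. 0) x = 0"
  by (simp_all add: cutl_def case_prod_unfold scale_simps lin_plus lin_smult flip: scale_scale)
     (simp add: lin_def)

lemma cutr_theta_mult:
  "cutr \<phi> (\<theta> i * x) = \<theta> i * cutr \<phi> x + K i (cutr (\<lambda>v. \<phi> (\<theta> i * v)) x)"
proof -
  have "cutr \<phi> (\<theta> i * x) = lin (\<lambda>b. \<theta> i * scale (\<phi> (mon (snd b))) (mon (fst b))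
      + K i (scale (\<phi> (\<theta> i * mon (snd b))) (mon (fst b)))) (coprod x)"
    by (simp add: cutr_def coprod_theta_mult lin_of_is_lin[OF is_lin_lin] coprod_step_def
        case_prod_unfold
        lin_simps mon_Cons scale_simps scale_mult K_simps K_mon)
      (simp add: mult.commute)
  then show ?thesis
    by (simp add: lin_plus cutr_def case_prod_unfold lin_of_is_lin[OF is_lin_K]
        lin_of_is_lin[OF is_lin_mult(1)[OF is_lin_ops(1)]])
qed

lemma cutl_theta_mult:
  assumes "is_functional \<phi>"
  shows "cutl \<phi> (\<theta> i * x) = cutl (\<lambda>u. \<phi> (\<theta> i * u)) x + \<theta> i * cutl (\<lambda>u. \<phi> (K i u)) x"
proof -
  have "cutl \<phi> (\<theta> i * x) = lin (\<lambda>b. scale (\<phi> (\<theta> i * mon (fst b))) (mon (snd b))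
      + \<theta> i * scale (\<phi> (K i (mon (fst b)))) (mon (snd b))) (coprod x)"
    by (simp add: cutl_def coprod_theta_mult lin_of_is_lin[OF is_lin_lin] coprod_step_def
        case_prod_unfold
        lin_simps mon_Cons scale_simps scale_mult K_simps K_mon is_functionalD[OF assms])
  then show ?thesis
    by (simp add: lin_plus cutl_def case_prod_unfold
        lin_of_is_lin[OF is_lin_mult(1)[OF is_lin_ops(1)]])
qed

lemma cutr_1: "cutr \<phi> 1 = scale (\<phi> 1) 1" and cutl_1: "cutl \<phi> 1 = scale (\<phi> 1) 1"
  by (simp_all add: cutr_def cutl_def coprod_1 mon_Nil)

lemma is_functional_theta_mult: "is_functional \<phi> \<Longrightarrow> is_functional (\<lambda>x. \<phi> (\<theta> i * x))"
  by (simp add: is_functional_def distrib_left scale_mult)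

lemma is_functional_K: "is_functional \<phi> \<Longrightarrow> is_functional (\<lambda>x. \<phi> (K i x))"
  by (rule is_functional_compose[OF _ is_lin_K])

lemma is_functional_lderiv: "is_functional \<phi> \<Longrightarrow> is_functional (\<lambda>x. \<phi> (lderiv i x))"
  by (rule is_functional_compose[OF _ is_lin_lderiv])

lemma cutr_K: "is_functional \<phi> \<Longrightarrow> cutr \<phi> (K j x) = K j (cutr (\<lambda>v. \<phi> (K j v)) x)"
proof (induction x arbitrary: \<phi> rule: free_induct)
  case (theta i x)
  then show ?case
    by (simp add: K_theta_mult cutr_theta_mult cutr_simps K_simps is_functional_theta_mult cutr_fun
        is_functionalD[OF theta.prems] scale_simps K_K)
qed (simp_all add: K_simps cutr_simps cutr_1)

text \<open>A case of coassociativity: the coproduct intertwines \<open>rderiv j\<close> with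
  \<open>rderiv j\<close> on the right factor. The induction has to vary the functional, because
  passing a letter changes it.\<close>

lemma cutr_rderiv: "is_functional \<phi> \<Longrightarrow> cutr \<phi> (rderiv j x) = cutr (\<lambda>v. \<phi> (rderiv j v)) x"
proof (induction x arbitrary: \<phi> rule: free_induct)
  case (theta i x)
  then show ?case
    by (auto simp: rderiv_theta_mult cutr_theta_mult cutr_simps rderiv_simps
        is_functional_theta_mult cutr_fun
        is_functionalD[OF theta.prems] scale_simps cutr_K K_simps)
qed (simp_all add: rderiv_simps cutr_simps cutr_1 is_functionalD scale_simps)

lemma cutl_lderiv: "is_functional \<phi> \<Longrightarrow> cutl \<phi> (lderiv j x) = cutl (\<lambda>v. \<phi> (lderiv j v)) x"
proof (induction x arbitrary: \<phi> rule: free_induct)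
  case (theta i x)
  then show ?case
    by (auto simp: lderiv_theta_mult cutl_theta_mult cutl_simps lderiv_simps
        is_functional_theta_mult cutl_fun
        is_functionalD[OF theta.prems] scale_simps K_simps is_functional_K is_functional_lderiv
            lderiv_K scale_mult)
qed (simp_all add: lderiv_simps cutl_simps cutl_1 is_functionalD scale_simps)

lemma cutr_counit [simp]: "cutr counit x = x"
  by (induction x rule: free_induct) (simp_all add: cutr_1 cutr_theta_mult cutr_fun K_simps
      cutr_simps)

lemma cutl_counit [simp]: "cutl counit x = x"
  by (induction x rule: free_induct)
     (simp_all add: cutl_1 cutl_theta_mult[OF is_functional_counit] cutl_fun K_simps cutl_simps)

lemma is_functional_counit_rderivs: "is_functional (\<lambda>v. counit (rderivs z v))"
  by (rule is_functional_compose[OF is_functional_counit is_lin_rderivs])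

text \<open>The functionals that define the radical, applied to the right factor of a coproduct,
  leave iterated derivatives of x. For x in the radical these are in the radical again.\<close>

lemma cutr_rderivs: "cutr (\<lambda>v. counit (rderivs z v)) x = rderivs z x"
  by (induction z arbitrary: x) (simp_all flip: cutr_rderiv[OF is_functional_counit_rderivs])

section \<open>The antipode\<close>

text \<open>The product of \<open>\<chi>\<close> over all pairs of positions, which is the scalar of
  the braid that reverses the word.\<close>

fun half_twist :: "'i list \<Rightarrow> 'k" where
  "half_twist [] = 1"
| "half_twist (i # w) = chi_prod i w * half_twist w"

definition antip :: "('i, 'k) free \<Rightarrow> ('i, 'k) free" where
  "antip = lin (\<lambda>w. scale ((-1) ^ length (letters w) * half_twist (letters w)) (mon (Word (rev
      (letters w)))))"

lemma antip_mon: "antip (mon (Word w)) = scale ((-1) ^ length w * half_twist w) (mon (Word (rev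
    w)))"
  unfolding antip_def by (subst mon_def) simp

lemma is_lin_antip: "is_lin antip" by (simp add: antip_def is_lin_lin)

lemmas antip_simps = is_linD[OF is_lin_antip]

lemma mon_mult: "mon u * mon v = mon (u + v)"
  by (simp add: mon_def mult_single)

lemma antip_theta_mult: "antip (\<theta> i * x) = - (antip (K i x) * \<theta> i)"
  by (rule mon_ext[of "\<lambda>x. antip (\<theta> i * x)"])
     (simp_all add: theta_mult_mon antip_mon K_mon is_lin_def antip_simps K_simps algebra_simps
         scale_mult
       scale_simps \<theta>_def mon_mult plus_word_def)

text \<open>The two summands of \<open>coprod_step\<close> already cancel against each other,
  whatever the coproduct of x is; only the unit survives.\<close>

lemma antipode: "lin (\<lambda>(u, v). antip (mon u) * mon v) (coprod x) = scale (counit x) 1"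
proof (induction x rule: free_induct)
  case one
  then show ?case using antip_mon[of "[]"] by (simp add: coprod_1 mon_Nil)
next
  case (theta i x)
  have "lin (\<lambda>(u, v). antip (mon u) * mon v) (coprod (\<theta> i * x)) = lin (\<lambda>b. 0) (coprod x)"
    by (simp add: coprod_theta_mult lin_of_is_lin[OF is_lin_lin] coprod_step_def case_prod_unfold
        lin_simps mon_Cons antip_theta_mult K_mon antip_simps scale_mult mult.assoc)
  then show ?case by (simp add: scale_simps lin_def)
qed (simp_all add: coprod_simps lin_simps counit_simps scale_simps)

end

section \<open>Subspaces and a kernel criterion for tensors\<close>

definition subsp :: "('b \<Rightarrow>\<^sub>0 'k::comm_ring_1) set \<Rightarrow> bool" where
  "subsp W \<longleftrightarrow> 0 \<in> W \<and> (\<forall>x\<in>W. \<forall>y\<in>W. x + y \<in> W) \<and> (\<forall>c. \<forall>x\<in>W. scale c x \<in> W)"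

lemma subspD:
  assumes "subsp W"
  shows "0 \<in> W" "x \<in> W \<Longrightarrow> y \<in> W \<Longrightarrow> x + y \<in> W" "x \<in> W \<Longrightarrow> scale c x \<in> W"
    "x \<in> W \<Longrightarrow> - x \<in> W" "x \<in> W \<Longrightarrow> y \<in> W \<Longrightarrow> x - y \<in> W"
    "(\<And>t. t \<in> T \<Longrightarrow> f t \<in> W) \<Longrightarrow> sum f T \<in> W"
proof -
  show 1: "0 \<in> W" "\<And>x y. x \<in> W \<Longrightarrow> y \<in> W \<Longrightarrow> x + y \<in> W" "\<And>x c. x \<in> W \<Longrightarrow> scale c x \<in> W"
    using assms by (simp_all add: subsp_def)
  show 2: "x \<in> W \<Longrightarrow> - x \<in> W" for x using 1(3)[of x "-1"] by (simp add: scale_simps)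
  show "x \<in> W \<Longrightarrow> y \<in> W \<Longrightarrow> x - y \<in> W" using 1(2)[of x "-y"] 2[of y] by simp
  show "(\<And>t. t \<in> T \<Longrightarrow> f t \<in> W) \<Longrightarrow> sum f T \<in> W"
    by (induction T rule: infinite_finite_induct) (simp_all add: 1)
qed

text \<open>If all slices by \<open>\<Phi>\<close> of the tensor lie in W, the tensor lies in the
  span of W \<otimes> V and U \<otimes> V', where U is the full space of left factors and V' the
  common kernel of \<open>\<Phi>\<close> in V. Testing this through a bilinear
  \<open>\<beta>\<close> that sends both parts to N avoids bases and complements.\<close>

lemma tensor_kernel:
  fixes u :: "'t \<Rightarrow> ('b \<Rightarrow>\<^sub>0 'k::field)" and v :: "'t \<Rightarrow> ('c \<Rightarrow>\<^sub>0 'k)"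
  assumes "finite T" and W: "subsp W" and V: "subsp V" and N: "subsp N"
    and \<Phi>: "\<And>\<phi>. \<phi> \<in> \<Phi> \<Longrightarrow> is_functional \<phi>"
    and v: "\<And>t. t \<in> T \<Longrightarrow> v t \<in> V"
    and cut: "\<And>\<phi>. \<phi> \<in> \<Phi> \<Longrightarrow> (\<Sum>t\<in>T. scale (\<phi> (v t)) (u t)) \<in> W"
    and lin1: "\<And>b. is_lin (\<lambda>a. \<beta> a b)" and lin2: "\<And>a. is_lin (\<beta> a)"
    and \<beta>W: "\<And>a b. a \<in> W \<Longrightarrow> b \<in> V \<Longrightarrow> \<beta> a b \<in> N"
    and \<beta>V: "\<And>a b. b \<in> V \<Longrightarrow> (\<And>\<phi>. \<phi> \<in> \<Phi> \<Longrightarrow> \<phi> b = 0) \<Longrightarrow> \<beta> a b \<in> N"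
  shows "(\<Sum>t\<in>T. \<beta> (u t) (v t)) \<in> N"
  using assms(1) v cut
proof (induction "card T" arbitrary: T v)
  case 0
  then show ?case using subspD[OF N] by simp
next
  case (Suc n)
  show ?case
  proof (cases "\<forall>t\<in>T. \<forall>\<phi>\<in>\<Phi>. \<phi> (v t) = 0")
    case True
    then show ?thesis using Suc.prems(2) by (intro subspD(6)[OF N] \<beta>V) auto
  next
    case False
    then obtain t0 \<phi> where t0: "t0 \<in> T" "\<phi> \<in> \<Phi>" "\<phi> (v t0) \<noteq> 0" by blast
    define T' where "T' = T - {t0}"
    have T: "finite T'" "t0 \<notin> T'" "T = insert t0 T'" "card T' = n"
      using t0 Suc.prems(1) Suc.hyps(2) by (auto simp: T'_def)
    \<comment> \<open>Gaussian elimination with pivot t0: multiples of \<open>v t0\<close> are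
      subtracted from the other right factors, and the left factor \<open>w\<close> collected at
      \<open>v t0\<close> is the slice by \<open>\<phi>\<close> divided by the pivot, hence lies in
      W.\<close>
    define c where "c t = \<phi> (v t) / \<phi> (v t0)" for t
    define v' where "v' t = v t - scale (c t) (v t0)" for t
    define w where "w = u t0 + (\<Sum>t\<in>T'. scale (c t) (u t))"
    have "scale (inverse (\<phi> (v t0))) (\<Sum>t\<in>T. scale (\<phi> (v t)) (u t)) \<in> W"
      using Suc.prems(3)[OF t0(2)] by (rule subspD(3)[OF W])
    moreover have "scale (inverse (\<phi> (v t0))) (\<Sum>t\<in>T. scale (\<phi> (v t)) (u t)) = w"
      using t0(3) by (simp add: T w_def scale_simps c_def scale_sum divide_inverse mult.commute)
    ultimately have w: "w \<in> W" by simp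
    have "(\<Sum>t\<in>T'. \<beta> (u t) (v' t)) \<in> N"
    proof (rule Suc.hyps(1))
      show "n = card T'" "finite T'" by (simp_all add: T)
      show "v' t \<in> V" if "t \<in> T'" for t
        using that Suc.prems(2) by (auto simp: v'_def T intro!: subspD[OF V])
      show "(\<Sum>t\<in>T'. scale (\<psi> (v' t)) (u t)) \<in> W" if \<psi>: "\<psi> \<in> \<Phi>" for \<psi>
      proof -
        have "(\<Sum>t\<in>T'. scale (\<psi> (v' t)) (u t))
            = (\<Sum>t\<in>T. scale (\<psi> (v t)) (u t)) - scale (\<psi> (v t0)) w"
          by (simp add: v'_def is_functionalD[OF \<Phi>[OF \<psi>]] T w_def scale_simps scale_sum
        sum_subtractf
              mult.commute)
        then show ?thesis
          using Suc.prems(3)[OF \<psi>] w by (simp add: subspD[OF W])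
      qed
    qed
    moreover have "\<beta> w (v t0) \<in> N"
      using w Suc.prems(2)[OF t0(1)] by (rule \<beta>W)
    moreover have "(\<Sum>t\<in>T. \<beta> (u t) (v t)) = (\<Sum>t\<in>T'. \<beta> (u t) (v' t)) + \<beta> w (v t0)"
      by (simp add: T v'_def w_def is_linD[OF lin1] is_linD[OF lin2] sum_subtractf
          is_lin_sum[OF lin1])
    ultimately show ?thesis by (simp add: subspD[OF N])
  qed
qed

section \<open>Supports\<close>

definition supp :: "('i list \<Rightarrow> bool) \<Rightarrow> ('i, 'k::comm_ring_1) free \<Rightarrow> bool" where
  "supp P x \<longleftrightarrow> (\<forall>w\<in>Poly_Mapping.keys x. P (letters w))"

lemma keys_scale: "Poly_Mapping.keys (scale c x) \<subseteq> Poly_Mapping.keys x"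
  by (auto simp: in_keys_iff lookup_scale)

lemma supp_simps:
  "supp P 0" "supp P x \<Longrightarrow> supp P y \<Longrightarrow> supp P (x + y)" "supp P x \<Longrightarrow> supp P (scale c x)"
  using keys_add[of x y] keys_scale[of c x] by (auto simp: supp_def)

lemma supp_mon: "P w \<Longrightarrow> supp P (mon (Word w))"
  by (auto simp: supp_def mon_def split: if_splits)

lemma subsp_supp: "subsp {x. supp P x}"
  by (simp add: subsp_def supp_simps)

lemma sum_mon: "x = (\<Sum>w\<in>Poly_Mapping.keys x. scale (Poly_Mapping.lookup x w) (mon w))"
  by (rule poly_mapping_eqI)
     (auto simp: lookup_sum lookup_scale mon_def lookup_single when_def sum.delta in_keys_iff
       if_distrib cong: if_cong)

lemma is_lin_keys:
  "is_lin f \<Longrightarrow> f x = (\<Sum>w\<in>Poly_Mapping.keys x. scale (Poly_Mapping.lookup x w) (f (mon w)))"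
  by (subst sum_mon[of x]) (simp add: is_lin_sum is_linD)

lemma supp_lin:
  assumes "is_lin f" "\<And>w. P w \<Longrightarrow> supp Q (f (mon (Word w)))" "supp P x"
  shows "supp Q (f x)"
proof -
  have "supp Q (f (mon w))" if "w \<in> Poly_Mapping.keys x" for w
    using assms(2)[of "letters w"] assms(3) that by (simp add: supp_def)
  then have "(\<Sum>w\<in>Poly_Mapping.keys x. scale (Poly_Mapping.lookup x w) (f (mon w))) \<in> {x. supp Q x}"
    by (intro subspD(6)[OF subsp_supp] subspD(3)[OF subsp_supp]) simp
  then show ?thesis unfolding is_lin_keys[OF assms(1), symmetric] by simp
qed

lemma is_lin_theta: "is_lin (\<lambda>x. \<theta> j * x)"
  by (rule is_lin_mult is_lin_ops)+

lemma supp_theta: "supp (\<lambda>w. P (j # w)) x \<Longrightarrow> supp P (\<theta> j * x)"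
  by (erule supp_lin[OF is_lin_theta, rotated]) (simp add: theta_mult_mon supp_mon)

lemma supp_mono: "supp P x \<Longrightarrow> (\<And>w. P w \<Longrightarrow> Q w) \<Longrightarrow> supp Q x"
  by (auto simp: supp_def)

definition proj :: "'i multiset \<Rightarrow> ('i, 'k::comm_ring_1) free \<Rightarrow> ('i, 'k) free" where
  "proj M = lin (\<lambda>w. if mset (letters w) = M then mon w else 0)"

lemma is_lin_proj: "is_lin (proj M)"
  by (simp add: proj_def is_lin_lin)

lemma proj_mon: "proj M (mon w) = (if mset (letters w) = M then mon w else 0)"
  unfolding proj_def by (subst mon_def) simp

lemma supp_proj: "supp P x \<Longrightarrow> supp (\<lambda>w. P w \<and> mset w = M) (proj M x)"
  by (erule supp_lin[OF is_lin_proj, rotated]) (simp add: proj_mon supp_mon supp_simps)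

lemma sum_proj: "x = (\<Sum>M\<in>(mset \<circ> letters) ` Poly_Mapping.keys x. proj M x)"
proof -
  have "(\<Sum>M\<in>(mset \<circ> letters) ` Poly_Mapping.keys x. proj M x)
    = (\<Sum>M\<in>(mset \<circ> letters) ` Poly_Mapping.keys x. \<Sum>w\<in>Poly_Mapping.keys x. 
         scale (Poly_Mapping.lookup x w) (if mset (letters w) = M then mon w else 0))"
    by (subst is_lin_keys[OF is_lin_proj]) (simp add: proj_mon)
  also have "\<dots> = (\<Sum>w\<in>Poly_Mapping.keys x. \<Sum>M\<in>(mset \<circ> letters) ` Poly_Mapping.keys x.
         if mset (letters w) = M then scale (Poly_Mapping.lookup x w) (mon w) else 0)"
    by (subst sum.swap) (intro sum.cong, simp_all)
  also have "\<dots> = x"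
    by (subst (4) sum_mon) (auto intro!: sum.cong simp: sum.delta')
  finally show ?thesis by simp
qed

lemma keys_lin: 
  assumes "t \<in> Poly_Mapping.keys (lin f x)"
  shows "\<exists>b\<in>Poly_Mapping.keys x. t \<in> Poly_Mapping.keys (f b)"
proof -
  have "(\<Sum>b\<in>Poly_Mapping.keys x. Poly_Mapping.lookup x b * Poly_Mapping.lookup (f b) t) \<noteq> 0"
    using assms by (simp add: lin_def in_keys_iff lookup_sum lookup_scale)
  then obtain b where "b \<in> Poly_Mapping.keys x" "Poly_Mapping.lookup x b * Poly_Mapping.lookup (f
      b) t \<noteq> 0"
    by (rule sum.not_neutral_contains_not_neutral)
  then have "Poly_Mapping.lookup (f b) t \<noteq> 0" by auto
  with \<open>b \<in> Poly_Mapping.keys x\<close> show ?thesis by (auto simp: in_keys_iff)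
qed

section \<open>Weights and degrees under derivations, coproduct and antipode\<close>

context braiding
begin

text \<open>Subtraction of multisets is truncated, so the weight claim would fail in the induction
  for an absent letter i; the simultaneous vanishing statement covers that case.\<close>

lemma supp_lderiv_mon:
  "(i \<notin># mset w \<longrightarrow> lderiv i (mon (Word w)) = 0) \<and> supp (\<lambda>u. mset u = mset w - {#i#}) (lderiv i (mon
      (Word w)))"
proof (induction w)
  case (Cons j w)
  have "supp (\<lambda>u. mset (j # u) = mset (j # w) - {#i#}) (lderiv i (mon (Word w)))"
  proof (cases "i \<in># mset w")
    case True
    then obtain M where "mset w = add_mset i M" by (metis mset_add)
    then show ?thesis using Cons by (simp add: add_mset_commute[of j i])
  qed (use Cons in \<open>simp add: supp_simps\<close>)
  then show ?case using Cons
    by (auto simp: lderiv_theta_mult supp_simps supp_mon simp flip: theta_mult_mon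
          intro!: supp_simps supp_theta supp_mon)
qed (simp add: mon_Nil supp_simps)

lemma supp_lderiv:
  assumes "supp (\<lambda>w. mset w = M) x"
  shows "i \<notin># M \<Longrightarrow> lderiv i x = 0" "supp (\<lambda>w. mset w = M - {#i#}) (lderiv i x)"
proof -
  show "supp (\<lambda>w. mset w = M - {#i#}) (lderiv i x)"
    using supp_lderiv_mon by (intro supp_lin[OF is_lin_lderiv _ assms]) metis
  assume i: "i \<notin># M"
  have "supp (\<lambda>_. False) (lderiv i x)"
    using supp_lderiv_mon[of i] i by (intro supp_lin[OF is_lin_lderiv _ assms]) (metis
        supp_simps(1))
  then show "lderiv i x = 0" by (auto simp: supp_def)
qed

lemma supp_rderiv_mon: "supp (\<lambda>u. Suc (length u) = length w) (rderiv i (mon (Word w)))"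
proof (induction w)
  case (Cons j w)
  have "supp (\<lambda>u. Suc (length (j # u)) = length (j # w)) (rderiv i (mon (Word w)))"
    using Cons by simp
  then show ?case
    by (auto simp: rderiv_theta_mult supp_simps supp_mon K_mon simp flip: theta_mult_mon
          intro!: supp_simps supp_theta supp_mon)
qed (simp add: mon_Nil supp_simps)

lemma supp_length_rderiv:
  assumes "supp (\<lambda>w. length w < Suc n) x" shows "supp (\<lambda>w. length w < n) (rderiv i x)"
proof (rule supp_lin[OF is_lin_rderiv _ assms])
  show "supp (\<lambda>w. length w < n) (rderiv i (mon (Word w)))" if "length w < Suc n" for w
    using that by (intro supp_mono[OF supp_rderiv_mon[of w i]]) simp
qed

lemma supp_length_rderivs: 
  "supp (\<lambda>w. length w < Suc n) x \<Longrightarrow> z \<noteq> [] \<Longrightarrow> supp (\<lambda>w. length w < n) (rderivs z x)"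
proof (induction z arbitrary: x)
  case (Cons i z)
  have rderiv: "supp (\<lambda>w. length w < n) (rderiv i x)"
    by (rule supp_length_rderiv) (rule Cons.prems)
  then have "supp (\<lambda>w. length w < Suc n) (rderiv i x)" by (rule supp_mono) simp
  with Cons.IH[OF this] rderiv show ?case by (cases "z = []") auto
qed simp

lemma supp_length_lderiv: 
  assumes "supp (\<lambda>w. length w < Suc n) x" shows "supp (\<lambda>w. length w < n) (lderiv i x)"
proof (rule supp_lin[OF is_lin_lderiv _ assms])
  fix w :: "'i list" assume w: "length w < Suc n"
  have "length u < n" if u: "mset u = mset w - {#i#}" and "i \<in># mset w" for u
  proof -
    from that obtain M where "mset w = add_mset i M" by (metis mset_add)
    with u w show ?thesis by (metis Suc_less_eq add_mset_remove_trivial size_add_mset size_mset)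
  qed
  then show "supp (\<lambda>w. length w < n) (lderiv i (mon (Word w)))"
    using supp_lderiv_mon[of i w] supp_mono[of "\<lambda>u. mset u = mset w - {#i#}" _ "\<lambda>w. length w < n"]
    by (cases "i \<in># mset w") (simp_all add: supp_simps)
qed

lemma counit_lderivs_supp: "supp (\<lambda>w. mset w = M) x \<Longrightarrow> counit (lderivs z x) \<noteq> 0 \<Longrightarrow> mset z = M"
proof (induction z arbitrary: M x)
  case Nil
  then show ?case 
    by (auto simp: counit_def supp_def in_keys_iff zero_word_def dest: bspec[of _ _ "Word []"])
next
  case (Cons i z)
  have "i \<in># M"
  proof (rule ccontr)
    assume "i \<notin># M"
    from supp_lderiv(1)[OF Cons.prems(1) this] Cons.prems(2) show False
      by (simp add: is_linD[OF is_lin_lderivs] counit_simps)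
  qed
  with Cons.IH[OF supp_lderiv(2)[OF Cons.prems(1)]] Cons.prems(2) show ?case by simp
qed

text \<open>Different weight spaces are orthogonal. Consequently the radical contains the weight
  components of its elements and can be treated weight by weight.\<close>

lemma counit_lderivs_proj: "counit (lderivs z (proj M x)) = (if mset z = M then counit (lderivs z
    x) else 0)"
proof -
  have f: "is_functional (\<lambda>x. counit (lderivs z x))" 
    by (rule is_functional_compose[OF is_functional_counit is_lin_lderivs])
  have "supp (\<lambda>w. mset w = mset (letters u)) (mon u)" for u :: "'i word"
    by (auto simp: supp_def mon_def split: if_splits)
  note * = counit_lderivs_supp[OF this]
  show ?thesis
  proof (rule functional_ext[of "\<lambda>x. counit (lderivs z (proj M x))"])
    show "is_functional (\<lambda>x. counit (lderivs z (proj M x)))"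
      by (rule is_functional_compose[OF f is_lin_proj])
    show "is_functional (\<lambda>x. if mset z = M then counit (lderivs z x) else 0)"
      using f by (auto simp: is_functional_def)
    fix b :: "'i word"
    show "counit (lderivs z (proj M (Poly_Mapping.single b 1))) =
         (if mset z = M then counit (lderivs z (Poly_Mapping.single b 1)) else 0)"
      using *[of z b] by (cases "counit (lderivs z (mon b)) = 0")
        (auto simp: proj_mon is_linD[OF is_lin_lderivs] counit_simps simp flip: mon_def)
  qed
qed

lemma radical_proj: "x \<in> radical \<Longrightarrow> proj M x \<in> radical"
  by (simp add: radical_def counit_lderivs_proj)

lemma supp_coprod_word:
  "(a, b) \<in> Poly_Mapping.keys (coprod_word w) \<Longrightarrow> length (letters a) + length (letters b) = length w"
proof (induction w arbitrary: a b)
  case (Cons i w)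
  then obtain u v where uv: "(u, v) \<in> Poly_Mapping.keys (coprod_word w)"
      "(a, b) \<in> Poly_Mapping.keys (coprod_step i (u, v))"
    using keys_lin[of "(a, b)" "coprod_step i" "coprod_word w"] by auto
  have "(a, b) \<in> {(Word (i # letters u), v), (u, Word (i # letters v))}"
    using uv(2) subsetD[OF keys_add uv(2)[unfolded coprod_step_def split]] by (auto split:
        if_splits)
  with Cons.IH[OF uv(1)] show ?case by auto
qed simp

lemma supp_coprod:
  assumes "(a, b) \<in> Poly_Mapping.keys (coprod x)" "supp (\<lambda>w. length w = n) x"
  shows "length (letters a) + length (letters b) = n"
proof -
  obtain w where w: "w \<in> Poly_Mapping.keys x" "(a, b) \<in> Poly_Mapping.keys (coprod_word (letters w))"
    using keys_lin[OF assms(1)[unfolded coprod_def]] by blast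
  then show ?thesis using supp_coprod_word[OF w(2)] assms(2) by (auto simp: supp_def)
qed

lemma chi_prod_mset: "mset u = mset w \<Longrightarrow> chi_prod i u = chi_prod i w"
  by (simp add: chi_prod_def flip: prod_mset_prod_list) 

lemma chi_prod_append: "chi_prod i (u @ w) = chi_prod i u * chi_prod i w"
  by (simp add: chi_prod_def)

lemma half_twist_insert: "half_twist (u @ i # w) = chi_prod i (u @ w) * half_twist (u @ w)"
  by (induction u) (simp_all add: chi_prod_append mult_ac \<chi>_sym)

text \<open>For symmetric \<open>\<chi>\<close> the product over pairs ignores the order of the
  letters. So the antipode is a scalar times reversal on each weight space, and its square is the
  square of \<open>half_twist\<close>.\<close>

lemma half_twist_mset: "mset u = mset w \<Longrightarrow> half_twist u = half_twist w"
proof (induction u arbitrary: w)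
  case (Cons i u)
  then have "i \<in> set w" by (metis list.set_intros(1) set_mset_mset)
  then obtain w1 w2 where w: "w = w1 @ i # w2" by (metis split_list)
  then have "mset u = mset (w1 @ w2)" using Cons.prems by simp
  with Cons.IH[OF this] chi_prod_mset[OF this] show ?case by (simp add: w half_twist_insert)
qed simp

definition reversal :: "('i, 'k) free \<Rightarrow> ('i, 'k) free" where
  "reversal = lin (\<lambda>w. mon (Word (rev (letters w))))"

lemma is_lin_reversal: "is_lin reversal" by (simp add: reversal_def is_lin_lin)

lemmas reversal_simps = is_linD[OF is_lin_reversal]

lemma reversal_mon: "reversal (mon (Word w)) = mon (Word (rev w))"
  unfolding reversal_def by (subst mon_def) simp

lemma reversal_theta_mult: "reversal (\<theta> i * x) = reversal x * \<theta> i"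
  by (rule mon_ext[of "\<lambda>x. reversal (\<theta> i * x)"])
     (simp_all add: theta_mult_mon reversal_mon is_lin_def reversal_simps algebra_simps scale_mult
       \<theta>_def mon_mult plus_word_def)

lemma reversal_1 [simp]: "reversal 1 = 1"
  using reversal_mon[of "[]"] by (simp add: mon_Nil)

lemma reversal_theta [simp]: "reversal (\<theta> i) = \<theta> i"
  using reversal_theta_mult[of i 1] by simp

lemma reversal_mult: "reversal (x * y) = reversal y * reversal x"
  by (induction x rule: free_induct)
     (simp_all add: reversal_theta_mult reversal_simps scale_mult scale_simps mult.assoc
         distrib_left distrib_right)

lemma reversal_reversal [simp]: "reversal (reversal x) = x"
  by (induction x rule: free_induct)
     (simp_all add: reversal_theta_mult reversal_mult reversal_simps)

lemma K_supp:
  assumes "supp (\<lambda>u. mset u = mset w) x"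
  shows "K i x = scale (chi_prod i w) x"
proof -
  have "K i x = (\<Sum>u\<in>Poly_Mapping.keys x. scale (chi_prod i w) (scale (Poly_Mapping.lookup x u)
      (mon u)))"
  proof (subst is_lin_keys[OF is_lin_K], intro sum.cong refl)
    fix u assume "u \<in> Poly_Mapping.keys x"
    then have "mset (letters u) = mset w" using assms by (auto simp: supp_def)
    from chi_prod_mset[OF this] show "scale (Poly_Mapping.lookup x u) (K i (mon u)) =
        scale (chi_prod i w) (scale (Poly_Mapping.lookup x u) (mon u))"
      by (simp add: K_mon scale_scale mult.commute)
  qed
  also have "\<dots> = scale (chi_prod i w) x"
    unfolding scale_sum[symmetric] sum_mon[symmetric] ..
  finally show ?thesis .
qed

lemma antip_supp:
  assumes "supp (\<lambda>u. mset u = mset w) x"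
  shows "antip x = scale ((-1) ^ length w * half_twist w) (reversal x)"
proof -
  have "antip x = (\<Sum>u\<in>Poly_Mapping.keys x. scale ((-1) ^ length w * half_twist w) (scale
      (Poly_Mapping.lookup x u) (reversal (mon u))))"
  proof (subst is_lin_keys[OF is_lin_antip], intro sum.cong refl)
    fix u assume "u \<in> Poly_Mapping.keys x"
    then have "mset (letters u) = mset w" using assms by (auto simp: supp_def)
    from half_twist_mset[OF this] mset_eq_length[OF this]
    show "scale (Poly_Mapping.lookup x u) (antip (mon u)) = 
      scale ((-1) ^ length w * half_twist w) (scale (Poly_Mapping.lookup x u) (reversal (mon u)))"
      using antip_mon[of "letters u"] reversal_mon[of "letters u"] by (simp add: scale_simps
          mult_ac)
  qed
  then show ?thesis unfolding scale_sum[symmetric] is_lin_keys[OF is_lin_reversal, symmetric] .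
qed

end

section \<open>The Serre ideal\<close>

text \<open>\<open>\<chi>_twist\<close> is the positivity input: if the square of the antipode is 1
  on a nonzero weight, that weight pairs positively with some simple root.
  \<open>\<chi>_root\<close> excludes roots of unity, which keeps quantum integers
  invertible.\<close>

locale cartan_braiding = braiding \<chi> for \<chi> :: "'i \<Rightarrow> 'i \<Rightarrow> 'k::field" +
  fixes A :: "'i \<Rightarrow> 'i \<Rightarrow> int"
  assumes A_diag: "A i i = 2"
    and A_off: "i \<noteq> j \<Longrightarrow> A i j \<le> 0"
    and \<chi>_nz: "\<chi> i j \<noteq> 0"
    and \<chi>_cartan: "\<chi> i j * \<chi> i j = \<chi> i i powi A i j"
    and \<chi>_root: "n > 0 \<Longrightarrow> \<chi> i i ^ n \<noteq> 1"
    and \<chi>_twist: "w \<noteq> [] \<Longrightarrow> half_twist w * half_twist w = 1 \<Longrightarrow> \<exists>i. (\<Sum>j\<leftarrow>w. A i j) > 0"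
begin

definition serre :: "'i \<Rightarrow> 'i \<Rightarrow> ('i, 'k) free" where
  "serre i j = (ad i ^^ nat (1 - A i j)) (\<theta> j)"

inductive_set serre_ideal :: "('i, 'k) free set" where
  gen: "i \<noteq> j \<Longrightarrow> serre i j \<in> serre_ideal"
| zero: "0 \<in> serre_ideal"
| add: "x \<in> serre_ideal \<Longrightarrow> y \<in> serre_ideal \<Longrightarrow> x + y \<in> serre_ideal"
| left: "x \<in> serre_ideal \<Longrightarrow> y * x \<in> serre_ideal"
| right: "x \<in> serre_ideal \<Longrightarrow> x * y \<in> serre_ideal"

lemma subsp_serre_ideal: "subsp serre_ideal"
proof -
  have "scale c x \<in> serre_ideal" if "x \<in> serre_ideal" for c x
    using serre_ideal.left[OF that, of "scale c 1"] by (simp add: scale_mult)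
  then show ?thesis by (simp add: subsp_def serre_ideal.zero serre_ideal.add)
qed

lemmas serre_ideal_simps = subspD[OF subsp_serre_ideal]

lemma K_ad_pow: "K l ((ad i ^^ n) y) = scale (\<chi> i l ^ n) ((ad i ^^ n) (K l y))"
  by (induction n) (simp_all add: K_ad ad_simps scale_simps)

lemma is_lin_ad_pow: "is_lin (ad i ^^ n)"
  by (induction n) (simp_all add: is_lin_def ad_simps)

lemmas ad_pow_simps = is_linD[OF is_lin_ad_pow]

lemma K_serre: "K l (serre i j) = scale (\<chi> i l ^ nat (1 - A i j) * \<chi> l j) (serre i j)"
  by (simp add: serre_def K_ad_pow ad_pow_simps scale_scale)

lemma K_serre_ideal: "x \<in> serre_ideal \<Longrightarrow> K l x \<in> serre_ideal"
  by (induction rule: serre_ideal.induct)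
     (simp_all add: K_serre K_mult K_simps serre_ideal_simps serre_ideal.gen serre_ideal.left
         serre_ideal.right)

lemma ad_serre_ideal: "x \<in> serre_ideal \<Longrightarrow> ad i x \<in> serre_ideal"
  by (simp add: ad_def K_serre_ideal serre_ideal.left serre_ideal.right serre_ideal_simps)

lemma ad_pow_serre_ideal: "x \<in> serre_ideal \<Longrightarrow> (ad i ^^ n) x \<in> serre_ideal"
  by (induction n) (simp_all add: ad_serre_ideal)

lemma \<chi>_ne_1: "\<chi> i i \<noteq> 1"
  using \<chi>_root[of 1 i] by simp

text \<open>The relation \<open>[e, f\<^sup>n\<^sup>+\<^sup>1] = [n+1][h-n] f\<^sup>n\<close> of quantum \<open>sl\<^sub>2\<close>, with \<open>e = lderiv i\<close>,
  \<open>f = ad i\<close> and a vector killed by \<open>e\<close> modulo \<open>I\<close>; \<open>K i\<close> is the square root of the Cartan element.\<close>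

lemma lderiv_ad_pow:
  fixes t :: 'k and i :: 'i and y :: "('i, 'k) free"
  defines "g \<equiv> \<lambda>n. (1 - \<chi> i i ^ Suc n) * (1 - t * t * \<chi> i i ^ n) / (1 - \<chi> i i)"
  assumes I: "subsp I" "\<And>x. x \<in> I \<Longrightarrow> ad i x \<in> I" "lderiv i y \<in> I" and K: "K i y = scale t y"
  shows "lderiv i ((ad i ^^ Suc n) y) - scale (g n) ((ad i ^^ n) y) \<in> I"
proof (induction n)
  case 0
  have "g 0 = 1 - t * t" using \<chi>_ne_1[of i] by (simp add: g_def)
  then have "lderiv i ((ad i ^^ Suc 0) y) - scale (g 0) ((ad i ^^ 0) y) = scale (\<chi> i i) (ad i
      (lderiv i y))"
    by (simp add: lderiv_ad K K_simps scale_simps)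
  then show ?case by (simp only: subspD[OF I(1)] I(2,3))
next
  case (Suc n)
  define z where "z = (ad i ^^ Suc n) y"
  define e where "e = lderiv i z - scale (g n) ((ad i ^^ n) y)"
  let ?b = "\<chi> i i"
  have e: "e \<in> I" "lderiv i z = scale (g n) ((ad i ^^ n) y) + e" using Suc by (simp_all add: e_def
      z_def)
  have Kz: "K i z = scale (t * ?b ^ Suc n) z"
    unfolding z_def K_ad_pow K by (simp add: ad_simps ad_pow_simps scale_simps mult_ac)
  have g: "g (Suc n) = 1 - t * ?b ^ Suc n * (t * ?b ^ Suc n) + ?b * g n"
    using \<chi>_ne_1[of i] by (simp add: g_def field_simps)
  have "lderiv i (ad i z) = z - scale (t * ?b ^ Suc n * (t * ?b ^ Suc n)) z + scale ?b (ad i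
      (lderiv i z))"
    unfolding lderiv_ad Kz K_simps by (simp add: scale_simps)
  also have "ad i (lderiv i z) = scale (g n) z + ad i e"
    unfolding e(2) by (simp add: ad_simps z_def)
  finally have "lderiv i (ad i z) - scale (g (Suc n)) z = scale ?b (ad i e)"
    by (simp add: g scale_simps)
  moreover have "scale ?b (ad i e) \<in> I" by (simp only: subspD[OF I(1)] I(2) e)
  ultimately show ?case by (simp add: z_def)
qed

lemma A_nat: "i \<noteq> j \<Longrightarrow> nat (1 - A i j) = Suc (nat (- A i j))"
  using A_off[of i j] by simp

text \<open>The origin of the exponent 1 - a_ij: the factor
  \<open>1 - t * t * \<chi> i i ^ n\<close> of \<open>lderiv_ad_pow\<close>, with
  \<open>t = \<chi> i j\<close>, is zero at n = -a_ij.\<close>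

lemma \<chi>_vanish: 
  assumes "i \<noteq> j" shows "\<chi> i j * \<chi> i j * \<chi> i i ^ nat (- A i j) = 1"
proof -
  have "\<chi> i i ^ nat (- A i j) = \<chi> i i powi (- A i j)" 
    using A_off[OF assms] by (simp add: power_int_def)
  then show ?thesis using \<chi>_nz[of i i] by (simp add: \<chi>_cartan power_int_minus)
qed

lemma ad_pow_1: "(ad i ^^ Suc n) 1 = 0"
  by (induction n) (simp_all add: ad_simps)

lemma lderiv_ad_pow_other: "l \<noteq> i \<Longrightarrow> lderiv l ((ad i ^^ n) y) = scale (\<chi> i l ^ n) ((ad i ^^ n)
    (lderiv l y))"
  by (induction n) (simp_all add: lderiv_ad_other ad_simps scale_simps)

text \<open>For l = i the quantum sl2 coefficient vanishes, where \<open>lderiv_ad_pow\<close> is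
  taken with I = 0. For l = j the derivation reaches \<open>\<theta> j\<close> and leaves a positive
  power of \<open>ad i\<close> applied to 1, which is 0.\<close>

lemma lderiv_serre: assumes "i \<noteq> j" shows "lderiv l (serre i j) = 0"
proof (cases "l = i")
  case True
  have "subsp {0::('i, 'k) free}" by (simp add: subsp_def)
  from lderiv_ad_pow[OF this, of i "\<theta> j" "\<chi> i j" "nat (- A i j)"] show ?thesis
    unfolding serre_def A_nat[OF assms] True using assms by (simp add: ad_simps \<chi>_vanish
        scale_simps)
qed (use A_nat[OF assms] in \<open>simp add: serre_def lderiv_ad_pow_other ad_pow_1 ad_pow_simps ad_simps
  del: funpow.simps\<close>)

lemma rderiv_ad_pow: "rderiv i y = 0 \<Longrightarrow> rderiv i ((ad i ^^ n) y) = 0"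
  by (induction n) (simp_all add: rderiv_ad K_simps scale_simps)

lemma rderiv_ad_pow_other_0: "l \<noteq> i \<Longrightarrow> rderiv l y = 0 \<Longrightarrow> rderiv l ((ad i ^^ n) y) = 0"
  by (induction n) (simp_all add: rderiv_ad_other K_simps scale_simps)

lemma K_theta_pow: "K i (\<theta> j ^ n) = scale (\<chi> i j ^ n) (\<theta> j ^ n)"
  by (induction n) (simp_all add: K_mult scale_mult scale_simps mult.commute)

lemma rderiv_ad_pow_theta: 
  "j \<noteq> i \<Longrightarrow> rderiv j ((ad i ^^ n) (\<theta> j)) = scale (\<Prod>k<n. 1 - \<chi> i j * \<chi> i j * \<chi> i i ^ k) (\<theta> i ^ n)"
proof (induction n)
  case (Suc n)
  then show ?case
    by (simp add: rderiv_ad_other K_simps K_theta_pow scale_mult scale_simps mult_ac algebra_simps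
        flip: power_Suc2)
qed simp

lemma rderiv_serre: assumes "i \<noteq> j" shows "rderiv l (serre i j) = 0"
proof -
  consider "l = i" | "l = j" | "l \<noteq> i" "l \<noteq> j" by blast
  then show ?thesis
  proof cases
    case 1
    then show ?thesis using assms by (simp add: serre_def rderiv_ad_pow)
  next
    case 2
    \<comment> \<open>The last factor, k = -a_ij, is zero by \<open>\<chi>_vanish\<close>.\<close>
    have "(\<Prod>k<nat (1 - A i j). 1 - \<chi> i j * \<chi> i j * \<chi> i i ^ k) = 0"
      using assms by (simp add: A_nat \<chi>_vanish)
    then show ?thesis unfolding serre_def 2 rderiv_ad_pow_theta[OF assms[symmetric]] by (simp
        only: scale_0)
  next
    case 3
    then show ?thesis by (simp add: serre_def rderiv_ad_pow_other_0)
  qed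
qed

lemma counit_ad: "counit (ad i y) = 0"
  using counit_theta[of i 1] by (simp add: ad_def counit_simps counit_mult)

lemma counit_serre_ideal: "x \<in> serre_ideal \<Longrightarrow> counit x = 0"
  by (induction rule: serre_ideal.induct)
     (simp_all add: serre_def A_nat counit_ad counit_simps counit_mult)

lemma lderiv_serre_ideal: "x \<in> serre_ideal \<Longrightarrow> lderiv i x \<in> serre_ideal"
  by (induction rule: serre_ideal.induct)
     (simp_all add: lderiv_serre lderiv_simps serre_ideal_simps lderiv_mult serre_ideal.left
         serre_ideal.right K_serre_ideal)

lemma rderiv_serre_ideal: "x \<in> serre_ideal \<Longrightarrow> rderiv i x \<in> serre_ideal"
  by (induction rule: serre_ideal.induct)
     (simp_all add: rderiv_serre rderiv_simps serre_ideal_simps rderiv_mult serre_ideal.left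
         serre_ideal.right K_serre_ideal)

lemma serre_ideal_radical: "serre_ideal \<subseteq> radical"
proof
  fix x assume "x \<in> serre_ideal"
  then have "lderivs w x \<in> serre_ideal" for w by (induction w arbitrary: x) (simp_all add:
      lderiv_serre_ideal)
  then show "x \<in> radical" by (simp add: radical_def counit_serre_ideal)
qed

section \<open>Reversal\<close>

text \<open>A power of \<open>ad i\<close> applied to a generator is a product of commuting operators \<open>skew i t\<close>.
  Reversal inverts the parameters \<open>t\<close>, which for a Serre element permutes them.\<close>

definition skew :: "'i \<Rightarrow> 'k \<Rightarrow> ('i, 'k) free \<Rightarrow> ('i, 'k) free" where
  "skew i t y = \<theta> i * y - scale t (y * \<theta> i)"

lemma skew_comm: "skew i t (skew i t' y) = skew i t' (skew i t y)"
  by (simp add: skew_def scale_simps scale_mult algebra_simps)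

lemma skew_simps: "skew i t (scale c x) = scale c (skew i t x)"
  by (simp add: skew_def scale_simps scale_mult algebra_simps)

lemma fold_skew_simps: "fold (skew i) ts (scale c x) = scale c (fold (skew i) ts x)"
  by (induction ts arbitrary: x) (simp_all add: skew_simps)

lemma reversal_skew: "t \<noteq> 0 \<Longrightarrow> reversal (skew i t y) = scale (- t) (skew i (inverse t) (reversal y))"
  by (simp add: skew_def reversal_simps reversal_mult scale_simps)

lemma reversal_fold_skew: "0 \<notin> set ts \<Longrightarrow> \<exists>c. reversal (fold (skew i) ts y) = scale c (fold (skew i)
    (map inverse ts) (reversal y))"
proof (induction ts arbitrary: y)
  case Nil
  show ?case by (rule exI[of _ 1]) simp
next
  case (Cons t ts)
  then obtain c where "reversal (fold (skew i) ts (skew i t y)) = scale c (fold (skew i) (map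
      inverse ts) (reversal (skew i t y)))"
    by fastforce
  then show ?case using Cons.prems by (auto simp: reversal_skew fold_skew_simps scale_scale)
qed

lemma ad_pow_skew: "(ad i ^^ n) (\<theta> j) = fold (skew i) (map (\<lambda>k. \<chi> i j * \<chi> i i ^ k) [0..<n]) (\<theta> j)"
proof (induction n)
  case (Suc n)
  have "ad i ((ad i ^^ n) (\<theta> j)) = skew i (\<chi> i j * \<chi> i i ^ n) ((ad i ^^ n) (\<theta> j))"
    by (subst ad_def) (simp add: skew_def K_ad_pow ad_pow_simps scale_mult scale_simps mult.commute)
  with Suc show ?case by simp
qed simp

lemma reversal_serre: assumes "i \<noteq> j" shows "reversal (serre i j) \<in> serre_ideal"
proof -
  define N where "N = nat (- A i j)"
  define ts where "ts = map (\<lambda>k. \<chi> i j * \<chi> i i ^ k) [0..<Suc N]"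
  have s: "serre i j = fold (skew i) ts (\<theta> j)"
    unfolding serre_def ad_pow_skew ts_def N_def A_nat[OF assms] ..
  \<comment> \<open>The parameters t_0, ..., t_N satisfy t_k t_(N-k) = 1 by
    \<open>\<chi>_vanish\<close>, so inverting them reverses the list.\<close>
  have "map inverse ts = rev ts"
  proof (rule nth_equalityI)
    show "map inverse ts ! k = rev ts ! k" if "k < length (map inverse ts)" for k
    proof -
      have k: "k \<le> N" using that by (simp add: ts_def)
      have "\<chi> i j * \<chi> i i ^ k * (\<chi> i j * \<chi> i i ^ (N - k)) = 1"
        using \<chi>_vanish[OF assms] k by (simp add: N_def power_add[symmetric] mult_ac)
      then have "inverse (\<chi> i j * \<chi> i i ^ k) = \<chi> i j * \<chi> i i ^ (N - k)"
        by (rule inverse_unique)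
      then show ?thesis using k by (simp add: ts_def rev_nth less_Suc_eq_le del: upt_Suc)
    qed
  qed simp
  moreover have "fold (skew i) (rev ts) = fold (skew i) ts"
    by (rule fold_rev) (simp add: fun_eq_iff skew_comm)
  moreover have "0 \<notin> set ts" by (auto simp: ts_def \<chi>_nz)
  ultimately obtain c where "reversal (serre i j) = scale c (serre i j)"
    unfolding s using reversal_fold_skew[of ts i "\<theta> j"] by auto
  then show ?thesis using serre_ideal.gen[OF assms] by (simp add: serre_ideal_simps)
qed

lemma reversal_serre_ideal: "x \<in> serre_ideal \<Longrightarrow> reversal x \<in> serre_ideal"
  by (induction rule: serre_ideal.induct)
     (simp_all add: reversal_serre reversal_simps serre_ideal_simps reversal_mult serre_ideal.left
         serre_ideal.right)

section \<open>Stability of the Serre ideal under the antipode\<close>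

lemma K_comp_simps:
  "\<exists>c. foldr K w (\<theta> i * x) = scale c (\<theta> i * foldr K w x)"
  "\<exists>c. foldr K w (x * \<theta> i) = scale c (foldr K w x * \<theta> i)"
  "\<exists>c. foldr K w (serre i j) = scale c (serre i j)"
proof -
  show "\<exists>c. foldr K w (\<theta> i * x) = scale c (\<theta> i * foldr K w x)"
  proof (induction w)
    case Nil show ?case by (rule exI[of _ 1]) simp
  qed (auto simp: K_simps K_theta_mult scale_scale)
  show "\<exists>c. foldr K w (x * \<theta> i) = scale c (foldr K w x * \<theta> i)"
  proof (induction w)
    case Nil show ?case by (rule exI[of _ 1]) simp
  qed (auto simp: K_simps K_mult scale_scale scale_mult)
  show "\<exists>c. foldr K w (serre i j) = scale c (serre i j)"
  proof (induction w)
    case Nil show ?case by (rule exI[of _ 1]) simp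
  qed (auto simp: K_simps serre_def K_ad_pow ad_pow_simps scale_scale)
qed

lemma antip_mult_theta: "antip (x * \<theta> i) = - (\<theta> i * antip (K i x))"
proof (rule mon_ext[of "\<lambda>x. antip (x * \<theta> i)"])
  show "antip (mon (Word w) * \<theta> i) = - (\<theta> i * antip (K i (mon (Word w))))" for w
  proof -
    have "mon (Word w) * \<theta> i = (mon (Word (w @ [i])) :: ('i, 'k) free)"
      by (simp add: \<theta>_def mon_mult plus_word_def)
    then show ?thesis
      using half_twist_insert[of w i "[]"] 
      by (simp add: antip_mon K_mon antip_simps scale_mult scale_simps theta_mult_mon mult_ac)
  qed
qed (simp_all add: is_lin_def distrib_left distrib_right antip_simps K_simps scale_mult
    scale_uminus)

lemma supp_ad: "supp (\<lambda>u. mset u = N) y \<Longrightarrow> supp (\<lambda>u. mset u = add_mset i N) (ad i y)"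
proof (erule supp_lin[OF is_lin_ad, rotated])
  fix w assume "mset w = N"
  moreover have "ad i (mon (Word w)) = mon (Word (i # w)) + scale (- chi_prod i w) (mon (Word (w @
      [i])))"
    by (simp add: ad_def K_mon theta_mult_mon scale_mult scale_simps)
       (simp add: \<theta>_def mon_mult plus_word_def)
  ultimately show "supp (\<lambda>u. mset u = add_mset i N) (ad i (mon (Word w)))"
    by (auto intro!: supp_simps supp_mon)
qed

lemma supp_serre: "\<exists>w. supp (\<lambda>u. mset u = mset w) (serre i j)"
proof -
  have "supp (\<lambda>u. mset u = mset (replicate n i @ [j])) ((ad i ^^ n) (\<theta> j))" for n
    by (induction n) (auto intro: supp_ad supp_mon simp: \<theta>_def)
  then show ?thesis unfolding serre_def by blast
qed

text \<open>A Serre element has a single weight, so there the antipode is reversal up to a scalar.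
  The rest is the passage from generators to the ideal.\<close>

lemma antip_serre_ideal: "x \<in> serre_ideal \<Longrightarrow> antip x \<in> serre_ideal"
proof -
  \<comment> \<open>The antipode reverses products only up to a twist:
    \<open>antip (\<theta> i * y)\<close> involves \<open>antip (K i y)\<close>. The induction
    therefore needs all compositions of the operators \<open>K\<close> at once.\<close>
  define Q where "Q = {x. \<forall>w. antip (foldr K w x) \<in> serre_ideal}"
  have lin: "is_lin (foldr K w)" for w by (induction w) (simp_all add: is_lin_def K_simps)
  have KK: "foldr K w (K i x) = foldr K (w @ [i]) x" for w i x by simp
  have Q: "subsp Q"
    by (auto simp: subsp_def Q_def is_linD[OF lin] antip_simps serre_ideal_simps)
  have left: "y * x \<in> Q" if "x \<in> Q" for x y
  proof (induction y rule: free_induct)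
    case (theta i y)
    show ?case unfolding Q_def
    proof safe
      fix w
      obtain c where c: "foldr K w (\<theta> i * (y * x)) = scale c (\<theta> i * foldr K w (y * x))"
        using K_comp_simps(1) by blast
      have "antip (foldr K (i # w) (y * x)) \<in> serre_ideal" using theta unfolding Q_def by blast
      then show "antip (foldr K w (\<theta> i * y * x)) \<in> serre_ideal"
        by (simp add: mult.assoc c antip_simps antip_theta_mult serre_ideal_simps serre_ideal.right)
    qed
  qed (use that in \<open>simp_all add: subspD[OF Q] distrib_right scale_mult\<close>)
  have right: "x * y \<in> Q" if "x \<in> Q" for x y
    using that
  proof (induction y arbitrary: x rule: free_induct)
    case (theta i y)
    have "x * \<theta> i \<in> Q" unfolding Q_def
    proof safe
      fix w
      obtain c where c: "foldr K w (x * \<theta> i) = scale c (foldr K w x * \<theta> i)"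
        using K_comp_simps(2) by blast
      have "antip (foldr K (i # w) x) \<in> serre_ideal" using theta unfolding Q_def by blast
      then show "antip (foldr K w (x * \<theta> i)) \<in> serre_ideal"
        by (simp add: c antip_simps antip_mult_theta serre_ideal_simps serre_ideal.left)
    qed
    from theta.IH[OF this] show ?case by (simp add: mult.assoc)
  qed (simp_all add: subspD[OF Q] distrib_left scale_mult)
  have gen: "serre i j \<in> Q" if "i \<noteq> j" for i j
  proof -
    obtain u where u: "supp (\<lambda>v. mset v = mset u) (serre i j)" using supp_serre by blast
    show ?thesis unfolding Q_def
    proof safe
      fix w
      obtain c where c: "foldr K w (serre i j) = scale c (serre i j)"
        using K_comp_simps(3) by blast
      show "antip (foldr K w (serre i j)) \<in> serre_ideal"
        by (simp add: c antip_simps antip_supp[OF u] serre_ideal_simps reversal_serre that)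
    qed
  qed
  assume "x \<in> serre_ideal"
  then have "x \<in> Q"
    by induction (simp_all add: subspD[OF Q] gen left right)
  then have "antip (foldr K [] x) \<in> serre_ideal" unfolding Q_def by blast
  then show "antip x \<in> serre_ideal" by simp
qed

end

context cartan_braiding
begin

section \<open>Local nilpotency of the adjoint action\<close>

text \<open>It serves as the kernel of \<open>rderiv i\<close>: it lies in that kernel by
  \<open>rderiv_ad_subalg\<close>, and \<open>rderiv_serre_ideal_ad_subalg\<close> gives the
  converse modulo the Serre ideal.\<close>

inductive_set ad_subalg :: "'i \<Rightarrow> ('i, 'k) free set" for i where
  one: "1 \<in> ad_subalg i"
| gen: "j \<noteq> i \<Longrightarrow> (ad i ^^ k) (\<theta> j) \<in> ad_subalg i"
| add: "x \<in> ad_subalg i \<Longrightarrow> y \<in> ad_subalg i \<Longrightarrow> x + y \<in> ad_subalg i"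
| mult: "x \<in> ad_subalg i \<Longrightarrow> y \<in> ad_subalg i \<Longrightarrow> x * y \<in> ad_subalg i"
| scale: "x \<in> ad_subalg i \<Longrightarrow> scale c x \<in> ad_subalg i"

lemma subsp_ad_subalg: "subsp (ad_subalg i)"
  using ad_subalg.scale[OF ad_subalg.one, of 0 i] by (simp add: subsp_def scale_0 ad_subalg.add
      ad_subalg.scale)

lemma K_ad_subalg: "x \<in> ad_subalg i \<Longrightarrow> K l x \<in> ad_subalg i"
  by (induction rule: ad_subalg.induct)
     (simp_all add: K_ad_pow ad_pow_simps K_simps K_mult ad_subalg.intros)

lemma ad_ad_subalg: "x \<in> ad_subalg i \<Longrightarrow> ad i x \<in> ad_subalg i"
proof (induction rule: ad_subalg.induct)
  case one
  show ?case using subspD(1)[OF subsp_ad_subalg] by simp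
next
  case (gen j k)
  then show ?case using ad_subalg.gen[of j i "Suc k"] by simp
qed (simp_all add: ad_simps ad_mult K_ad_subalg ad_subalg.intros)

lemma rderiv_ad_subalg: "x \<in> ad_subalg i \<Longrightarrow> rderiv i x = 0"
  by (induction rule: ad_subalg.induct)
     (simp_all add: rderiv_ad_pow rderiv_simps rderiv_mult)

text \<open>Instead of a q-binomial Leibniz formula, one \<open>ad i\<close> is moved into either
  factor and the induction runs on m + n.\<close>

lemma ad_pow_mult_serre_ideal: 
  "(ad i ^^ m) x \<in> serre_ideal \<Longrightarrow> (ad i ^^ n) y \<in> serre_ideal \<Longrightarrow> (ad i ^^ (m + n)) (x * y) \<in>
      serre_ideal"
proof (induction "m + n" arbitrary: m n x y)
  case 0
  then show ?case by (simp add: serre_ideal.left)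
next
  case (Suc k)
  show ?case
  proof (cases "m = 0 \<or> n = 0")
    case True
    then have "x * y \<in> serre_ideal" using Suc.prems by (auto simp: serre_ideal.left
        serre_ideal.right)
    then show ?thesis by (rule ad_pow_serre_ideal)
  next
    case False
    then obtain m' n' where mn: "m = Suc m'" "n = Suc n'" by (meson not0_implies_Suc)
    have 1: "(ad i ^^ (m' + n)) (ad i x * y) \<in> serre_ideal"
      using Suc.prems by (intro Suc.hyps(1)) (use Suc.hyps(2) in \<open>simp_all add: mn funpow_swap1\<close>)
    \<comment> \<open>The twisted factor \<open>K i x\<close> inherits the hypothesis on x, because
      \<open>K i\<close> commutes with powers of \<open>ad i\<close> up to an invertible
      scalar.\<close>
    have "(ad i ^^ m) (K i x) \<in> serre_ideal"
    proof -
      have "scale (inverse (\<chi> i i ^ m)) (K i ((ad i ^^ m) x)) \<in> serre_ideal"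
        by (intro serre_ideal_simps K_serre_ideal Suc.prems)
      then show ?thesis by (simp add: K_ad_pow scale_scale \<chi>_nz)
    qed
    then have 2: "(ad i ^^ (m + n')) (K i x * ad i y) \<in> serre_ideal"
      using Suc.prems by (intro Suc.hyps(1)) (use Suc.hyps(2) in \<open>simp_all add: mn funpow_swap1\<close>)
    have "(ad i ^^ (m + n)) (x * y) = (ad i ^^ (m' + n)) (ad i (x * y))"
      unfolding mn(1) add_Suc funpow_Suc_right o_apply ..
    moreover have "m + n' = m' + n" by (simp add: mn)
    ultimately have "(ad i ^^ (m + n)) (x * y)
        = (ad i ^^ (m' + n)) (ad i x * y) + (ad i ^^ (m + n')) (K i x * ad i y)"
      by (simp only: ad_mult ad_pow_simps)
    with 1 2 show ?thesis by (simp only: serre_ideal_simps)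
  qed
qed

lemma ad_pow_serre_ideal_mono: "(ad i ^^ m) x \<in> serre_ideal \<Longrightarrow> (ad i ^^ (n + m)) x \<in> serre_ideal"
  by (simp add: funpow_add ad_pow_serre_ideal)

lemma ad_subalg_nil: "x \<in> ad_subalg i \<Longrightarrow> \<exists>n. (ad i ^^ n) x \<in> serre_ideal"
proof (induction rule: ad_subalg.induct)
  case one
  show ?case by (rule exI[of _ "Suc 0"]) (simp add: serre_ideal_simps)
next
  case (gen j k)
  have "(ad i ^^ (k + nat (1 - A i j))) (\<theta> j) \<in> serre_ideal"
    using serre_ideal.gen[of i j] gen unfolding serre_def by (intro ad_pow_serre_ideal_mono) auto
  then have "(ad i ^^ nat (1 - A i j)) ((ad i ^^ k) (\<theta> j)) \<in> serre_ideal"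
    by (simp add: add.commute[of k] funpow_add)
  then show ?case by blast
next
  case (add x y)
  then obtain m n where mn: "(ad i ^^ m) x \<in> serre_ideal" "(ad i ^^ n) y \<in> serre_ideal" by blast
  have "(ad i ^^ (m + n)) (x + y) \<in> serre_ideal"
    using ad_pow_serre_ideal_mono[OF mn(1), of n] ad_pow_serre_ideal_mono[OF mn(2), of m]
    by (simp add: ad_pow_simps serre_ideal_simps add.commute)
  then show ?case by blast
next
  case (mult x y)
  then show ?case using ad_pow_mult_serre_ideal by blast
next
  case (scale x c)
  then show ?case by (metis ad_pow_simps(2) serre_ideal_simps(3))
qed

text \<open>The rule \<open>\<theta> i * y = ad i y + K i y * \<theta> i\<close> moves every
  \<open>\<theta> i\<close> to the right, and both \<open>ad i\<close> and \<open>K i\<close>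
  preserve the subalgebra.\<close>

lemma ad_subalg_decomp: "\<exists>N y. (\<forall>n. y n \<in> ad_subalg i) \<and> x = (\<Sum>n<Suc N. y n * \<theta> i ^ n)"
proof (induction x rule: free_induct)
  case one
  have "1 = (\<Sum>n<Suc 0. (if n = 0 then 1 else 0) * \<theta> i ^ n)" by simp
  moreover have "\<forall>n. (if n = (0::nat) then 1 else 0) \<in> ad_subalg i"
    using subspD(1)[OF subsp_ad_subalg] by (simp add: ad_subalg.one)
  ultimately show ?case by fast
next
  case (theta j x)
  then obtain N y where y: "\<And>n. y n \<in> ad_subalg i" "x = (\<Sum>n<Suc N. y n * \<theta> i ^ n)" by blast
  show ?case
  proof (cases "j = i")
    case False
    have "\<theta> j * x = (\<Sum>n<Suc N. (\<theta> j * y n) * \<theta> i ^ n)"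
      by (simp add: y(2) sum_distrib_left mult.assoc distrib_left)
    moreover have "\<theta> j * y n \<in> ad_subalg i" for n
      using ad_subalg.gen[OF False, of 0] y(1) by (simp add: ad_subalg.mult)
    ultimately show ?thesis
      by (intro exI[of _ N] exI[of _ "\<lambda>n. \<theta> j * y n"]) blast
  next
    case True
    \<comment> \<open>The \<open>ad i\<close> part keeps the power of \<open>\<theta> i\<close> and
      the \<open>K i\<close> part raises it by one. The cutoff is needed because the values of y
      beyond N are arbitrary.\<close>
    define y' where "y' n = (if n < Suc N then ad i (y n) else 0) + (case n of 0 \<Rightarrow> 0 | Suc k \<Rightarrow> K i
        (y k))" for n
    have "\<theta> i * y n = ad i (y n) + K i (y n) * \<theta> i" for n by (simp add: ad_def)
    then have "\<theta> i * x = (\<Sum>n<Suc N. ad i (y n) * \<theta> i ^ n) + (\<Sum>n<Suc N. K i (y n) * \<theta> i ^ Suc n)"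
      unfolding y(2) sum_distrib_left sum.distrib[symmetric]
      by (intro sum.cong refl) (metis (no_types) distrib_right mult.assoc power_Suc)
    also have "(\<Sum>n<Suc N. ad i (y n) * \<theta> i ^ n) = (\<Sum>n<Suc (Suc N). (if n < Suc N then ad i (y n)
        else 0) * \<theta> i ^ n)"
      by (subst (2) sum.lessThan_Suc) simp
    also have "(\<Sum>n<Suc N. K i (y n) * \<theta> i ^ Suc n) = (\<Sum>n<Suc (Suc N). (case n of 0 \<Rightarrow> 0 | Suc k \<Rightarrow> K
        i (y k)) * \<theta> i ^ n)"
      by (subst (2) sum.lessThan_Suc_shift) simp
    finally have "\<theta> i * x = (\<Sum>n<Suc (Suc N). y' n * \<theta> i ^ n)"
      unfolding y'_def by (simp only: distrib_right sum.distrib)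
    moreover have "y' n \<in> ad_subalg i" for n
      unfolding y'_def using y(1) by (auto intro!: subspD[OF subsp_ad_subalg] ad_ad_subalg
          K_ad_subalg split: nat.split)
    ultimately show ?thesis unfolding True by blast
  qed
next
  case (add x x')
  obtain N y where y: "\<And>n. y n \<in> ad_subalg i" "x = (\<Sum>n<Suc N. y n * \<theta> i ^ n)" using add by blast
  obtain N' y' where y': "\<And>n. y' n \<in> ad_subalg i" "x' = (\<Sum>n<Suc N'. y' n * \<theta> i ^ n)" using add by
      blast
  have ext: "(\<Sum>n<Suc N. y n * \<theta> i ^ n) = (\<Sum>n<Suc (N + N'). (if n < Suc N then y n else 0) * \<theta> i ^
      n)"
    for N N' and y :: "nat \<Rightarrow> ('i, 'k) free"
    by (rule sum.mono_neutral_cong_left) auto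
  have "x + x' = (\<Sum>n<Suc (N + N'). ((if n < Suc N then y n else 0) + (if n < Suc N' then y' n else
      0)) * \<theta> i ^ n)"
    unfolding y(2) y'(2) ext[where N = N and N' = N' and y = y] ext[where N = N' and N' = N and y
        = y'] distrib_right sum.distrib
    by (simp only: add.commute[of N' N])
  moreover have "(if n < Suc N then y n else 0) + (if n < Suc N' then y' n else 0) \<in> ad_subalg i"
      for n
    using y(1) y'(1) by (auto intro!: subspD[OF subsp_ad_subalg])
  ultimately show ?case
    by (intro exI[of _ "N + N'"]
      exI[of _ "\<lambda>n. (if n < Suc N then y n else 0) + (if n < Suc N' then y' n else 0)"]) blast
next
  case (scale c x)
  then obtain N y where y: "\<And>n. y n \<in> ad_subalg i" "x = (\<Sum>n<Suc N. y n * \<theta> i ^ n)" by blast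
  have "scale c x = (\<Sum>n<Suc N. scale c (y n) * \<theta> i ^ n)"
    by (simp add: y(2) scale_sum scale_mult scale_add)
  then show ?case using ad_subalg.scale[OF y(1)]
    by (intro exI[of _ N] exI[of _ "\<lambda>n. scale c (y n)"]) blast
qed

definition qnum :: "'i \<Rightarrow> nat \<Rightarrow> 'k" where
  "qnum i n = (1 - \<chi> i i ^ n) / (1 - \<chi> i i)"

lemma qnum_nz: "n > 0 \<Longrightarrow> qnum i n \<noteq> 0"
  using \<chi>_root[of n i] \<chi>_ne_1[of i] by (simp add: qnum_def)

lemma rderiv_theta_pow: "rderiv i (\<theta> i ^ Suc n) = scale (qnum i (Suc n)) (\<theta> i ^ n)"
proof (induction n)
  case 0
  then show ?case using \<chi>_ne_1[of i] by (simp add: qnum_def)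
next
  case (Suc n)
  have "qnum i (Suc (Suc n)) = qnum i (Suc n) + \<chi> i i ^ Suc n"
    using \<chi>_ne_1[of i] by (simp add: qnum_def field_simps)
  moreover have "rderiv i (\<theta> i * \<theta> i ^ Suc n) = scale (qnum i (Suc n)) (\<theta> i * \<theta> i ^ n) + scale (\<chi>
      i i ^ Suc n) (\<theta> i ^ Suc n)"
    by (simp only: rderiv_theta_mult Suc.IH K_theta_pow scale_mult if_True refl)
  ultimately show ?case by (simp only: scale_simps power_Suc[of "\<theta> i"])
qed

lemma rderiv_sum_theta_pow:
  assumes "\<And>n. y n \<in> ad_subalg i"
  shows "rderiv i (\<Sum>n<Suc N. y n * \<theta> i ^ n) = (\<Sum>n<N. scale (qnum i (Suc n)) (y (Suc n)) * \<theta> i ^ n)"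
proof -
  have "rderiv i (\<Sum>n<Suc N. y n * \<theta> i ^ n) = (\<Sum>n<Suc N. y n * rderiv i (\<theta> i ^ n))"
    by (subst is_lin_sum[OF is_lin_rderiv]) (simp add: rderiv_mult rderiv_ad_subalg[OF assms])
  also have "\<dots> = (\<Sum>n<N. y (Suc n) * rderiv i (\<theta> i ^ Suc n))"
    by (subst sum.lessThan_Suc_shift) simp
  finally show ?thesis by (simp only: rderiv_theta_pow scale_mult)
qed

text \<open>\<open>rderiv i\<close> kills the coefficients and lowers the powers of
  \<open>\<theta> i\<close>, so N applications leave only the top coefficient, times a quantum
  factorial.\<close>

lemma rderiv_pow_sum:
  assumes "\<And>n. y n \<in> ad_subalg i"
  shows "\<exists>c. c \<noteq> 0 \<and> (rderiv i ^^ N) (\<Sum>n<Suc N. y n * \<theta> i ^ n) = scale c (y N)"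
  using assms
proof (induction N arbitrary: y)
  case 0
  show ?case by (rule exI[of _ 1]) simp
next
  case (Suc N)
  obtain c where c: "c \<noteq> 0"
    "(rderiv i ^^ N) (\<Sum>n<Suc N. scale (qnum i (Suc n)) (y (Suc n)) * \<theta> i ^ n) = scale c (scale
        (qnum i (Suc N)) (y (Suc N)))"
    using Suc.IH[of "\<lambda>n. scale (qnum i (Suc n)) (y (Suc n))"] ad_subalg.scale[OF Suc.prems] by blast
  have "(rderiv i ^^ Suc N) (\<Sum>n<Suc (Suc N). y n * \<theta> i ^ n) = scale (c * qnum i (Suc N)) (y (Suc
      N))"
    unfolding funpow_Suc_right o_apply rderiv_sum_theta_pow[OF Suc.prems] c(2) scale_scale ..
  moreover have "c * qnum i (Suc N) \<noteq> 0" using c(1) qnum_nz by simp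
  ultimately show ?case by blast
qed

text \<open>The Serre ideal is stable under \<open>rderiv i\<close>, so the top coefficient of the
  decomposition of x lies in it and can be discarded. Repeating this leaves the constant
  coefficient, an element of the subalgebra.\<close>

lemma rderiv_serre_ideal_ad_subalg:
  assumes "rderiv i x \<in> serre_ideal" shows "\<exists>y\<in>ad_subalg i. x - y \<in> serre_ideal"
proof -
  obtain N y where "\<forall>n. y n \<in> ad_subalg i" "x = (\<Sum>n<Suc N. y n * \<theta> i ^ n)" using ad_subalg_decomp
      by blast
  then show ?thesis using assms
  proof (induction N arbitrary: x)
    case 0
    then show ?case by (intro bexI[of _ x]) (simp_all add: serre_ideal_simps)
  next
    case (Suc N)
    obtain c where c: "c \<noteq> 0" "(rderiv i ^^ Suc N) x = scale c (y (Suc N))"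
      using rderiv_pow_sum[of y i "Suc N"] Suc.prems(1,2) by blast
    have "(rderiv i ^^ N) (rderiv i x) \<in> serre_ideal"
      using Suc.prems(3) by (induction N) (simp_all add: rderiv_serre_ideal)
    then have "scale c (y (Suc N)) \<in> serre_ideal" unfolding c(2)[symmetric] funpow_Suc_right by simp
    then have "scale (inverse c) (scale c (y (Suc N))) \<in> serre_ideal" by (rule serre_ideal_simps)
    then have y: "y (Suc N) * \<theta> i ^ Suc N \<in> serre_ideal" using c(1) by (simp add: scale_scale
        serre_ideal.right)
    define x' where "x' = (\<Sum>n<Suc N. y n * \<theta> i ^ n)"
    have x: "x = x' + y (Suc N) * \<theta> i ^ Suc N" by (simp add: Suc.prems(2) x'_def)
    have "rderiv i x - rderiv i (y (Suc N) * \<theta> i ^ Suc N) \<in> serre_ideal"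
      using Suc.prems(3) y rderiv_serre_ideal serre_ideal_simps(5) by blast
    then have "rderiv i x' \<in> serre_ideal" by (simp add: x rderiv_simps)
    from Suc.IH[OF Suc.prems(1) x'_def this] obtain z where "z \<in> ad_subalg i" "x' - z \<in>
        serre_ideal" by blast
    moreover from this(2) y have "x - z \<in> serre_ideal"
      unfolding x using serre_ideal_simps(2)[of "x' - z"] by (metis add_diff_eq diff_add_eq
          add.commute)
    ultimately show ?case by blast
  qed
qed

lemma rderiv_serre_ideal_nil: "rderiv i x \<in> serre_ideal \<Longrightarrow> \<exists>n. (ad i ^^ n) x \<in> serre_ideal"
proof -
  assume "rderiv i x \<in> serre_ideal"
  then obtain y where y: "y \<in> ad_subalg i" "x - y \<in> serre_ideal" using
      rderiv_serre_ideal_ad_subalg by blast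
  obtain n where "(ad i ^^ n) y \<in> serre_ideal" using ad_subalg_nil[OF y(1)] by blast
  moreover have "(ad i ^^ n) (x - y) \<in> serre_ideal" by (rule ad_pow_serre_ideal[OF y(2)])
  ultimately have "(ad i ^^ n) (x - y) + (ad i ^^ n) y \<in> serre_ideal" by (simp add:
      serre_ideal_simps)
  then show ?thesis by (auto simp flip: ad_pow_simps)
qed

section \<open>The radical is the Serre ideal\<close>

text \<open>Local nilpotency of \<open>ad i\<close> would put \<open>x\<close> into a finite-dimensional \<open>sl\<^sub>2\<close>-module, in which a
  vector killed by \<open>lderiv i\<close> cannot have the weight that the last assumption prescribes.\<close>

lemma singular_serre_ideal:
  assumes "supp (\<lambda>u. mset u = mset w) x" "lderiv i x \<in> serre_ideal" "rderiv i x \<in> serre_ideal"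
      "(\<Sum>j\<leftarrow>w. A i j) > 0"
  shows "x \<in> serre_ideal"
proof -
  have chi_prod: "chi_prod i w * chi_prod i w = \<chi> i i powi (\<Sum>j\<leftarrow>w. A i j)" for w
    by (induction w) (simp_all add: power_int_add \<chi>_nz \<chi>_cartan[symmetric] mult_ac)
  obtain n where "(ad i ^^ n) x \<in> serre_ideal" using rderiv_serre_ideal_nil[OF assms(3)] by blast
  then show ?thesis
  proof (induction n)
    case (Suc n)
    define m where "m = nat (\<Sum>j\<leftarrow>w. A i j)"
    have "chi_prod i w * chi_prod i w * \<chi> i i ^ n = \<chi> i i ^ (m + n)"
      using assms(4) by (simp add: chi_prod m_def power_int_def power_add)
    \<comment> \<open>The coefficient of \<open>lderiv_ad_pow\<close>. The weight enters as the
      square of \<open>chi_prod i w\<close>, which is the m-th power of \<open>\<chi> i i\<close>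
      with m > 0, so both factors of the numerator are nonzero and one can descend from n + 1 to
      n.\<close>
    define g where "g = (1 - \<chi> i i ^ Suc n) * (1 - chi_prod i w * chi_prod i w * \<chi> i i ^ n) / (1 -
        \<chi> i i)"
    have g: "g \<noteq> 0" 
      using \<chi>_root[of "m + n" i] \<chi>_root[of "Suc n" i] \<chi>_ne_1[of i] assms(4)
      by (simp add: g_def \<open>chi_prod i w * chi_prod i w * \<chi> i i ^ n = _\<close> m_def)
    have "lderiv i ((ad i ^^ Suc n) x) - scale g ((ad i ^^ n) x) \<in> serre_ideal"
      unfolding g_def by (rule lderiv_ad_pow[OF subsp_serre_ideal ad_serre_ideal assms(2)
          K_supp[OF assms(1)]])
    with lderiv_serre_ideal[OF Suc.prems]
    have "lderiv i ((ad i ^^ Suc n) x) - (lderiv i ((ad i ^^ Suc n) x) - scale g ((ad i ^^ n) x))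
        \<in> serre_ideal"
      by (rule serre_ideal_simps)
    then have "scale g ((ad i ^^ n) x) \<in> serre_ideal" by (simp del: funpow.simps)
    then have "scale (inverse g) (scale g ((ad i ^^ n) x)) \<in> serre_ideal" by (rule
        serre_ideal_simps)
    then show ?case using g Suc.IH by (simp add: scale_scale)
  qed simp
qed

text \<open>By \<open>tensor_kernel\<close>, all terms of the coproduct of \<open>x\<close> with two factors of positive degree
  can be neglected modulo the Serre ideal, so that the antipode identity reduces to its extreme terms.\<close>

lemma primitive_antip:
  assumes IH: "\<And>y. y \<in> radical \<Longrightarrow> supp (\<lambda>w. length w < n) y \<Longrightarrow> y \<in> serre_ideal"
    and x: "x \<in> radical" "supp (\<lambda>w. length w = n) x"
  shows "antip x + x \<in> serre_ideal"
proof -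
  \<comment> \<open>The inner terms of the coproduct. Both factors are nonempty words, hence shorter
    than n.\<close>
  define T where "T = {t \<in> Poly_Mapping.keys (coprod x). fst t \<noteq> 0 \<and> snd t \<noteq> 0}"
  have T: "finite T" by (simp add: T_def)
  have sumT: "(\<Sum>t\<in>T. scale (Poly_Mapping.lookup (coprod x) t) (f t))
      = lin (\<lambda>t. if fst t \<noteq> 0 \<and> snd t \<noteq> 0 then f t else 0) (coprod x)" for f :: "_ \<Rightarrow> ('i, 'k) free"
    unfolding lin_def T_def by (subst sum.inter_filter) (auto intro!: sum.cong)
  have x0: "counit (rderivs z x) = 0" for z using x(1) by (simp add: radical_rderivs)
  from x0[of "[]"] have x00: "counit x = 0" by simp
  have cm: "counit (mon v) = (if v = 0 then 1 else 0)" for v :: "'i word"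
    by (auto simp: counit_def mon_def lookup_single)
  have m0: "mon 0 = (1 :: ('i, 'k) free)" by (simp add: mon_def)
  \<comment> \<open>The common kernel of the chosen functionals is the radical, which in V lies in
    the Serre ideal by \<open>IH\<close>. The slices of the inner terms are 0 or proper derivatives
    of x, covered by \<open>IH\<close> as well.\<close>
  have "(\<Sum>t\<in>T. (\<lambda>a b. antip a * b) (scale (Poly_Mapping.lookup (coprod x) t) (mon (fst t))) (mon
      (snd t))) \<in> serre_ideal"
  proof (rule tensor_kernel[where \<Phi> = "range (\<lambda>z v. counit (rderivs z v))" and V = "{v. supp (\<lambda>w.
      length w < n) v}"
        and W = serre_ideal and N = serre_ideal and \<beta> = "\<lambda>a b. antip a * b"])
    show "is_functional \<phi>" if "\<phi> \<in> range (\<lambda>z v. counit (rderivs z v))" for \<phi> :: "('i, 'k) free \<Rightarrow> 'k"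
      using that by (auto simp: is_functional_counit_rderivs)
    show "mon (snd t) \<in> {v. supp (\<lambda>w. length w < n) v}" if "t \<in> T" for t
    proof -
      have "length (letters (fst t)) + length (letters (snd t)) = n"
        using that by (intro supp_coprod[of _ _ x] x(2)) (simp add: T_def)
      moreover have "letters (fst t) \<noteq> []" using that by (cases "fst t") (auto simp: T_def
          zero_word_def)
      ultimately have "length (letters (snd t)) < n" by (simp flip: length_greater_0_conv)
      then show ?thesis using supp_mon[of "\<lambda>w. length w < n" "letters (snd t)"] by simp
    qed
    show "(\<Sum>t\<in>T. scale (\<phi> (mon (snd t))) (scale (Poly_Mapping.lookup (coprod x) t) (mon (fst t))))
        \<in> serre_ideal"
      if "\<phi> \<in> range (\<lambda>z v. counit (rderivs z v))" for \<phi>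
    proof -
      from that obtain z where \<phi>: "\<phi> = (\<lambda>v. counit (rderivs z v))" by auto
      have *: "(\<Sum>t\<in>T. scale (\<phi> (mon (snd t))) (scale (Poly_Mapping.lookup (coprod x) t) (mon (fst
          t))))
        = lin (\<lambda>t. if fst t \<noteq> 0 \<and> snd t \<noteq> 0 then scale (\<phi> (mon (snd t))) (mon (fst t)) else 0)
            (coprod x)"
        unfolding sumT[symmetric] by (simp add: scale_scale mult.commute)
      show ?thesis
      proof (cases "z = []")
        case True
        have "lin (\<lambda>t. if fst t \<noteq> 0 \<and> snd t \<noteq> 0 then scale (\<phi> (mon (snd t))) (mon (fst t)) else 0)
            (coprod x) = lin (\<lambda>t. 0) (coprod x)"
          by (rule arg_cong[where f = "\<lambda>h. lin h (coprod x)"]) (auto simp: fun_eq_iff \<phi> True cm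
        scale_0)
        then show ?thesis unfolding * by (simp add: lin_def serre_ideal_simps)
      next
        case False
        then obtain i z' where z: "z = i # z'" by (cases z) auto
        \<comment> \<open>This removes the terms with empty right factor. Those with empty left
          factor add up to \<open>\<phi> x\<close> times 1, which is zero because x is in the
          radical. So the inner terms alone give \<open>rderivs z x\<close>.\<close>
        have 1: "\<phi> 1 = 0" by (simp add: \<phi> z is_linD[OF is_lin_rderivs] counit_simps)
        define L where "L v = scale (\<phi> v) (1 :: ('i, 'k) free)" for v
        have L: "is_lin L"
          using is_functional_counit_rderivs[of z] by (simp add: is_lin_def is_functional_def
        L_def \<phi> scale_simps)
        have "rderivs z x = lin (\<lambda>t. scale (\<phi> (mon (snd t))) (mon (fst t))) (coprod x)"
          using cutr_rderivs[of z x] by (simp add: cutr_def \<phi> case_prod_unfold)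
        also have "\<dots> = lin (\<lambda>t. (if fst t \<noteq> 0 \<and> snd t \<noteq> 0 then scale (\<phi> (mon (snd t))) (mon (fst
            t)) else 0)
            + L (scale (counit (mon (fst t))) (mon (snd t)))) (coprod x)"
          by (rule arg_cong[where f = "\<lambda>h. lin h (coprod x)"])
             (auto simp: fun_eq_iff cm scale_0 L_def 1 m0 is_linD[OF L, unfolded L_def])
        also have "\<dots> = lin (\<lambda>t. if fst t \<noteq> 0 \<and> snd t \<noteq> 0 then scale (\<phi> (mon (snd t))) (mon (fst
            t)) else 0) (coprod x)
            + L (cutl counit x)"
          by (simp add: lin_plus lin_of_is_lin[OF L] cutl_def case_prod_unfold)
        also have "L (cutl counit x) = 0" by (simp add: L_def \<phi> x0 scale_0)
        finally have eq: "lin (\<lambda>t. if fst t \<noteq> 0 \<and> snd t \<noteq> 0 then scale (\<phi> (mon (snd t))) (mon (fst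
            t)) else 0) (coprod x) = rderivs z x"
          by simp
        have "rderivs w x \<in> radical" for w using x(1) by (induction w arbitrary: x) (simp_all add:
            radical_rderiv)
        moreover have "supp (\<lambda>w. length w < n) (rderivs z x)"
          using x(2) False by (intro supp_length_rderivs) (auto simp: supp_def)
        ultimately show ?thesis unfolding * eq by (rule IH)
      qed
    qed
    show "is_lin (\<lambda>a. antip a * b)" "is_lin (\<lambda>b. antip a * b)" for a b
      by (simp_all add: is_lin_def antip_simps scale_mult algebra_simps)
    show "antip a * b \<in> serre_ideal" if "a \<in> serre_ideal" for a b
      by (rule serre_ideal.right[OF antip_serre_ideal[OF that]])
    show "antip a * b \<in> serre_ideal" 
      if "b \<in> {v. supp (\<lambda>w. length w < n) v}" "\<And>\<phi>. \<phi> \<in> range (\<lambda>z v. counit (rderivs z v)) \<Longrightarrow> \<phi> b =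
          0" for a b
    proof -
      have "b \<in> radical" using that(2) by (auto simp: radical_rderivs)
      then show ?thesis using IH that(1) by (simp add: serre_ideal.left)
    qed
  qed (simp_all add: T subsp_serre_ideal subsp_supp)
  moreover have "(\<Sum>t\<in>T. (\<lambda>a b. antip a * b) (scale (Poly_Mapping.lookup (coprod x) t) (mon (fst
      t))) (mon (snd t))) 
      = lin (\<lambda>t. if fst t \<noteq> 0 \<and> snd t \<noteq> 0 then antip (mon (fst t)) * mon (snd t) else 0) (coprod
          x)" (is "_ = ?E")
    unfolding sumT[symmetric] by (simp add: antip_simps scale_mult)
  ultimately have E: "?E \<in> serre_ideal" by simp
  \<comment> \<open>An inclusion-exclusion correction: the term with both factors empty occurs in
    both extreme sums. Its total is \<open>counit x\<close>, which is zero.\<close>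
  define L where "L v = scale (counit v) (1 :: ('i, 'k) free)" for v :: "('i, 'k) free"
  have L: "is_lin L"
    by (simp add: is_lin_def L_def scale_simps counit_simps)
  have S1: "antip 1 = 1" using antip_mon[of "[]"] by (simp add: mon_Nil)
  have "0 = lin (\<lambda>t. antip (mon (fst t)) * mon (snd t)) (coprod x)"
    using antipode[of x] by (simp add: case_prod_unfold x00 scale_0)
  also have "\<dots> = lin (\<lambda>t. ((if fst t \<noteq> 0 \<and> snd t \<noteq> 0 then antip (mon (fst t)) * mon (snd t) else 0)
      + antip (scale (counit (mon (snd t))) (mon (fst t)))) + (scale (counit (mon (fst t))) (mon
          (snd t))
      + L (scale (- counit (mon (snd t))) (mon (fst t))))) (coprod x)"
    by (rule arg_cong[where f = "\<lambda>h. lin h (coprod x)"])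
       (auto simp: fun_eq_iff cm scale_simps L_def m0 antip_simps counit_simps S1)
  also have "\<dots> = ?E + antip (cutr counit x) + (cutl counit x + lin (\<lambda>t. L (scale (- counit (mon
      (snd t))) (mon (fst t)))) (coprod x))"
    by (simp add: lin_plus lin_of_is_lin[OF is_lin_antip] cutl_def cutr_def case_prod_unfold)
  also have "lin (\<lambda>t. L (scale (- counit (mon (snd t))) (mon (fst t)))) (coprod x) = - L (cutr
      counit x)"
    by (simp add: scale_uminus is_linD[OF L] lin_of_is_lin[OF L] cutr_def case_prod_unfold)
       (simp add: lin_def scale_uminus sum_negf)
  also have "L (cutr counit x) = 0" by (simp add: L_def x00 scale_0)
  finally have "antip x + x = - ?E" by (simp add: algebra_simps eq_neg_iff_add_eq_0)
  then show ?thesis using E by (simp add: serre_ideal_simps)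
qed

lemma radical_serre_ideal_length: "x \<in> radical \<Longrightarrow> supp (\<lambda>w. length w < n) x \<Longrightarrow> x \<in> serre_ideal"
proof (induction n arbitrary: x)
  case 0
  then have "Poly_Mapping.keys x = {}" by (auto simp: supp_def)
  then show ?case by (simp add: serre_ideal_simps)
next
  case (Suc n)
  have "proj M x \<in> serre_ideal" if M: "M \<in> (mset \<circ> letters) ` Poly_Mapping.keys x" for M
  proof -
    obtain u where "u \<in> Poly_Mapping.keys x" "M = mset (letters u)" using M by auto
    then obtain w where w: "M = mset w" "length w < Suc n"
      using Suc.prems(2) by (metis supp_def)
    define y where "y = proj M x"
    have y: "y \<in> radical" "supp (\<lambda>u. mset u = mset w) y"
      using radical_proj[OF Suc.prems(1)] supp_proj[OF Suc.prems(2), of M]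
      by (auto simp: y_def w supp_def)
    have ylen: "supp (\<lambda>u. length u = length w) y"
      by (rule supp_mono[OF y(2)]) (rule mset_eq_length)
    have ylt: "supp (\<lambda>u. length u < Suc n) y"
      by (rule supp_mono[OF ylen]) (use w in simp)
    show ?thesis
    proof (cases "length w = n \<and> w \<noteq> []")
      case False
      show ?thesis
      proof (cases "w = []")
        case True
        have k: "Poly_Mapping.keys y \<subseteq> {0}"
        proof
          fix u assume "u \<in> Poly_Mapping.keys y"
          then have "letters u = []" using y(2) True by (auto simp: supp_def)
          then show "u \<in> {0}" by (cases u) (simp add: zero_word_def)
        qed
        \<comment> \<open>In degree zero y is a multiple of 1, and the counit reads off the
          factor.\<close>
        have "counit (lderivs [] y) = 0" using y(1) unfolding radical_def by blast
        with k have "y = 0" by (auto simp: counit_def in_keys_iff intro!: poly_mapping_eqI)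
        then show ?thesis by (simp add: y_def serre_ideal_simps)
      next
        case n: False
        have "y \<in> serre_ideal"
          by (rule Suc.IH[OF y(1)], rule supp_mono[OF ylen]) (use w n False in auto)
        then show ?thesis by (simp add: y_def)
      qed
    next
      case True
      define c where "c = (-1) ^ length w * half_twist w"
      have "antip y + y \<in> serre_ideal"
        by (rule primitive_antip[of "length w"]) (use Suc.IH y ylen True in auto)
      then have 1: "scale c (reversal y) + y \<in> serre_ideal" using antip_supp[OF y(2)] by (simp
          add: c_def)
      \<comment> \<open>The congruence of y with \<open>- scale c (reversal y)\<close> is applied
        twice; reversal is an involution preserving the Serre ideal, so the multiple of y by 1 - c *
        c lies in the ideal.\<close>
      have "scale c (reversal (scale c (reversal y) + y)) \<in> serre_ideal" by (intro
          serre_ideal_simps reversal_serre_ideal 1)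
      then have "scale c (reversal y) + y - scale c (reversal (scale c (reversal y) + y)) \<in>
          serre_ideal"
        using 1 by (rule_tac serre_ideal_simps)
      moreover have "scale c (reversal y) + y - scale c (reversal (scale c (reversal y) + y)) =
          scale (1 - c * c) y"
        by (simp add: reversal_simps scale_simps)
      moreover have "c * c = half_twist w * half_twist w"
        by (simp add: c_def power_mult_distrib[symmetric] power_add[symmetric] mult_ac flip: mult_2)
      ultimately have 2: "scale (1 - half_twist w * half_twist w) y \<in> serre_ideal" by simp
      have "y \<in> serre_ideal"
      proof (cases "half_twist w * half_twist w = 1")
        case False
        have "scale (inverse (1 - half_twist w * half_twist w)) (scale (1 - half_twist w *
            half_twist w) y) \<in> serre_ideal"
          by (rule serre_ideal_simps(3)[OF 2])
        then show ?thesis using False by (simp add: scale_scale)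
      next
        case t: True
        then obtain i where i: "(\<Sum>j\<leftarrow>w. A i j) > 0" using \<chi>_twist True by blast
        have "lderiv i y \<in> serre_ideal" "rderiv i y \<in> serre_ideal"
          using y(1) ylt by (auto intro!: Suc.IH radical_lderiv radical_rderiv supp_length_lderiv
        supp_length_rderiv)
        then show ?thesis by (rule singular_serre_ideal[OF y(2) _ _ i])
      qed
      then show ?thesis by (simp add: y_def)
    qed
  qed
  then have "(\<Sum>M\<in>(mset \<circ> letters) ` Poly_Mapping.keys x. proj M x) \<in> serre_ideal"
    by (rule serre_ideal_simps)
  then show ?case unfolding sum_proj[symmetric] .
qed

theorem radical_eq_serre_ideal: "radical = serre_ideal"
proof
  show "radical \<subseteq> serre_ideal"
  proof
    fix x assume x: "x \<in> radical"
    have "supp (\<lambda>w. length w < Suc (Max ((length \<circ> letters) ` Poly_Mapping.keys x))) x"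
      by (auto simp: supp_def less_Suc_eq_le)
    with x show "x \<in> serre_ideal" by (rule radical_serre_ideal_length)
  qed
qed (rule serre_ideal_radical)

end

section \<open>Expansion of the Serre elements\<close>

context cartan_braiding
begin

text \<open>Up to the sign (-1)^k, the k-th elementary symmetric polynomial in the parameters
  \<open>\<chi> i j * \<chi> i i ^ m\<close>, m < n.\<close>

fun serre_coeff :: "'i \<Rightarrow> 'i \<Rightarrow> nat \<Rightarrow> nat \<Rightarrow> 'k" where
  "serre_coeff i j 0 k = (if k = 0 then 1 else 0)"
| "serre_coeff i j (Suc n) 0 = serre_coeff i j n 0"
| "serre_coeff i j (Suc n) (Suc k) = serre_coeff i j n (Suc k) - \<chi> i j * \<chi> i i ^ n * serre_coeff i
    j n k"

lemma serre_coeff_0: "n < k \<Longrightarrow> serre_coeff i j n k = 0"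
  by (induction i j n k rule: serre_coeff.induct) simp_all

lemma ad_pow_serre_coeff:
  "(ad i ^^ n) (\<theta> j) = (\<Sum>k\<le>n. scale (serre_coeff i j n k) (\<theta> i ^ (n - k) * \<theta> j * \<theta> i ^ k))"
proof (induction n)
  case (Suc n)
  define T :: "nat \<Rightarrow> ('i, 'k) free" where "T k = \<theta> i ^ (Suc n - k) * \<theta> j * \<theta> i ^ k" for k
  let ?z = "(ad i ^^ n) (\<theta> j)"
  let ?t = "\<chi> i j * \<chi> i i ^ n"
  have 1: "\<theta> i * ?z = (\<Sum>k\<le>n. scale (serre_coeff i j n k) (T k))"
    unfolding Suc sum_distrib_left T_def
    by (intro sum.cong refl) (simp add: Suc_diff_le scale_mult mult.assoc)
  have "scale ?t (?z * \<theta> i) = (\<Sum>k\<le>n. scale (?t * serre_coeff i j n k) (T (Suc k)))"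
    unfolding Suc sum_distrib_right T_def scale_sum
    by (intro sum.cong refl) (simp add: scale_mult mult.assoc scale_scale power_commutes)
  moreover have "K i ?z * \<theta> i = scale ?t (?z * \<theta> i)"
    by (simp add: K_ad_pow ad_pow_simps scale_mult scale_scale mult.commute)
  ultimately have "(ad i ^^ Suc n) (\<theta> j)
      = (\<Sum>k\<le>n. scale (serre_coeff i j n k) (T k)) - (\<Sum>k\<le>n. scale (?t * serre_coeff i j n k) (T
          (Suc k)))"
    using 1 by (simp add: ad_def)
  also have "(\<Sum>k\<le>n. scale (serre_coeff i j n k) (T k)) = (\<Sum>k\<le>Suc n. scale (serre_coeff i j n k) (T
      k))"
    by (simp add: serre_coeff_0 scale_0)
  also have "\<dots> = scale (serre_coeff i j n 0) (T 0) + (\<Sum>k\<le>n. scale (serre_coeff i j n (Suc k)) (T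
      (Suc k)))"
    by (rule sum.atMost_Suc_shift)
  also have "\<dots> - (\<Sum>k\<le>n. scale (?t * serre_coeff i j n k) (T (Suc k)))
      = scale (serre_coeff i j n 0) (T 0) + (\<Sum>k\<le>n. scale (serre_coeff i j (Suc n) (Suc k)) (T (Suc
          k)))"
    by (simp add: scale_diff_left sum_subtractf)
  also have "\<dots> = (\<Sum>k\<le>Suc n. scale (serre_coeff i j (Suc n) k) (T k))"
    by (subst sum.atMost_Suc_shift) simp
  finally show ?case by (simp only: T_def)
qed simp

definition qfact :: "'i \<Rightarrow> nat \<Rightarrow> 'k" where
  "qfact i n = (\<Prod>m=1..n. qnum i m)"

lemma qfact_simps: "qfact i 0 = 1" "qfact i (Suc n) = qfact i n * qnum i (Suc n)"
  by (simp_all add: qfact_def)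

lemma qnum_add: "qnum i (m + n) = qnum i m + \<chi> i i ^ m * qnum i n"
  using \<chi>_ne_1[of i] by (simp add: qnum_def power_add field_simps)

text \<open>The q-binomial theorem with denominators cleared; the sum over \<open>{..<k}\<close> is
  k(k-1)/2 written without division.\<close>

lemma serre_coeff_closed:
  "k \<le> n \<Longrightarrow> serre_coeff i j n k * (qfact i k * qfact i (n - k)) =
     (-1) ^ k * \<chi> i j ^ k * \<chi> i i ^ (\<Sum>{..<k}) * qfact i n"
proof (induction n arbitrary: k)
  case 0
  then show ?case by (simp add: qfact_simps)
next
  case (Suc n)
  show ?case
  proof (cases k)
    case 0
    have "serre_coeff i j n 0 = 1" for n by (induction n) simp_all
    then show ?thesis by (simp add: 0 qfact_simps)
  next
    case (Suc l)
    let ?s = "(-1) ^ l * \<chi> i j ^ l * \<chi> i i ^ (\<Sum>{..<l})"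
    have l: "serre_coeff i j n l * (qfact i l * qfact i (n - l)) = ?s * qfact i n"
      using Suc.IH[of l] Suc.prems Suc by simp
    show ?thesis
    \<comment> \<open>For k = n + 1 the first term of the recursion is zero and lies outside the
      range of the induction hypothesis.\<close>
    proof (cases "l = n")
      case True
      have "serre_coeff i j (Suc n) (Suc n) * (qfact i (Suc n) * qfact i (Suc n - Suc n))
          = - (\<chi> i j * \<chi> i i ^ n * qnum i (Suc n) * (serre_coeff i j n n * (qfact i n * qfact i (n
        - n))))"
        by (simp add: serre_coeff_0 qfact_simps mult_ac)
      also have "\<dots> = - (\<chi> i j * \<chi> i i ^ n * qnum i (Suc n) * (?s * qfact i n))"
        using l True by simp
      finally show ?thesis by (simp add: Suc True qfact_simps power_add mult_ac)
    next
      case False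
      then obtain m where m: "n = l + Suc m" using Suc.prems Suc 
        by (metis add_Suc_right less_imp_Suc_add linorder_not_less nat_less_le not_less_eq_eq)
      have k: "serre_coeff i j n (Suc l) * (qfact i (Suc l) * qfact i m) = - ?s * \<chi> i j * \<chi> i i ^
          l * qfact i n"
        using Suc.IH[of "Suc l"] m by (simp add: power_add mult_ac)
      have "serre_coeff i j (Suc n) k * (qfact i k * qfact i (Suc n - k))
         = (serre_coeff i j n (Suc l) * (qfact i (Suc l) * qfact i m)) * qnum i (Suc m)
           - \<chi> i j * \<chi> i i ^ n * (serre_coeff i j n l * (qfact i l * qfact i (n - l))) * qnum i
        (Suc l)"
        by (simp add: Suc m qfact_simps algebra_simps)
      also have "\<dots> = - ?s * \<chi> i j * \<chi> i i ^ l * qfact i n * (qnum i (Suc m) + \<chi> i i ^ Suc m * qnum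
          i (Suc l))"
        unfolding l k by (simp add: m power_add algebra_simps)
      also have "qnum i (Suc m) + \<chi> i i ^ Suc m * qnum i (Suc l) = qnum i (Suc n)"
        using qnum_add[of i "Suc m" "Suc l"] by (simp add: m add.commute)
      finally show ?thesis
        by (simp add: Suc qfact_simps power_add mult_ac)
    qed
  qed
qed

lemma qfact_nz: "qfact i n \<noteq> 0"
  by (simp add: qfact_def qnum_nz)

text \<open>With \<open>e\<close> the sign and \<open>Q\<close> standing for \<open>q\<^sub>i\<close>, all powers of \<open>Q\<close> cancel in the rescaled
  coefficients.\<close>

lemma serre_coeff_rescale:
  fixes e \<delta> Q :: 'k and g :: "nat \<Rightarrow> 'k"
  assumes Q: "Q \<noteq> 0" and e: "e * e = 1" "e ^ (k * (Suc N - k)) = 1"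
    and b: "\<chi> i i = e * inverse Q ^ 2" and x: "\<chi> i j = \<delta> * Q ^ N" and k: "k \<le> Suc N"
    and g: "\<And>n. g n = (e ^ n * Q ^ n - inverse Q ^ n) / (e * Q - inverse Q)"
  defines "G \<equiv> \<lambda>n. \<Prod>m=1..n. g m"
  shows "serre_coeff i j (Suc N) k = G (Suc N) * ((-1) ^ k * (\<delta> ^ k * e ^ (\<Sum>{..<k})) * inverse (G
      (Suc N - k)) * inverse (G k))"
proof -
  have e0: "e \<noteq> 0" using e(1) by auto
  have "g (Suc n) = (e * Q) ^ n * qnum i (Suc n)" for n
  proof -
    have "e ^ m * Q ^ m * (1 - \<chi> i i ^ m) = e ^ m * Q ^ m - inverse Q ^ m" for m
    proof -
      have "e ^ m * e ^ m = 1" by (simp add: e(1) flip: power_mult_distrib)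
      moreover have "Q ^ m * inverse Q ^ m = 1" using Q by (simp flip: power_mult_distrib)
      moreover have "e ^ m * Q ^ m * (1 - \<chi> i i ^ m)
          = e ^ m * Q ^ m - (e ^ m * e ^ m) * (Q ^ m * inverse Q ^ m) * inverse Q ^ m"
        unfolding b by (simp only: power_mult_distrib power2_eq_square right_diff_distrib
            mult_1_left mult_1_right mult_ac)
      ultimately show ?thesis by simp
    qed
    from this[of "Suc n"] this[of 1]
    have "g (Suc n) = (e ^ Suc n * Q ^ Suc n * (1 - \<chi> i i ^ Suc n)) / (e * Q * (1 - \<chi> i i))"
      by (simp add: g)
    then show ?thesis using e0 Q by (simp add: qnum_def power_mult_distrib)
  qed
  then have GF: "G n = (e * Q) ^ (\<Sum>{..<n}) * qfact i n" for n
    by (induction n) (simp_all add: G_def qfact_simps power_add mult_ac)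
  have tri: "\<Sum>{..<m + n} = \<Sum>{..<m} + \<Sum>{..<n} + m * n" for m n :: nat
    by (induction n) (simp_all add: algebra_simps)
  have tri2: "2 * \<Sum>{..<m} + m = m * m" for m :: nat
    by (induction m) (simp_all add: algebra_simps)
  obtain l where l: "Suc N = k + l" using k by (metis le_add_diff_inverse)
  \<comment> \<open>With N + 1 = k + l the exponent Nk - k(k-1) equals kl. By \<open>tri\<close>
    this is also the excess of the triangular number of k + l over those of k and l, so it is
    absorbed when \<open>qfact\<close> is replaced by \<open>G\<close>.\<close>
  have Q1: "Q ^ (N * k) * inverse Q ^ (2 * \<Sum>{..<k}) = Q ^ (k * l)"
  proof -
    have "N * k + k = k * l + (2 * \<Sum>{..<k} + k)"
      unfolding tri2 using arg_cong[OF l, of "\<lambda>n. n * k"] by (simp add: algebra_simps)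
    then have "N * k = k * l + 2 * \<Sum>{..<k}" by simp
    then show ?thesis using Q by (simp add: power_add power_inverse)
  qed
  have "\<chi> i j ^ k * \<chi> i i ^ (\<Sum>{..<k}) = \<delta> ^ k * e ^ (\<Sum>{..<k}) * (Q ^ (N * k) * inverse Q ^ (2 *
      \<Sum>{..<k}))"
    unfolding b x by (simp add: power_mult_distrib power_mult mult_ac)
  also have "\<dots> = \<delta> ^ k * e ^ (\<Sum>{..<k}) * (e * Q) ^ (k * l)"
    unfolding Q1 using e(2) l by (simp add: power_mult_distrib)
  finally have c: "\<chi> i j ^ k * \<chi> i i ^ (\<Sum>{..<k}) = \<delta> ^ k * e ^ (\<Sum>{..<k}) * (e * Q) ^ (k * l)" .
  have Gnz: "G n \<noteq> 0" for n using GF e0 Q by (simp add: qfact_nz)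
  have "serre_coeff i j (Suc N) k * (G k * G l) = serre_coeff i j (Suc N) k * (qfact i k * qfact i
      l) * (e * Q) ^ (\<Sum>{..<k} + \<Sum>{..<l})"
    by (simp add: GF power_add mult_ac)
  also have "serre_coeff i j (Suc N) k * (qfact i k * qfact i l) = (-1) ^ k * (\<chi> i j ^ k * \<chi> i i ^
      (\<Sum>{..<k})) * qfact i (Suc N)"
    using serre_coeff_closed[OF k, of i j] l by simp
  also have "\<dots> * (e * Q) ^ (\<Sum>{..<k} + \<Sum>{..<l}) = (-1) ^ k * (\<delta> ^ k * e ^ (\<Sum>{..<k})) * G (Suc N)"
    unfolding c GF l tri by (simp add: power_add mult_ac)
  finally show ?thesis using Gnz l by (simp add: field_simps)
qed

end

section \<open>The bilinear form\<close>

definition lin_functional :: "('b \<Rightarrow> 'k::comm_ring_1) \<Rightarrow> ('b \<Rightarrow>\<^sub>0 'k) \<Rightarrow> 'k" where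
  "lin_functional f x = (\<Sum>b\<in>Poly_Mapping.keys x. Poly_Mapping.lookup x b * f b)"

lemma lin_functional_single [simp]: "lin_functional f (Poly_Mapping.single b c) = c * f b"
  by (simp add: lin_functional_def)

lemma is_functional_lin_functional: "is_functional (lin_functional f)"
proof -
  have add: "lin_functional f (x + y) = lin_functional f x + lin_functional f y" for x y
    unfolding lin_functional_def by (rule setsum_keys_plus_distrib) (simp_all add: distrib_right)
  have "lin_functional f (scale c x) = c * lin_functional f x" for c x
    by (induction x rule: single_add_induct)
       (simp_all add: add scale_add scale_single algebra_simps)
  with add show ?thesis by (simp add: is_functional_def)
qed

context braiding
begin

text \<open>Existence of the form by an explicit formula: multiplication by
  \<open>\<theta> i\<close> is made adjoint to \<open>d i\<close> times
  \<open>lderiv i\<close>.\<close>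

definition biform :: "('i \<Rightarrow> 'k) \<Rightarrow> ('i, 'k) free \<Rightarrow> ('i, 'k) free \<Rightarrow> 'k" where
  "biform d x y = lin_functional (\<lambda>w. prod_list (map d (letters w)) * counit (lderivs (letters w)
      y)) x"

lemma is_functional_bf1: "is_functional (\<lambda>x. biform d x y)"
  unfolding biform_def by (rule is_functional_lin_functional)

lemma is_functional_bf2: "is_functional (biform d x)"
  by (simp add: is_functional_def biform_def lin_functional_def is_linD[OF is_lin_lderivs]
      counit_simps algebra_simps
      sum.distrib sum_distrib_left)

lemmas biform_simps = is_functionalD[OF is_functional_bf1] is_functionalD[OF is_functional_bf2]

lemma biform_mon: "biform d (mon (Word w)) y = prod_list (map d w) * counit (lderivs w y)"
  unfolding biform_def by (subst mon_def) simp

lemma functional_mon_ext: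
  assumes "is_functional f" "is_functional g" "\<And>w. f (mon (Word w)) = g (mon (Word w))"
  shows "f x = g x"
proof (rule functional_ext[OF assms(1,2)])
  show "f (Poly_Mapping.single b 1) = g (Poly_Mapping.single b 1)" for b
    using assms(3)[of "letters b"] by (simp add: mon_def)
qed

lemma biform_theta1: "biform d (\<theta> i * x) y = d i * biform d x (lderiv i y)"
proof (rule functional_mon_ext[of "\<lambda>x. biform d (\<theta> i * x) y"])
  show "is_functional (\<lambda>x. biform d (\<theta> i * x) y)"
    by (rule is_functional_compose[OF is_functional_bf1 is_lin_theta])
  show "is_functional (\<lambda>x. d i * biform d x (lderiv i y))"
    using is_functional_bf1 by (simp add: is_functional_def algebra_simps)
qed (simp add: theta_mult_mon biform_mon mult.assoc)

lemma biform_1 [simp]: "biform d 1 = counit"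
  using biform_mon[of d "[]"] by (simp add: mon_Nil fun_eq_iff)

text \<open>The same adjunction in the second argument, which relies on the symmetry of
  \<open>\<chi>\<close>; symmetry of the form follows by comparing the two.\<close>

lemma biform_theta2: "biform d x (\<theta> i * y) = d i * biform d (lderiv i x) y"
  by (induction x arbitrary: y rule: free_induct)
     (simp_all add: biform_theta1 lderiv_theta_mult biform_simps lderiv_simps algebra_simps \<chi>_sym)

lemma biform_sym: "biform d x y = biform d y x"
proof (induction x arbitrary: y rule: free_induct)
  case one
  show ?case by (induction y rule: free_induct) (simp_all add: biform_simps counit_simps
      biform_theta1)
qed (simp_all add: biform_simps biform_theta1 biform_theta2)

lemma biform_mult: "biform d (x * x') y = biform d x' (cutl (biform d x) y)"
proof (induction x arbitrary: y rule: free_induct)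
  case (theta i x)
  have "cutl (biform d x) (lderiv i y) = cutl (\<lambda>v. biform d x (lderiv i v)) y"
    by (rule cutl_lderiv[OF is_functional_bf2])
  moreover have "biform d (\<theta> i * x) = (\<lambda>v. d i * biform d x (lderiv i v))"
    by (simp add: fun_eq_iff biform_theta1)
  ultimately show ?case
    by (simp add: mult.assoc biform_theta1 theta cutl_fun biform_simps)
next
  case (add x z)
  have "biform d (x + z) = (\<lambda>v. biform d x v + biform d z v)" by (simp add: fun_eq_iff biform_simps)
  with add show ?case by (simp add: distrib_right biform_simps cutl_fun)
next
  case (scale c x)
  have "biform d (scale c x) = (\<lambda>v. c * biform d x v)" by (simp add: fun_eq_iff biform_simps)
  with scale show ?case by (simp add: scale_mult biform_simps cutl_fun)
qed simp

text \<open>Each d_i is a unit, hence so is the factor attached to any word, and it can be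
  cancelled. Explicit inverses are used because the coefficients need not form a field.\<close>

lemma biform_rad:
  assumes "\<And>i. d i * d' i = 1"
  shows "{x. \<forall>y. biform d x y = 0} = radical"
proof -
  have u: "\<exists>c. prod_list (map d w) * c = 1" for w
  proof (induction w)
    case (Cons i w)
    then obtain c where c: "prod_list (map d w) * c = 1" by blast
    have "prod_list (map d (i # w)) * (d' i * c) = (d i * d' i) * (prod_list (map d w) * c)"
      by (simp add: mult_ac)
    with c assms show ?case by (intro exI[of _ "d' i * c"]) simp
  qed simp
  have "(\<forall>y. biform d y x = 0) \<longleftrightarrow> x \<in> radical" for x
  proof
    assume biform: "\<forall>y. biform d y x = 0"
    show "x \<in> radical" unfolding radical_def
    proof safe
      fix w
      obtain c where "prod_list (map d w) * c = 1" using u by blast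
      moreover have "prod_list (map d w) * counit (lderivs w x) = 0"
        using biform by (simp flip: biform_mon)
      ultimately show "counit (lderivs w x) = 0"
        by (metis mult.commute mult.left_commute mult_zero_right mult_1_right)
    qed
  qed (auto simp: biform_def lin_functional_def radical_def)
  then show ?thesis by (simp add: biform_sym)
qed

end

section \<open>Comparison with the form that defines the covering algebra\<close>

context cartan_data
begin

lemma tensor_single:
  "tensor (Poly_Mapping.single u c) (Poly_Mapping.single v d) = Poly_Mapping.single (u, v) (c * d)"
  by (simp add: tensor_def)

lemma tform_add:
  "tform B (X + X') Z = tform B X Z + tform B X' Z"
  "tform B Z (X + X') = tform B Z X + tform B Z X'"
proof -
  show "tform B (X + X') Z = tform B X Z + tform B X' Z"
    unfolding tform_def by (rule setsum_keys_plus_distrib [where f = "\<lambda>a c. \<Sum>b\<in>Poly_Mapping.keys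
        Z. c * Poly_Mapping.lookup Z b *
        (B (mon (fst a)) (mon (fst b)) * B (mon (snd a)) (mon (snd b)))"])
      (simp_all add: algebra_simps sum.distrib)
  show "tform B Z (X + X') = tform B Z X + tform B Z X'"
    unfolding tform_def sum.distrib[symmetric]
    by (intro sum.cong refl setsum_keys_plus_distrib) (simp_all add: algebra_simps)
qed

lemma tform_single:
  "tform B (Poly_Mapping.single a c) (Poly_Mapping.single b d)
     = c * d * (B (mon (fst a)) (mon (fst b)) * B (mon (snd a)) (mon (snd b)))"
  by (simp add: tform_def)

lemma tform_scale: "tform B (scale c X) Z = c * tform B X Z" "tform B Z (scale c X) = c * tform B
    Z X"
proof -
  have 1: "tform B (scale c (Poly_Mapping.single a e)) Z = c * tform B (Poly_Mapping.single a e) Z"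
    and 2: "tform B Z (scale c (Poly_Mapping.single a e)) = c * tform B Z (Poly_Mapping.single a e)"
    for a e Z
    by (induction Z rule: single_add_induct)
       (simp_all add: tform_add tform_single scale_single algebra_simps)
  show "tform B (scale c X) Z = c * tform B X Z" "tform B Z (scale c X) = c * tform B Z X"
    by (induction X rule: single_add_induct) (simp_all only: scale_add tform_add 1 2 distrib_left)
qed

lemma tform_sym: "(\<And>x y. B x y = B y x) \<Longrightarrow> tform B X Y = tform B Y X"
  unfolding tform_def by (subst sum.swap) (intro sum.cong refl, simp add: mult_ac)

lemma is_functional_tform: "is_functional (\<lambda>X. tform B X Z)" "is_functional (tform B X)"
  by (simp_all add: is_functional_def tform_add tform_scale)

definition bilinear :: "(('i, Qq pi_ext) free \<Rightarrow> ('i, Qq pi_ext) free \<Rightarrow> Qq pi_ext) \<Rightarrow> bool" where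
  "bilinear B \<longleftrightarrow> (\<forall>x. is_functional (B x)) \<and> (\<forall>y. is_functional (\<lambda>x. B x y))"

lemma bilinear_single:
  assumes "bilinear B" 
  shows "B (Poly_Mapping.single u c) y = c * B (mon u) y" "B y (Poly_Mapping.single u c) = c * B y
      (mon u)"
proof -
  have 1: "is_functional (B x)" "is_functional (\<lambda>x. B x y)" for x y using assms by (auto simp:
      bilinear_def)
  show "B (Poly_Mapping.single u c) y = c * B (mon u) y" "B y (Poly_Mapping.single u c) = c * B y
      (mon u)"
    by (subst single_scale, simp add: is_functionalD[OF 1(2)] is_functionalD[OF 1(1)] mon_def)+
qed

lemma tform_tensor_single:
  assumes B: "bilinear B"
  shows "tform B (tensor x x') (Poly_Mapping.single b 1) = B x (mon (fst b)) * B x' (mon (snd b))"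
proof (induction x rule: single_add_induct)
  case (single u c)
  have 1: "is_functional (\<lambda>x. B x y)" for y using B by (auto simp: bilinear_def)
  show ?case
    by (induction x' rule: single_add_induct)
       (simp_all add: tensor_single tform_single tensor_add tform_add distrib_left
          bilinear_single[OF B] is_functionalD[OF 1] mult_ac)
next
  case (add x y)
  have 1: "is_functional (\<lambda>x. B x y)" for y using B by (auto simp: bilinear_def)
  from add show ?case by (simp add: tensor_add tform_add is_functionalD[OF 1] distrib_right)
qed

text \<open>Pairing with a pure tensor is a slice followed by B; this turns the axioms of the form
  into statements about \<open>cutl\<close>.\<close>

lemma tform_tensor:
  assumes B: "bilinear B"
  shows "tform B (tensor x x') Z = B x' (lin (\<lambda>(u, v). scale (B x (mon u)) (mon v)) Z)"
proof (rule functional_ext[of "tform B (tensor x x')"])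
  have 1: "is_functional (B x)" for x using B by (auto simp: bilinear_def)
  show "is_functional (\<lambda>Z. B x' (lin (\<lambda>(u, v). scale (B x (mon u)) (mon v)) Z))"
    by (rule is_functional_compose[OF 1 is_lin_lin])
  show "tform B (tensor x x') (Poly_Mapping.single b 1)
      = B x' (lin (\<lambda>(u, v). scale (B x (mon u)) (mon v)) (Poly_Mapping.single b 1))" for b
    by (simp add: tform_tensor_single[OF B] case_prod_unfold is_functionalD[OF 1])
qed (rule is_functional_tform)

lemma tform_tensor_tensor:
  assumes B: "bilinear B"
  shows "tform B (tensor x x') (tensor y y') = B x y * B x' y'"
proof (induction y rule: single_add_induct)
  case (single u c)
  have 1: "is_functional (B x)" for x using B by (auto simp: bilinear_def)
  have 2: "tform B (tensor x x') (Poly_Mapping.single b e) = e * (B x (mon (fst b)) * B x' (mon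
      (snd b)))"
    for b e
    by (subst single_scale) (simp add: tform_scale tform_tensor_single[OF B])
  show ?case
  proof (induction y' rule: single_add_induct)
    case (single v e)
    show ?case by (simp add: tensor_single 2 bilinear_single[OF B] mult_ac)
  qed (simp add: tensor_add tform_add distrib_left is_functionalD[OF 1])
next
  case (add y z)
  have 1: "is_functional (B x)" for x using B by (auto simp: bilinear_def)
  from add show ?case by (simp add: tensor_add tform_add distrib_right is_functionalD[OF 1])
qed

definition chi_pi :: "'i \<Rightarrow> 'i \<Rightarrow> Qq pi_ext" where
  "chi_pi i j = cpi ^ (p i * p j) * of_base (qvar powi (- (int (s i) * A i j)))"

lemma pairing_single: "pairing (wt (Word [i])) (wt (Word [j])) = int (s i) * A i j"
proof -
  have "pairing (wt (Word [i])) (wt (Word [j])) 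
    = (\<Sum>k\<in>UNIV. \<Sum>l\<in>UNIV. if l = j then if k = i then int (s i) * A i j else 0 else 0)"
    unfolding pairing_def wt_def by (intro sum.cong refl) auto
  then show ?thesis by simp
qed

lemma tcoeff_left: "tcoeff (a, Word [i]) (u, v) = prod_list (map (chi_pi i) (letters u))"
proof -
  have "tcoeff (a, Word [i]) (Word w, v) = prod_list (map (chi_pi i) w)" for w
  proof (induction w)
    case Nil
    then show ?case by (simp add: tcoeff_def par_def pairing_def wt_def of_base_hom)
  next
    case (Cons j w)
    have "tcoeff (a, Word [i]) (Word [j] + Word w, v) = tcoeff (a, Word [i]) (Word [j], v) *
        tcoeff (a, Word [i]) (Word w, v)"
      by (rule tcoeff_plus)
    moreover have "tcoeff (a, Word [i]) (Word [j], v) = chi_pi i j"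
      by (simp add: tcoeff_def chi_pi_def pairing_single par_def)
    ultimately show ?case by (simp add: Cons plus_word_def)
  qed
  from this[of "letters u"] show ?thesis by simp
qed

end

context super_cartan_datum
begin

sublocale pi_br: braiding chi_pi
proof
  show "chi_pi i j = chi_pi j i" for i j
    using C5_sym[of i j] by (simp add: chi_pi_def mult.commute[of "p i"])
qed

lemma tmult_theta: "tmult (tensor (\<theta> i) 1 + tensor 1 (\<theta> i)) Z = lin (pi_br.coprod_step i) Z"
proof (rule lin_ext[OF _ is_lin_lin])
  show "is_lin (tmult (tensor (\<theta> i) 1 + tensor 1 (\<theta> i)))"
    by (simp add: is_lin_def tmult_add_right tmult_scale)
  show "tmult (tensor (\<theta> i) 1 + tensor 1 (\<theta> i)) (Poly_Mapping.single b 1) =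
      lin (pi_br.coprod_step i) (Poly_Mapping.single b 1)" for b
  proof -
    obtain u v where b: "b = (u, v)" by (cases b)
    have "tcoeff (Word [i], 0) (u, v) = 1"
      by (simp add: tcoeff_def par_def pairing_def wt_def of_base_hom zero_word_def)
    then show ?thesis
      by (simp add: b \<theta>_def one_mon tensor_mon tmult_add_left tmult_single pi_br.coprod_step_def
          tcoeff_left pi_br.chi_prod_def plus_word_def zero_word_def)
  qed
qed

lemma r_word_coprod: "r_word w = pi_br.coprod_word w"
proof (induction w)
  case Nil
  show ?case using tensor_mon[of "Word []" "Word []"] by (simp add: mon_Nil)
qed (simp add: tmult_theta)

lemma r_coprod: "r x = pi_br.coprod x"
  by (simp add: r_def pi_br.coprod_def lin_def r_word_coprod)

lemma tform_r: "bilinear B \<Longrightarrow> tform B (tensor x x') (r y) = B x' (pi_br.cutl (B x) y)"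
  by (simp add: tform_tensor r_coprod pi_br.cutl_def)

lemma is_form_biform:
  assumes "\<And>i. d i * (1 - cpi ^ p i * of_base (q i ^ 2)) = 1"
  shows "is_form (pi_br.biform d)"
proof -
  have bil: "bilinear (pi_br.biform d)"
    by (simp add: bilinear_def pi_br.is_functional_bf1 pi_br.is_functional_bf2)
  have 1: "pi_br.biform d (x * x') y = tform (pi_br.biform d) (tensor x x') (r y)" for x x' y
    by (simp add: tform_r[OF bil] pi_br.biform_mult)
  have 2: "pi_br.biform d y (x * x') = tform (pi_br.biform d) (r y) (tensor x x')" for x x' y
    using 1[of x x' y] by (simp add: pi_br.biform_sym[of d y] tform_sym[of "pi_br.biform d", OF
        pi_br.biform_sym, of "r y"])
  have 3: "pi_br.biform d (\<theta> i) (\<theta> j) = (if i = j then d i else 0)" for i j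
    using pi_br.biform_theta1[of d i 1 "\<theta> j"] by (simp add: counit_simps)
  show ?thesis
    unfolding is_form_def using assms 1 2 by (simp add: pi_br.biform_simps 3)
qed

text \<open>The axioms determine B on 1 and on each \<open>\<theta> i\<close> in the first argument.
  Multiplicativity then forces the adjunction between \<open>\<theta> i\<close> and
  \<open>lderiv i\<close>, which leaves only \<open>biform d\<close>.\<close>

lemma is_form_unique:
  assumes B: "is_form B" and d: "\<And>i. d i * (1 - cpi ^ p i * of_base (q i ^ 2)) = 1"
  shows "B = pi_br.biform d"
proof -
  have bil: "bilinear B" and B11: "B 1 1 = 1"
    and th: "\<And>i. B (\<theta> i) (\<theta> i) * (1 - cpi ^ p i * of_base (q i ^ 2)) = 1" "\<And>i j. i \<noteq> j \<Longrightarrow> B (\<theta> i)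
        (\<theta> j) = 0"
    and m1: "\<And>x y y'. B x (y * y') = tform B (r x) (tensor y y')"
    and m2: "\<And>x x' y. B (x * x') y = tform B (tensor x x') (r y)"
    using B by (auto simp: is_form_def bilinear_def is_functional_def)
  have f1: "is_functional (\<lambda>x. B x y)" and f2: "is_functional (B x)" for x y using bil by (auto
      simp: bilinear_def)
  have thd: "B (\<theta> i) (\<theta> j) = (if i = j then d i else 0)" for i j
  proof -
    have "B (\<theta> i) (\<theta> i) = B (\<theta> i) (\<theta> i) * (d i * (1 - cpi ^ p i * of_base (q i ^ 2)))"
      by (simp add: d)
    also have "\<dots> = d i * (B (\<theta> i) (\<theta> i) * (1 - cpi ^ p i * of_base (q i ^ 2)))"
      by (simp only: mult_ac)
    finally show ?thesis using th by auto
  qed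
  \<comment> \<open>Orthogonality of 1 and \<open>\<theta> i\<close> is not among the axioms; it
    comes from writing 1 as 1 times 1, which doubles the value.\<close>
  have "B 1 (\<theta> i) = B 1 (\<theta> i) + B 1 (\<theta> i)" for i
    using m2[of 1 1 "\<theta> i"] by (simp add: r_hom tform_add tform_tensor_tensor[OF bil] B11)
  then have B1t: "B 1 (\<theta> i) = 0" for i by simp
  have B1: "B 1 = counit"
  proof
    show "B 1 y = counit y" for y
      by (induction y rule: free_induct)
         (simp_all add: B11 is_functionalD[OF f2] counit_simps m1 r_hom(3) tform_tensor_tensor[OF
        bil] B1t)
  qed
  have Bt1: "B (\<theta> i) 1 = 0" for i
    using m1[of "\<theta> i" 1 1] by (simp add: r_hom tform_add tform_tensor_tensor[OF bil] B11)
  have Bt: "B (\<theta> i) = (\<lambda>y. d i * counit (pi_br.lderiv i y))" for i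
  proof
    show "B (\<theta> i) y = d i * counit (pi_br.lderiv i y)" for y
    proof (induction y rule: free_induct)
      case (theta j y)
      show ?case
        by (simp add: m1 r_hom(5) tform_add tform_tensor_tensor[OF bil] thd B1 B1t
            pi_br.lderiv_theta_mult
            counit_simps counit_theta[of _ 1, simplified])
    qed (simp_all add: Bt1 is_functionalD[OF f2] pi_br.lderiv_simps counit_simps algebra_simps)
  qed
  have "B (\<theta> i * x) y = d i * B x (pi_br.lderiv i y)" for i x y
    by (simp add: m2 tform_r[OF bil] Bt pi_br.cutl_fun is_functionalD[OF f2]
        flip: pi_br.cutl_lderiv[OF is_functional_counit])
  then have "B x y = pi_br.biform d x y" for x y
    by (induction x arbitrary: y rule: free_induct)
       (simp_all add: B1 pi_br.biform_theta1 is_functionalD[OF f1] pi_br.biform_simps)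
  then show ?thesis by (simp add: fun_eq_iff)
qed

end

section \<open>Specialization of \<open>\<pi>\<close>\<close>

text \<open>The flag \<open>b\<close> selects \<open>\<pi> = -1\<close>, that is, the super case.\<close>

lift_definition spec :: "bool \<Rightarrow> 'a::comm_ring_1 pi_ext \<Rightarrow> 'a" is "\<lambda>b f. poly f (if b then -1 else 1)"
proof -
  fix b :: bool and f g :: "'a poly"
  assume "[:-1, 0, 1:] dvd f - g"
  then obtain k where "f - g = [:-1, 0, 1:] * k" by (rule dvdE)
  then have "poly (f - g) (if b then -1 else 1) = poly ([:-1, 0, 1:] * k) (if b then -1 else 1)"
      by simp
  then show "poly f (if b then -1 else 1) = poly g (if b then -1 else 1)" by (simp split: if_splits)
qed

abbreviation eps :: "bool \<Rightarrow> 'a::comm_ring_1" where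
  "eps b \<equiv> (if b then -1 else 1)"

lemma spec_hom:
  "spec b 0 = 0" "spec b 1 = 1" "spec b (x + y) = spec b x + spec b y"
  "spec b (x * y) = spec b x * spec b y" "spec b (- x) = - spec b x" "spec b (x - y) = spec b x -
      spec b y"
  by (transfer, simp)+

lemma spec_of_base [simp]: "spec b (of_base c) = c"
  by transfer simp

lemma spec_cpi [simp]: "spec b cpi = eps b"
  by transfer simp

lemma spec_power: "spec b (x ^ n) = spec b x ^ n"
  by (induction n) (simp_all add: spec_hom)

text \<open>A polynomial vanishing at 1 and -1 is divisible by both linear factors, hence by their
  product; 2 \<noteq> 0 is needed to cancel the value of the first factor at -1.\<close>

lemma spec_eq_0:
  fixes x :: "'a::field pi_ext"
  assumes "(2::'a) \<noteq> 0" "\<And>b. spec b x = 0"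
  shows "x = 0"
  using assms(2)
proof (transfer fixing: )
  fix f :: "'a poly"
  assume *: "\<And>b. poly f (if b then - 1 else 1) = 0"
  from *[of False] have "[:-1, 1:] dvd f" by (simp add: poly_eq_0_iff_dvd)
  then obtain g where g: "f = [:-1, 1:] * g" by (rule dvdE)
  from *[of True] assms(1) have "poly g (-1) = 0" by (simp add: g)
  then have "[:1, 1:] dvd g" by (simp add: poly_eq_0_iff_dvd)
  then obtain h where "g = [:1, 1:] * h" by (rule dvdE)
  then have "f = ([:-1, 1:] * [:1, 1:]) * h" by (simp only: g mult.assoc)
  also have "[:-1, 1:] * [:1, 1:] = [:-1, 0, 1 :: 'a:]" by simp
  finally have "f - 0 = [:-1, 0, 1:] * h" by (simp only: diff_zero)
  then show "[:-1, 0, 1:] dvd f - 0" by (simp only: dvd_triv_left)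
qed

definition specialize :: "bool \<Rightarrow> ('b \<Rightarrow>\<^sub>0 'k::comm_ring_1 pi_ext) \<Rightarrow> ('b \<Rightarrow>\<^sub>0 'k)" where
  "specialize b = Poly_Mapping.map (spec b)"

lemma lookup_specialize: "Poly_Mapping.lookup (specialize b x) w = spec b (Poly_Mapping.lookup x w)"
  by (simp add: specialize_def map.rep_eq when_def spec_hom)

lemma specialize_single: "specialize b (Poly_Mapping.single w c) = Poly_Mapping.single w (spec b c)"
  by (rule poly_mapping_eqI) (simp add: lookup_specialize lookup_single when_def spec_hom)

lemma specialize_add: "specialize b (x + y) = specialize b x + specialize b y"
  by (rule poly_mapping_eqI) (simp add: lookup_specialize lookup_add spec_hom)

lemma specialize_diff: "specialize b (x - y) = specialize b x - specialize b y"
  by (rule poly_mapping_eqI) (simp add: lookup_specialize lookup_minus spec_hom)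

lemma specialize_0 [simp]: "specialize b 0 = 0"
  by (rule poly_mapping_eqI) (simp add: lookup_specialize spec_hom)

lemma specialize_scale: "specialize b (scale c x) = scale (spec b c) (specialize b x)"
  by (rule poly_mapping_eqI) (simp add: lookup_specialize lookup_scale spec_hom)

lemma specialize_mult: "specialize b (x * y) = specialize b x * specialize b (y :: ('i,
    'k::comm_ring_1 pi_ext) free)"
proof (induction x rule: single_add_induct)
  case (single u c)
  show ?case
    by (induction y rule: single_add_induct)
       (simp_all add: mult_single specialize_single spec_hom specialize_add distrib_left)
qed (simp add: specialize_add distrib_right)

lemma specialize_1 [simp]: "specialize b (1 :: ('i, 'k::comm_ring_1 pi_ext) free) = 1"
  using specialize_single[of b "0 :: 'i word" "1 :: 'k pi_ext"] by (simp add: spec_hom)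

lemma specialize_theta [simp]: "specialize b (\<theta> i) = \<theta> i"
  by (simp add: \<theta>_def mon_def specialize_single spec_hom)

lemma counit_specialize: "counit (specialize b x) = spec b (counit x)"
  by (simp add: counit_def lookup_specialize)

lemma specialize_surj: "\<exists>y. specialize b y = x"
proof (induction x rule: single_add_induct)
  case (single w c)
  show ?case by (rule exI[of _ "Poly_Mapping.single w (of_base c)"]) (simp add: specialize_single)
qed (metis specialize_add)

lemma two_Qq: "(2::Qq) \<noteq> 0"
proof -
  have "(2::Qq) = Fract 1 1 + Fract 1 1" by (simp flip: One_fract_def)
  also have "\<dots> = Fract 2 1" by simp
  finally have *: "(2::Qq) = Fract 2 1" .
  show ?thesis unfolding * by (simp add: Zero_fract_def eq_fract)
qed

lemma qvar_pow: "qvar ^ n = Fract (monom 1 n) 1"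
  by (induction n) (simp_all add: qvar_def One_fract_def monom_0 monom_Suc one_pCons)

lemma qvar_pow_1: "n > 0 \<Longrightarrow> qvar ^ n \<noteq> 1"
proof
  assume "n > 0" "qvar ^ n = 1"
  then have "monom (1::rat) n = 1"
    by (simp add: qvar_pow One_fract_def eq_fract)
  then have "degree (monom (1::rat) n) = 0" by simp
  with \<open>n > 0\<close> show False by (simp add: degree_monom_eq)
qed

lemma qvar_powi_1: "qvar powi m = 1 \<Longrightarrow> m = 0"
  using qvar_pow_1[of "nat m"] qvar_pow_1[of "nat (- m)"]
  by (cases m "0::int" rule: linorder_cases) (auto simp: power_int_def power_inverse)

context super_cartan_datum
begin

definition chi :: "bool \<Rightarrow> 'i \<Rightarrow> 'i \<Rightarrow> Qq" where
  "chi b i j = eps b ^ (p i * p j) * qvar powi (- (int (s i) * A i j))"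

lemma spec_chi: "spec b (chi_pi i j) = chi b i j"
  by (simp add: chi_pi_def chi_def spec_hom spec_power)

lemma chi_sq: "chi b i j * chi b i j = qvar powi (- 2 * (int (s i) * A i j))"
proof -
  have "chi b i j * chi b i j = (eps b ^ (p i * p j) * eps b ^ (p i * p j)) *
      (qvar powi (- (int (s i) * A i j)) * qvar powi (- (int (s i) * A i j)))"
    by (simp only: chi_def mult_ac)
  also have "eps b ^ (p i * p j) * eps b ^ (p i * p j) = (1 :: Qq)"
    by (simp flip: power_mult_distrib)
  finally show ?thesis by (simp add: qvar_nonzero mult_ac flip: power_int_add)
qed

lemma braiding_chi: "braiding (chi b)"
proof
  show "chi b i j = chi b j i" for i j
    using C5_sym[of i j] by (simp add: chi_def mult.commute[of "p i"])
qed

text \<open>This is (nu,nu) for the weight nu of the word.\<close>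

definition energy :: "'i list \<Rightarrow> int" where
  "energy w = (\<Sum>i\<leftarrow>w. \<Sum>j\<leftarrow>w. int (s i) * A i j)"

lemma energy_Cons: "energy (i # w) = 2 * (\<Sum>j\<leftarrow>w. int (s i) * A i j) + 2 * int (s i) + energy w"
proof -
  have "(\<Sum>j\<leftarrow>w. int (s j) * A j i) = (\<Sum>j\<leftarrow>w. int (s i) * A i j)"
    by (intro arg_cong[where f = sum_list] map_cong refl) (simp only: C5_sym)
  then show ?thesis by (simp add: energy_def C1 sum_list_addf)
qed

text \<open>In (nu,nu) each pair of positions counts twice and the diagonal contributes the sum of 2
  s_i, which is 2(rho,nu). So the exponent is 2(rho,nu) - (nu,nu); squaring has removed the
  signs.\<close>

lemma half_twist_chi: "braiding.half_twist (chi b) w * braiding.half_twist (chi b) w = qvar powi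
    ((\<Sum>i\<leftarrow>w. 2 * int (s i)) - energy w)"
proof -
  interpret braiding "chi b" by (rule braiding_chi)
  have chi_prod: "chi_prod i w * chi_prod i w = qvar powi (- 2 * (\<Sum>j\<leftarrow>w. int (s i) * A i j))" for i w
  proof (induction w)
    case (Cons j w)
    have "chi_prod i (j # w) * chi_prod i (j # w) = (chi b i j * chi b i j) * (chi_prod i w *
        chi_prod i w)" by (simp add: mult_ac)
    then show ?case unfolding Cons chi_sq by (simp add: qvar_nonzero algebra_simps flip:
        power_int_add)
  qed simp
  show ?thesis
  proof (induction w)
    case Nil
    then show ?case by (simp add: energy_def)
  next
    case (Cons i w)
    have "half_twist (i # w) * half_twist (i # w) = (chi_prod i w * chi_prod i w) * (half_twist w
        * half_twist w)" by (simp add: mult_ac)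
    then show ?case unfolding Cons chi_prod energy_Cons
      by (simp add: qvar_nonzero algebra_simps flip: power_int_add)
  qed
qed

lemma cartan_chi: "cartan_braiding (chi b) A"
proof (intro cartan_braiding.intro braiding_chi cartan_braiding_axioms.intro)
  show "A i i = 2" "i \<noteq> j \<Longrightarrow> A i j \<le> 0" for i j by (fact C1, fact C2)
  show "chi b i j \<noteq> 0" for i j by (simp add: chi_def qvar_nonzero)
  show "chi b i j * chi b i j = chi b i i powi A i j" for i j
  proof -
    \<comment> \<open>Here (C4) enters: for odd i the entry a_ij is even, so the sign of
      \<open>chi b i i\<close> disappears in this power.\<close>
    have "(eps b ^ (p i * p i) :: Qq) powi A i j = 1"
      using C4[of i j] by (auto simp: p_def)
    then have "chi b i i powi A i j = qvar powi (- 2 * (int (s i) * A i j))"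
      by (simp add: chi_def C1 power_int_mult_distrib mult_ac flip: power_int_mult)
    then show ?thesis by (simp add: chi_sq)
  qed
  show "chi b i i ^ n \<noteq> 1" if "n > 0" for i n
  proof
    assume "chi b i i ^ n = 1"
    then have "(chi b i i * chi b i i) ^ n = 1" by (simp add: power_mult_distrib)
    then have "qvar powi (- 2 * (int (s i) * A i i) * int n) = 1"
      unfolding chi_sq by (simp only: power_int_mult power_int_of_nat)
    from qvar_powi_1[OF this] show False using that C5_pos[of i] by (simp add: C1)
  qed
  show "\<exists>i. (\<Sum>j\<leftarrow>w. A i j) > 0" if w: "w \<noteq> []" "braiding.half_twist (chi b) w * braiding.half_twist
      (chi b) w = 1" for w
  proof (rule ccontr)
    assume "\<nexists>i. (\<Sum>j\<leftarrow>w. A i j) > 0"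
    then have "(\<Sum>j\<leftarrow>w. int (s i) * A i j) \<le> 0" for i
      by (simp add: sum_list_const_mult mult_nonneg_nonpos not_less)
    then have "energy w \<le> 0" unfolding energy_def by (intro sum_list_nonpos) auto
    moreover have "(\<Sum>i\<leftarrow>w. 2 * int (s i)) > 0"
      using w(1) C5_pos by (cases w) (auto intro!: add_pos_nonneg sum_list_nonneg)
    moreover have "(\<Sum>i\<leftarrow>w. 2 * int (s i)) - energy w = 0"
      using w(2) unfolding half_twist_chi by (rule qvar_powi_1)
    ultimately show False by simp
  qed
qed

sublocale sp: cartan_braiding "chi b" A for b
  by (rule cartan_chi)

lemma specialize_lderiv: "specialize b (pi_br.lderiv i x) = sp.lderiv b i (specialize b x)"
  by (induction x rule: free_induct)
     (simp_all add: pi_br.lderiv_theta_mult sp.lderiv_theta_mult pi_br.lderiv_simps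
         sp.lderiv_simps specialize_add specialize_scale
       specialize_mult spec_chi)

lemma specialize_lderivs: "specialize b (pi_br.lderivs w x) = sp.lderivs b w (specialize b x)"
  by (induction w arbitrary: x) (simp_all add: specialize_lderiv)

lemma radical_specialize: "x \<in> pi_br.radical \<longleftrightarrow> (\<forall>b. specialize b x \<in> sp.radical b)"
proof
  show "x \<in> pi_br.radical \<Longrightarrow> \<forall>b. specialize b x \<in> sp.radical b"
    by (simp add: pi_br.radical_def sp.radical_def counit_specialize spec_hom flip:
        specialize_lderivs)
  show "\<forall>b. specialize b x \<in> sp.radical b \<Longrightarrow> x \<in> pi_br.radical"
    unfolding pi_br.radical_def sp.radical_def by (auto simp: counit_specialize simp flip:
        specialize_lderivs intro!: spec_eq_0 two_Qq)
qed

lemma form_rad_eq: "form_rad = pi_br.radical"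
proof -
  \<comment> \<open>The inverse of 1 - \<pi>_i q_i^2 by conjugation: the product with 1 + \<pi>_i
    q_i^2 is the scalar 1 - q_i^4, because \<pi>_i squares to 1.\<close>
  define d where "d i = (1 + cpi ^ p i * of_base (q i ^ 2)) * of_base (inverse (1 - q i ^ 4))" for i
  have d: "d i * (1 - cpi ^ p i * of_base (q i ^ 2)) = 1" for i
  proof -
    have c: "(cpi ^ p i * cpi ^ p i :: Qq pi_ext) = 1"
      using cpi_squared[where 'a = Qq] by (simp add: p_def power2_eq_square)
    have "q i ^ 4 \<noteq> 1"
      using qvar_pow_1[of "s i * 4"] C5_pos[of i] by (simp add: q_def power_mult)
    have "d i * (1 - cpi ^ p i * of_base (q i ^ 2)) =
      (1 - (cpi ^ p i * cpi ^ p i) * (of_base (q i ^ 2) * of_base (q i ^ 2))) * of_base (inverse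
          (1 - q i ^ 4))"
      by (simp add: d_def algebra_simps)
    also have "\<dots> = (of_base 1 + of_base (- (q i ^ 4))) * of_base (inverse (1 - q i ^ 4))"
    proof -
      have "of_base (- x) = - of_base x" for x :: Qq by transfer simp
      moreover have "of_base (q i ^ 2) * of_base (q i ^ 2) = (of_base (q i ^ 4) :: Qq pi_ext)"
        by (simp flip: of_base_hom(4) power_add)
      ultimately show ?thesis by (simp only: c of_base_hom(2) mult_1_left diff_conv_add_uminus)
    qed
    also have "\<dots> = 1"
      unfolding of_base_hom(3)[symmetric] of_base_hom(4)[symmetric]
      using \<open>q i ^ 4 \<noteq> 1\<close> by (simp add: of_base_hom(2))
    finally show ?thesis .
  qed
  have "form = pi_br.biform d"
    unfolding form_def
  proof (rule the_equality)
    show "is_form (pi_br.biform d)" using d by (rule is_form_biform)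
    show "B = pi_br.biform d" if "is_form B" for B using that d by (rule is_form_unique)
  qed
  then show ?thesis unfolding form_rad_def using pi_br.biform_rad[OF d] by simp
qed

section \<open>The defining relations\<close>

lemma serre_scale:
  fixes qint :: "'i \<Rightarrow> nat \<Rightarrow> Qq"
  assumes ij: "i \<noteq> j"
    and qint: "\<And>n. qint i n = ((eps b ^ p i) ^ n * q i ^ n - inverse (q i) ^ n) / (eps b ^ p i * q
        i - inverse (q i))"
  shows "sp.serre b i j = scale (\<Prod>m=1..nat (1 - A i j). qint i m) (\<Sum>k=0..nat (1 - A i j).
        scale ((-1) ^ k * (eps b ^ p3 k i j))
          (divpow qint i (nat (1 - A i j) - k) * \<theta> j * divpow qint i k))"
proof -
  define N where "N = nat (- A i j)"
  have N: "nat (1 - A i j) = Suc N" using C2[OF ij] by (simp add: N_def)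
  define G where "G n = (\<Prod>m=1..n. qint i m)" for n
  have tri: "k * (k - 1) div 2 = \<Sum>{..<k}" for k :: nat
  proof -
    have "2 * \<Sum>{..<k} + k = k * k" by (induction k) simp_all
    then have "k * (k - 1) = 2 * \<Sum>{..<k}" by (cases k) simp_all
    then show ?thesis by simp
  qed
  have dp: "divpow qint i n = scale (inverse (G n)) (\<theta> i ^ n)" for n
    by (simp add: divpow_def G_def)
  have serre_coeff: "sp.serre_coeff b i j (Suc N) k = G (Suc N) * ((-1) ^ k * ((eps b ^ (p i * p
      j)) ^ k * (eps b ^ p i) ^ (\<Sum>{..<k})) *
      inverse (G (Suc N - k)) * inverse (G k))" if k: "k \<le> Suc N" for k
    unfolding G_def
  proof (rule sp.serre_coeff_rescale[where Q = "q i"])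
    show "q i \<noteq> 0" by (simp add: q_def qvar_nonzero)
    show "(eps b ^ p i * eps b ^ p i :: Qq) = 1" by (simp add: p_def)
    show "(eps b ^ p i) ^ (k * (Suc N - k)) = (1 :: Qq)"
    proof (cases "i \<in> odd_part \<and> b")
      case True
      \<comment> \<open>As N + 1 is odd, one of k and N + 1 - k is even, so the sign raised to their
        product is 1.\<close>
      then have "even N" using C4[of i j] C2[OF ij] by (simp add: N_def even_nat_iff)
      then have "even (k * (Suc N - k))" using k by auto
      then show ?thesis using True by (simp add: p_def)
    qed (auto simp: p_def)
    show "chi b i i = eps b ^ p i * (inverse (q i))\<^sup>2"
      by (simp add: chi_def C1 q_def p_def power_int_minus power_inverse power_int_mult
          mult.commute[of _ 2]
          flip: power_mult)
    show "chi b i j = eps b ^ (p i * p j) * q i ^ N"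
    proof -
      have "- (int (s i) * A i j) = int (s i * N)" using C2[OF ij] by (simp add: N_def)
      then show ?thesis by (simp add: chi_def q_def power_mult del: of_nat_mult)
    qed
  qed (use k qint in simp_all)
  have "sp.serre b i j = (\<Sum>k\<le>Suc N. scale (sp.serre_coeff b i j (Suc N) k) (\<theta> i ^ (Suc N - k) * \<theta>
      j * \<theta> i ^ k))"
    unfolding sp.serre_def N by (rule sp.ad_pow_serre_coeff)
  also have "\<dots> = (\<Sum>k\<le>Suc N. scale (G (Suc N)) (scale ((-1) ^ k * (eps b ^ p3 k i j))
          (divpow qint i (Suc N - k) * \<theta> j * divpow qint i k)))"
  proof (intro sum.cong refl)
    fix k assume "k \<in> {..Suc N}"
    moreover have "(eps b ^ p3 k i j :: Qq) = (eps b ^ (p i * p j)) ^ k * (eps b ^ p i) ^ (\<Sum>{..<k})"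
      unfolding p3_def tri by (simp add: power_add mult_ac flip: power_mult)
    ultimately show "scale (sp.serre_coeff b i j (Suc N) k) (\<theta> i ^ (Suc N - k) * \<theta> j * \<theta> i ^ k) =
      scale (G (Suc N)) (scale ((-1) ^ k * (eps b ^ p3 k i j)) (divpow qint i (Suc N - k) * \<theta> j *
          divpow qint i k))"
      by (simp only: serre_coeff atMost_iff) (simp add: dp scale_mult scale_scale mult_ac)
  qed
  finally show ?thesis
    by (simp only: N G_def[symmetric] scale_sum atMost_atLeast0)
qed

lemma prod_nz:
  fixes Q e :: Qq
  assumes "e * e = 1" "\<And>n. n > 0 \<Longrightarrow> Q ^ n \<noteq> 1" "Q \<noteq> 0"
  shows "(\<Prod>m=1..n. (e ^ m * Q ^ m - inverse Q ^ m) / (e * Q - inverse Q)) \<noteq> 0"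
proof -
  have "e ^ m * Q ^ m - inverse Q ^ m \<noteq> 0" if "m > 0" for m
  proof
    assume "e ^ m * Q ^ m - inverse Q ^ m = 0"
    then have "e ^ m * Q ^ m * Q ^ m = 1" using assms(3) by (simp add: power_inverse)
    \<comment> \<open>Squaring removes the sign and leaves the equation Q^(4m) = 1.\<close>
    then have "(e ^ m * Q ^ m * Q ^ m) * (e ^ m * Q ^ m * Q ^ m) = 1" by simp
    then have "(e * e) ^ m * Q ^ (4 * m) = 1"
    proof -
      have "4 * m = m + m + m + m" by simp
      then show ?thesis
        using \<open>(e ^ m * Q ^ m * Q ^ m) * (e ^ m * Q ^ m * Q ^ m) = 1\<close>
        by (simp only: power_add power_mult_distrib mult_ac)
    qed
    then show False using assms(2)[of "4 * m"] that assms(1) by simp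
  qed
  from this this[of 1] show ?thesis by simp
qed

lemma q_props: "n > 0 \<Longrightarrow> q i ^ n \<noteq> 1" "q i \<noteq> 0"
  using qvar_pow_1[of "s i * n"] C5_pos[of i] by (simp_all add: q_def qvar_nonzero flip: power_mult)

lemma serre_minus_scale: "i \<noteq> j \<Longrightarrow> \<exists>c. c \<noteq> 0 \<and> sp.serre True i j = scale c (serre_minus i j)"
proof -
  assume ij: "i \<noteq> j"
  have qint: "qint_minus i n = ((eps True ^ p i) ^ n * q i ^ n - inverse (q i) ^ n) / (eps True ^
      p i * q i - inverse (q i))" for n
    by (simp add: qint_minus_def mult.commute[of n] power_mult)
  have "sp.serre True i j = scale (\<Prod>m=1..nat (1 - A i j). qint_minus i m) (serre_minus i j)"
    unfolding serre_minus_def using serre_scale[of i j qint_minus True, OF ij qint] by (simp add: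
        power_add)
  moreover have "(\<Prod>m=1..nat (1 - A i j). qint_minus i m) \<noteq> 0"
    unfolding qint by (rule prod_nz) (simp_all add: q_props p_def)
  ultimately show ?thesis by blast
qed

lemma serre_plus_scale: "i \<noteq> j \<Longrightarrow> \<exists>c. c \<noteq> 0 \<and> sp.serre False i j = scale c (serre_plus i j)"
proof -
  assume ij: "i \<noteq> j"
  have qint: "qint_plus i n = ((eps False ^ p i) ^ n * q i ^ n - inverse (q i) ^ n) / (eps False ^
      p i * q i - inverse (q i))" for n
    by (simp add: qint_plus_def)
  have "sp.serre False i j = scale (\<Prod>m=1..nat (1 - A i j). qint_plus i m) (serre_plus i j)"
    unfolding serre_plus_def using serre_scale[of i j qint_plus False, OF ij qint] by simp
  moreover have "(\<Prod>m=1..nat (1 - A i j). qint_plus i m) \<noteq> 0"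
    unfolding qint by (rule prod_nz) (simp_all add: q_props p_def)
  ultimately show ?thesis by blast
qed

end

section \<open>Quotient algebras\<close>

definition is_alg :: "('k, 'a) module \<Rightarrow> bool" where
  "is_alg M \<longleftrightarrow> ring M \<and>
     (\<forall>c. \<forall>x\<in>carrier M. c \<odot>\<^bsub>M\<^esub> x \<in> carrier M) \<and>
     (\<forall>c. \<forall>x\<in>carrier M. \<forall>y\<in>carrier M. c \<odot>\<^bsub>M\<^esub> (x \<oplus>\<^bsub>M\<^esub> y) = c \<odot>\<^bsub>M\<^esub> x \<oplus>\<^bsub>M\<^esub> c \<odot>\<^bsub>M\<^esub> y) \<and>
     (\<forall>c. \<forall>x\<in>carrier M. \<forall>y\<in>carrier M. c \<odot>\<^bsub>M\<^esub> (x \<otimes>\<^bsub>M\<^esub> y) = (c \<odot>\<^bsub>M\<^esub> x) \<otimes>\<^bsub>M\<^esub> y)"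

definition alg_epi :: "('k, 'a) module \<Rightarrow> ('k, 'b) module \<Rightarrow> ('a \<Rightarrow> 'b) \<Rightarrow> bool" where
  "alg_epi M N f \<longleftrightarrow> f \<in> ring_hom M N \<and> f ` carrier M = carrier N \<and>
     (\<forall>c. \<forall>x\<in>carrier M. f (c \<odot>\<^bsub>M\<^esub> x) = c \<odot>\<^bsub>N\<^esub> f x)"

text \<open>Algebra records over different scalar types cannot be equated, so the ring structure is
  transported field by field.\<close>

lemma ring_cong:
  assumes "ring R" "carrier S = carrier R" "monoid.mult S = monoid.mult R" "one S = one R"
    "zero S = zero R" "add S = add R"
  shows "ring S"
proof -
  interpret ring R by fact
  show ?thesis
  proof (intro ringI abelian_groupI monoidI)
    show "\<exists>y\<in>carrier S. y \<oplus>\<^bsub>S\<^esub> x = \<zero>\<^bsub>S\<^esub>" if "x \<in> carrier S" for x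
      using that l_neg[of x] a_inv_closed[of x] unfolding assms by blast
  qed (auto simp: assms a_ac m_assoc l_distr r_distr)
qed

lemma ideal_cong:
  assumes "ideal J R" "ring R" "carrier S = carrier R" "monoid.mult S = monoid.mult R" "one S =
      one R"
    "zero S = zero R" "add S = add R"
  shows "ideal J S"
proof -
  have S: "ring S" by (rule ring_cong) (use assms in simp_all)
  interpret J: ideal J R by fact
  show ?thesis
  proof (rule idealI[OF S])
    show "subgroup J (add_monoid S)"
    proof (rule group.subgroupI)
      show "group (add_monoid S)" using S abelian_group.a_group ring.is_abelian_group by blast
      show "J \<subseteq> carrier (add_monoid S)" using J.a_subset by (simp add: assms)
      show "J \<noteq> {}" using additive_subgroup.zero_closed[OF J.is_additive_subgroup] by blast
      show "inv\<^bsub>add_monoid S\<^esub> a \<in> J" if "a \<in> J" for a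
      proof -
        have "inv\<^bsub>add_monoid S\<^esub> a = \<ominus>\<^bsub>R\<^esub> a"
          by (simp add: a_inv_def m_inv_def assms)
        then show ?thesis using that by simp
      qed
      show "a \<otimes>\<^bsub>add_monoid S\<^esub> b \<in> J" if "a \<in> J" "b \<in> J" for a b
        using that by (simp add: assms)
    qed
  qed (simp_all add: assms J.I_l_closed J.I_r_closed)
qed

lemma quot_alg_simps:
  "carrier (quot_alg M J) = carrier (M Quot J)"
  "monoid.mult (quot_alg M J) = monoid.mult (M Quot J)"
  "one (quot_alg M J) = one (M Quot J)"
  "zero (quot_alg M J) = zero (M Quot J)"
  "add (quot_alg M J) = add (M Quot J)"
  "c \<odot>\<^bsub>quot_alg M J\<^esub> X = (\<Union>x\<in>X. J +>\<^bsub>M\<^esub> (c \<odot>\<^bsub>M\<^esub> x))"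
  by (simp_all add: quot_alg_def ring.extend_def module.fields_def)

lemma restrict_scalars_simps:
  "carrier (restrict_scalars h M) = carrier M"
  "monoid.mult (restrict_scalars h M) = monoid.mult M"
  "one (restrict_scalars h M) = one M"
  "zero (restrict_scalars h M) = zero M"
  "add (restrict_scalars h M) = add M"
  "c \<odot>\<^bsub>restrict_scalars h M\<^esub> x = h c \<odot>\<^bsub>M\<^esub> x"
  by (simp_all add: restrict_scalars_def ring.extend_def ring.truncate_def module.fields_def)

lemma is_alg_restrict_scalars: "is_alg M \<Longrightarrow> is_alg (restrict_scalars h M)"
  unfolding is_alg_def
  by (auto simp: restrict_scalars_simps intro: ring_cong[of M])

lemma alg_epi_restrict_scalars:
  "alg_epi M N f \<Longrightarrow> alg_epi (restrict_scalars h M) (restrict_scalars h N) f"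
  by (auto simp: alg_epi_def ring_hom_def restrict_scalars_simps)

lemma alg_epi_compose: "alg_epi M N f \<Longrightarrow> alg_epi N P g \<Longrightarrow> alg_epi M P (g \<circ> f)"
  unfolding alg_epi_def by (auto simp: ring_hom_def Pi_iff simp flip: image_image)

text \<open>Scalars act as multiplication by c times 1, so every ring ideal is stable under
  them.\<close>

lemma ideal_smult: 
  assumes "is_alg M" "ideal J M" "x \<in> J" shows "c \<odot>\<^bsub>M\<^esub> x \<in> J"
proof -
  interpret ideal J M by fact
  have "x \<in> carrier M" using assms(3) by (rule a_Hcarr)
  then have "c \<odot>\<^bsub>M\<^esub> x = (c \<odot>\<^bsub>M\<^esub> \<one>\<^bsub>M\<^esub>) \<otimes>\<^bsub>M\<^esub> x" "c \<odot>\<^bsub>M\<^esub> \<one>\<^bsub>M\<^esub> \<in> carrier M"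
    using assms(1) unfolding is_alg_def by (metis l_one one_closed)+
  then show ?thesis using I_l_closed[OF assms(3)] by simp
qed

lemma quot_alg:
  assumes M: "is_alg M" and J: "ideal J M"
  shows "is_alg (quot_alg M J)" "alg_epi M (quot_alg M J) ((+>\<^bsub>M\<^esub>) J)"
    "\<And>x y. x \<in> carrier M \<Longrightarrow> y \<in> carrier M \<Longrightarrow>
       J +>\<^bsub>M\<^esub> x = J +>\<^bsub>M\<^esub> y \<longleftrightarrow> x \<ominus>\<^bsub>M\<^esub> y \<in> J"
proof -
  interpret ideal J M by fact
  show coset: "J +>\<^bsub>M\<^esub> x = J +>\<^bsub>M\<^esub> y \<longleftrightarrow> x \<ominus>\<^bsub>M\<^esub> y \<in> J" if "x \<in> carrier M" "y \<in> carrier M" for x y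
    using quotient_eq_iff_same_a_r_cos[OF J that] by blast
  have hom: "(+>\<^bsub>M\<^esub>) J \<in> ring_hom M (quot_alg M J)"
    using rcos_ring_hom by (simp add: ring_hom_def quot_alg_simps)
  have surj: "carrier (quot_alg M J) = (+>\<^bsub>M\<^esub>) J ` carrier M"
    by (auto simp: quot_alg_simps FactRing_def A_RCOSETS_def')
  have closed: "c \<odot>\<^bsub>M\<^esub> x \<in> carrier M" if "x \<in> carrier M" for c x
    using M that by (simp add: is_alg_def)
  have add: "c \<odot>\<^bsub>M\<^esub> (x \<oplus>\<^bsub>M\<^esub> y) = c \<odot>\<^bsub>M\<^esub> x \<oplus>\<^bsub>M\<^esub> c \<odot>\<^bsub>M\<^esub> y" if "x \<in> carrier M" "y \<in> carrier M" for c
      x y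
    using M that by (simp add: is_alg_def)
  \<comment> \<open>The scalar action on cosets is a union over representatives; since J is stable
    under scalars, all of them yield the same coset.\<close>
  have smult: "c \<odot>\<^bsub>quot_alg M J\<^esub> (J +>\<^bsub>M\<^esub> x) = J +>\<^bsub>M\<^esub> (c \<odot>\<^bsub>M\<^esub> x)" if x: "x \<in> carrier M" for c x
  proof -
    have "J +>\<^bsub>M\<^esub> (c \<odot>\<^bsub>M\<^esub> y) = J +>\<^bsub>M\<^esub> (c \<odot>\<^bsub>M\<^esub> x)" if "y \<in> J +>\<^bsub>M\<^esub> x" for y
    proof -
      from that obtain h where h: "h \<in> J" "y = h \<oplus>\<^bsub>M\<^esub> x" by (auto simp: a_r_coset_def')
      then have hc: "h \<in> carrier M" by (simp add: a_Hcarr)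
      have ch: "c \<odot>\<^bsub>M\<^esub> h \<in> J" by (rule ideal_smult[OF M J h(1)])
      have "c \<odot>\<^bsub>M\<^esub> y \<ominus>\<^bsub>M\<^esub> c \<odot>\<^bsub>M\<^esub> x = c \<odot>\<^bsub>M\<^esub> h"
        using closed[OF hc, of c] closed[OF x, of c]
        by (simp add: h(2) add hc x a_minus_def a_assoc r_neg)
      then show ?thesis using ch coset[OF closed closed] x hc h(2) by simp
    qed
    moreover have "x \<in> J +>\<^bsub>M\<^esub> x" using a_rcos_self[OF x] .
    ultimately show ?thesis unfolding quot_alg_simps by (intro SUP_eq_const) blast+
  qed
  show epi: "alg_epi M (quot_alg M J) ((+>\<^bsub>M\<^esub>) J)"
    using hom surj smult by (simp add: alg_epi_def)
  have R: "ring (quot_alg M J)"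
    by (rule ring_cong[OF quotient_is_ring]) (simp_all add: quot_alg_simps)
  have h: "J +>\<^bsub>M\<^esub> (x \<oplus>\<^bsub>M\<^esub> y) = (J +>\<^bsub>M\<^esub> x) \<oplus>\<^bsub>quot_alg M J\<^esub> (J +>\<^bsub>M\<^esub> y)"
    "J +>\<^bsub>M\<^esub> (x \<otimes>\<^bsub>M\<^esub> y) = (J +>\<^bsub>M\<^esub> x) \<otimes>\<^bsub>quot_alg M J\<^esub> (J +>\<^bsub>M\<^esub> y)"
    if "x \<in> carrier M" "y \<in> carrier M" for x y
    using ring_hom_add[OF hom that] ring_hom_mult[OF hom that] by simp_all
  have mult: "c \<odot>\<^bsub>M\<^esub> (x \<otimes>\<^bsub>M\<^esub> y) = (c \<odot>\<^bsub>M\<^esub> x) \<otimes>\<^bsub>M\<^esub> y" if "x \<in> carrier M" "y \<in> carrier M" for c x y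
    using M that by (simp add: is_alg_def)
  show "is_alg (quot_alg M J)"
    unfolding is_alg_def surj
    using R by (auto simp: smult closed add mult simp flip: h)
qed

text \<open>Two surjections with the same fibres have isomorphic targets. This treats a quotient of
  a quotient without describing cosets of cosets.\<close>

lemma alg_iso_of_epis:
  assumes f: "alg_epi M N f" and g: "alg_epi M P g" and M: "is_alg M"
    and ker: "\<And>x y. x \<in> carrier M \<Longrightarrow> y \<in> carrier M \<Longrightarrow> f x = f y \<longleftrightarrow> g x = g y"
  shows "\<exists>\<phi>. \<phi> \<in> alg_iso N P"
proof -
  interpret ring M using M by (simp add: is_alg_def)
  \<comment> \<open>The choice of representative does not matter, because \<open>ker\<close> makes g
    constant on the fibres of f.\<close>
  define \<phi> where "\<phi> X = g (SOME x. x \<in> carrier M \<and> f x = X)" for X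
  have \<phi>: "\<phi> (f x) = g x" if "x \<in> carrier M" for x
  proof -
    have "(SOME y. y \<in> carrier M \<and> f y = f x) \<in> carrier M \<and> f (SOME y. y \<in> carrier M \<and> f y = f x)
        = f x"
      by (rule someI[of _ x]) (simp add: that)
    then show ?thesis using ker that unfolding \<phi>_def by blast
  qed
  have N: "carrier N = f ` carrier M" and P: "carrier P = g ` carrier M"
    and fh: "f \<in> ring_hom M N" and gh: "g \<in> ring_hom M P"
    and fs: "\<And>c x. x \<in> carrier M \<Longrightarrow> c \<odot>\<^bsub>N\<^esub> f x = f (c \<odot>\<^bsub>M\<^esub> x)" 
    and gs: "\<And>c x. x \<in> carrier M \<Longrightarrow> g (c \<odot>\<^bsub>M\<^esub> x) = c \<odot>\<^bsub>P\<^esub> g x" 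
    using f g by (auto simp: alg_epi_def)
  have cl: "c \<odot>\<^bsub>M\<^esub> x \<in> carrier M" if "x \<in> carrier M" for c x
    using M that by (simp add: is_alg_def)
  have "\<phi> \<in> ring_hom N P"
    unfolding ring_hom_def N
    by (auto simp: \<phi> P ring_hom_mult[OF gh] ring_hom_add[OF gh] ring_hom_one[OF gh]
        simp flip: ring_hom_mult[OF fh] ring_hom_add[OF fh] ring_hom_one[OF fh])
  moreover have "bij_betw \<phi> (carrier N) (carrier P)"
    unfolding bij_betw_def inj_on_def N P by (auto simp: \<phi> ker image_iff)
  ultimately have "\<phi> \<in> alg_iso N P"
    unfolding alg_iso_def ring_iso_def by (auto simp: N fs gs \<phi> cl)
  then show ?thesis by blast
qed

lemma is_alg_free_alg: "is_alg free_alg"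
  using free_alg_ring unfolding is_alg_def by (simp add: free_alg_def scale_add scale_mult)

lemma ideal_free_alg:
  fixes I :: "('i, 'k::comm_ring_1) free set"
  assumes "0 \<in> I" "\<And>x y. x \<in> I \<Longrightarrow> y \<in> I \<Longrightarrow> x + y \<in> I"
    "\<And>x y. x \<in> I \<Longrightarrow> y * x \<in> I" "\<And>x y. x \<in> I \<Longrightarrow> x * y \<in> I"
  shows "ideal I free_alg"
proof (rule idealI[OF free_alg_ring])
  have G: "group (add_monoid (free_alg :: ('k, ('i, 'k) free) module))"
    using abelian_group.a_group ring.is_abelian_group free_alg_ring by blast
  show "subgroup I (add_monoid free_alg)"
  proof (rule group.subgroupI[OF G])
    fix a assume a: "a \<in> I"
    have "inv\<^bsub>add_monoid free_alg\<^esub> a = - a"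
      by (rule group.inv_equality[OF G]) (simp_all add: free_alg_def)
    then show "inv\<^bsub>add_monoid free_alg\<^esub> a \<in> I" using assms(3)[OF a, of "- 1"] by simp
  qed (use assms in \<open>auto simp: free_alg_def\<close>)
qed (use assms in \<open>simp_all add: free_alg_def\<close>)

lemma minus_free_alg: "x \<ominus>\<^bsub>free_alg\<^esub> y = x - y"
proof -
  have "\<ominus>\<^bsub>free_alg\<^esub> y = - y"
    by (rule abelian_group.minus_equality[OF ring.is_abelian_group[OF free_alg_ring]])
       (simp_all add: free_alg_def)
  then show ?thesis by (simp add: a_minus_def) (simp add: free_alg_def)
qed

context super_cartan_datum
begin

lemma serre_ideal_eq_Idl:
  assumes "\<And>i j. i \<noteq> j \<Longrightarrow> \<exists>c. c \<noteq> 0 \<and> sp.serre b i j = scale c (g i j)"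
  shows "sp.serre_ideal b = Idl\<^bsub>free_alg\<^esub> {g i j | i j. i \<noteq> j}"
proof
  let ?G = "{g i j | i j. i \<noteq> j}"
  have id: "ideal (Idl\<^bsub>free_alg\<^esub> ?G) free_alg"
    by (rule ring.genideal_ideal[OF free_alg_ring]) (simp add: free_alg_def)
  interpret J: ideal "Idl\<^bsub>free_alg\<^esub> ?G" free_alg by (rule id)
  have sub: "?G \<subseteq> Idl\<^bsub>free_alg\<^esub> ?G"
    by (rule ring.genideal_self[OF free_alg_ring]) (simp add: free_alg_def)
  show "sp.serre_ideal b \<subseteq> Idl\<^bsub>free_alg\<^esub> ?G"
  proof
    fix x assume "x \<in> sp.serre_ideal b"
    then show "x \<in> Idl\<^bsub>free_alg\<^esub> ?G"
    proof induction
      case (gen i j)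
      then obtain c where c: "sp.serre b i j = scale c (g i j)" using assms by blast
      have "g i j \<in> Idl\<^bsub>free_alg\<^esub> ?G" using sub gen by blast
      from ideal_smult[OF is_alg_free_alg id this, of c] show ?case by (simp add: c free_alg_def)
    next
      case zero
      show ?case using additive_subgroup.zero_closed[OF J.is_additive_subgroup] by (simp add:
          free_alg_def)
    next
      case (add x y)
      then show ?case
        using additive_subgroup.a_closed[OF J.is_additive_subgroup, of x y] by (simp add:
            free_alg_def)
    next
      case (left x y)
      then show ?case using J.I_l_closed[of x y] by (simp add: free_alg_def)
    next
      case (right x y)
      then show ?case using J.I_r_closed[of x y] by (simp add: free_alg_def)
    qed
  qed
  show "Idl\<^bsub>free_alg\<^esub> ?G \<subseteq> sp.serre_ideal b"
  proof (rule ring.genideal_minimal[OF free_alg_ring])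
    show "ideal (sp.serre_ideal b) free_alg"
      by (rule ideal_free_alg) (simp_all add: sp.serre_ideal.intros)
    show "?G \<subseteq> sp.serre_ideal b"
    proof safe
      fix i j :: 'i assume ij: "i \<noteq> j"
      then obtain c where c: "c \<noteq> 0" "sp.serre b i j = scale c (g i j)" using assms by blast
      have "scale (inverse c) (sp.serre b i j) \<in> sp.serre_ideal b"
        by (intro sp.serre_ideal_simps sp.serre_ideal.gen ij)
      then show "g i j \<in> sp.serre_ideal b" using c by (simp add: scale_scale)
    qed
  qed
qed

lemma form_rad_iff: "x \<in> form_rad \<longleftrightarrow> (\<forall>b. specialize b x \<in> sp.serre_ideal b)"
  by (simp add: form_rad_eq radical_specialize sp.radical_eq_serre_ideal)

lemma ideal_form_rad: "ideal form_rad free_alg"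
  by (rule ideal_free_alg) (simp_all add: form_rad_iff specialize_add specialize_mult
      sp.serre_ideal.intros)

text \<open>The element \<open>1 - u c\<close> in the proof is the idempotent of \<open>\<rat>(q)\<^sup>\<pi>\<close> with values 1 and 0 under
  \<open>spec b\<close> and \<open>spec (\<not> b)\<close>.\<close>

lemma f_pi_mod_iso:
  assumes u: "spec b u = 0" "spec (\<not> b) u \<noteq> 0" and g: "sp.serre_ideal b = Idl\<^bsub>free_alg\<^esub> G"
  shows "\<exists>\<phi>. \<phi> \<in> alg_iso (f_pi_mod u) (quot_alg free_alg (Idl\<^bsub>free_alg\<^esub> G))"
proof -
  let ?R = "free_alg :: (Qq pi_ext, ('i, Qq pi_ext) free) module"
  let ?\<pi> = "(+>\<^bsub>?R\<^esub>) form_rad"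
  let ?P' = "restrict_scalars of_base f_pi"
  let ?R' = "restrict_scalars of_base ?R"
  define I where "I = Idl\<^bsub>f_pi\<^esub> {u \<odot>\<^bsub>f_pi\<^esub> \<one>\<^bsub>f_pi\<^esub>}"
  have P: "is_alg f_pi" and epi: "alg_epi ?R f_pi ?\<pi>"
    and coset: "\<And>x y. ?\<pi> x = ?\<pi> y \<longleftrightarrow> x - y \<in> form_rad"
    using quot_alg[OF is_alg_free_alg ideal_form_rad]
    by (simp_all add: f_pi_def minus_free_alg) (simp_all add: free_alg_def)
  have ringP: "ring f_pi" using P by (simp add: is_alg_def)
  have hom: "?\<pi> \<in> ring_hom ?R f_pi" and carP: "carrier f_pi = range ?\<pi>"
    and sm: "\<And>c x. ?\<pi> (scale c x) = c \<odot>\<^bsub>f_pi\<^esub> ?\<pi> x"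
    using epi by (auto simp: alg_epi_def free_alg_def)
  interpret h: ring_hom_ring ?R f_pi ?\<pi>
    by (intro ring_hom_ringI2 free_alg_ring ringP hom)
  have one: "?\<pi> 1 = \<one>\<^bsub>f_pi\<^esub>" and mul: "?\<pi> (x * y) = ?\<pi> x \<otimes>\<^bsub>f_pi\<^esub> ?\<pi> y"
    and add: "?\<pi> x \<oplus>\<^bsub>f_pi\<^esub> ?\<pi> y = ?\<pi> (x + y)" for x y
    using ring_hom_one[OF hom] ring_hom_mult[OF hom, of x y] ring_hom_add[OF hom, of x y]
    by (simp_all add: free_alg_def)
  have u1: "u \<odot>\<^bsub>f_pi\<^esub> \<one>\<^bsub>f_pi\<^esub> = ?\<pi> (scale u 1)" by (simp add: sm one)
  have idI: "ideal I f_pi"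
    unfolding I_def by (rule ring.genideal_ideal[OF ringP]) (auto simp: u1 carP)
  have uI: "?\<pi> (scale u 1) \<in> I"
    unfolding I_def u1 by (rule ring.genideal_self'[OF ringP]) (simp add: carP)
  \<comment> \<open>The generated ideal is bounded from above by an ideal containing the generator,
    the image of the elements that specialize into the Serre ideal; this contains u because u
    specializes to 0.\<close>
  have I_sub: "I \<subseteq> ?\<pi> ` {z. specialize b z \<in> sp.serre_ideal b}"
    unfolding I_def
  proof (rule ring.genideal_minimal[OF ringP])
    have idz: "ideal {z. specialize b z \<in> sp.serre_ideal b} ?R"
      by (rule ideal_free_alg) (simp_all add: specialize_add specialize_mult sp.serre_ideal.intros)
    show "ideal (?\<pi> ` {z. specialize b z \<in> sp.serre_ideal b}) f_pi"
    proof (rule idealI[OF ringP])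
      show "subgroup (?\<pi> ` {z. specialize b z \<in> sp.serre_ideal b}) (add_monoid f_pi)"
        using additive_subgroup.a_subgroup[OF ideal.axioms(1)[OF idz]]
        by (rule h.img_is_add_subgroup)
    qed (auto simp: carP image_iff simp flip: mul, (metis mul specialize_mult sp.serre_ideal.left
        sp.serre_ideal.right)+)
    show "{u \<odot>\<^bsub>f_pi\<^esub> \<one>\<^bsub>f_pi\<^esub>} \<subseteq> ?\<pi> ` {z. specialize b z \<in> sp.serre_ideal b}"
      unfolding u1 by (auto simp: specialize_scale u scale_0 sp.serre_ideal.zero)
  qed
  have key: "?\<pi> z \<in> I \<longleftrightarrow> specialize b z \<in> sp.serre_ideal b" for z
  proof
    assume "?\<pi> z \<in> I"
    then obtain z' where z': "?\<pi> z = ?\<pi> z'" "specialize b z' \<in> sp.serre_ideal b" using I_sub by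
        blast
    then have "specialize b (z - z') \<in> sp.serre_ideal b" using coset form_rad_iff by blast
    from sp.serre_ideal.add[OF this z'(2)] show "specialize b z \<in> sp.serre_ideal b" by (simp add:
        specialize_diff)
  next
    assume z: "specialize b z \<in> sp.serre_ideal b"
    define c where "c = (of_base (inverse (spec (\<not> b) u)) :: Qq pi_ext)"
    have "specialize b' (z - scale (u * c) z) \<in> sp.serre_ideal b'" for b'
      using z u by (cases "b' = b") (auto simp: specialize_diff specialize_scale spec_hom scale_0
          c_def sp.serre_ideal.zero)
    then have "?\<pi> z = ?\<pi> (scale (u * c) z)" by (simp add: coset form_rad_iff)
    also have "\<dots> = ?\<pi> (scale u 1) \<otimes>\<^bsub>f_pi\<^esub> ?\<pi> (scale c z)"
      by (simp add: scale_mult scale_scale mult.commute flip: mul)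
    also have "\<dots> \<in> I"
      by (rule ideal.I_r_closed[OF idI uI]) (simp add: carP)
    finally show "?\<pi> z \<in> I" .
  qed
  have R': "is_alg ?R'" by (rule is_alg_restrict_scalars[OF is_alg_free_alg])
  have P': "is_alg ?P'" by (rule is_alg_restrict_scalars[OF P])
  have idI': "ideal I ?P'"
    by (rule ideal_cong[OF idI ringP]) (simp_all add: restrict_scalars_simps)
  have epi': "alg_epi ?R' ?P' ?\<pi>" by (rule alg_epi_restrict_scalars[OF epi])
  have carR': "carrier ?R' = UNIV" by (simp add: restrict_scalars_simps free_alg_def)
  have hom': "?\<pi> \<in> ring_hom ?R' ?P'" using epi' by (simp add: alg_epi_def)
  interpret h': ring_hom_ring ?R' ?P' ?\<pi>
    using P' R' by (intro ring_hom_ringI2 hom') (simp_all only: is_alg_def)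
  \<comment> \<open>The common source is the free algebra over the covering ring, viewed over the
    base field. It maps onto the left-hand side through two quotients and onto the right-hand side
    through specialization, so only kernels remain to be compared.\<close>
  have e1: "alg_epi ?R' (f_pi_mod u) ((+>\<^bsub>?P'\<^esub>) I \<circ> ?\<pi>)"
    unfolding f_pi_mod_def I_def[symmetric]
    by (rule alg_epi_compose[OF epi' quot_alg(2)[OF P' idI']])
  have "alg_epi ?R' (free_alg :: (Qq, ('i, Qq) free) module) (specialize b)"
  proof -
    have "range (specialize b :: ('i, Qq pi_ext) free \<Rightarrow> _) = UNIV"
      using specialize_surj[of b] by (metis surj_def)
    then show ?thesis
      unfolding alg_epi_def
      by (auto simp: ring_hom_def restrict_scalars_simps free_alg_def specialize_mult
          specialize_add specialize_scale)
  qed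
  moreover have ids: "ideal (Idl\<^bsub>free_alg\<^esub> G) free_alg"
    by (rule ring.genideal_ideal[OF free_alg_ring]) (simp add: free_alg_def)
  ultimately have e2: "alg_epi ?R' (quot_alg free_alg (Idl\<^bsub>free_alg\<^esub> G)) ((+>\<^bsub>free_alg\<^esub>)
      (Idl\<^bsub>free_alg\<^esub> G) \<circ> specialize b)"
    by (rule_tac alg_epi_compose[OF _ quot_alg(2)[OF is_alg_free_alg]])
  show ?thesis
  proof (rule alg_iso_of_epis[OF e1 e2 R'])
    fix x y
    have "\<ominus>\<^bsub>?R'\<^esub> y = - y"
      by (rule h'.R.minus_equality) (simp_all add: restrict_scalars_simps free_alg_def)
    then have "\<ominus>\<^bsub>?P'\<^esub> ?\<pi> y = ?\<pi> (- y)"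
      using h'.hom_a_inv[of y] by (simp add: carR')
    then have "?\<pi> x \<ominus>\<^bsub>?P'\<^esub> ?\<pi> y = ?\<pi> (x - y)"
      by (simp add: a_minus_def restrict_scalars_simps(5) add)
    moreover have "?\<pi> x \<in> carrier ?P'" for x
      using h'.hom_closed[of x] by (simp add: carR')
    ultimately have "(I +>\<^bsub>?P'\<^esub> ?\<pi> x = I +>\<^bsub>?P'\<^esub> ?\<pi> y) \<longleftrightarrow> ?\<pi> (x - y) \<in> I"
      using quot_alg(3)[OF P' idI', of "?\<pi> x" "?\<pi> y"] by simp
    also have "\<dots> \<longleftrightarrow> specialize b x - specialize b y \<in> Idl\<^bsub>free_alg\<^esub> G"
      by (simp add: key specialize_diff g)
    also have "\<dots> \<longleftrightarrow> Idl\<^bsub>free_alg\<^esub> G +>\<^bsub>free_alg\<^esub> specialize b x = Idl\<^bsub>free_alg\<^esub> G +>\<^bsub>free_alg\<^esub>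
        specialize b y"
      using quot_alg(3)[OF is_alg_free_alg ids, of "specialize b x" "specialize b y"]
      by (simp add: minus_free_alg) (simp add: free_alg_def)
    finally show "((+>\<^bsub>?P'\<^esub>) I \<circ> ?\<pi>) x = ((+>\<^bsub>?P'\<^esub>) I \<circ> ?\<pi>) y \<longleftrightarrow>
      ((+>\<^bsub>free_alg\<^esub>) (Idl\<^bsub>free_alg\<^esub> G) \<circ> specialize b) x = ((+>\<^bsub>free_alg\<^esub>) (Idl\<^bsub>free_alg\<^esub> G) \<circ>
          specialize b) y"
      by simp
  qed
qed

end

theorem theorem3p9:
  fixes A :: "'i::finite \<Rightarrow> 'i \<Rightarrow> int" and s :: "'i \<Rightarrow> nat" and odd_part :: "'i set"
  assumes "super_cartan_datum A s odd_part"
  shows "(\<exists>\<phi>. \<phi> \<in> alg_iso (cartan_data.f_pi_mod A s odd_part (cpi + 1))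
                         (cartan_data.f_minus A s odd_part)) \<and>
         (\<exists>\<psi>. \<psi> \<in> alg_iso (cartan_data.f_pi_mod A s odd_part (cpi - 1))
                         (cartan_data.f_plus A s))"
proof -
  interpret super_cartan_datum A s odd_part by fact
  show ?thesis
  proof
    \<comment> \<open>The element \<pi> + 1 is 0 at \<pi> = -1 and 2 at \<pi> = 1; for \<pi> - 1
      below the values are -2 and 0.\<close>
    show "\<exists>\<phi>. \<phi> \<in> alg_iso (f_pi_mod (cpi + 1)) f_minus"
      unfolding f_minus_def
      by (rule f_pi_mod_iso[of True, OF _ _ serre_ideal_eq_Idl[OF serre_minus_scale]])
         (simp_all add: spec_hom two_Qq)
    show "\<exists>\<psi>. \<psi> \<in> alg_iso (f_pi_mod (cpi - 1)) f_plus"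
      unfolding f_plus_def
      by (rule f_pi_mod_iso[of False, OF _ _ serre_ideal_eq_Idl[OF serre_plus_scale]])
         (simp_all add: spec_hom two_Qq)
  qed
qed

end
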